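(* Let $A\in\mathbb R^{n\times n}$, $B\in\mathbb R^n$, $G\in\mathbb R^{n\times n}$, $c\in\mathbb R^n$, $r\ge0$, $\tau\ge0$ with $r+\tau>0$, and suppose that $k,p\in\mathbb R^n$ are vectors such that the matrices $A+Bk'$ and $A+pc'$ are Hurwitz. Then for all sufficiently small holding periods $T_2>0$ and all sufficiently small $T_1>0$ there exist constants $\sigma>0$, $\Theta_i>0$ ($i=1,\dots,6$) and a non-decreasing function $M\in C^0(\mathbb R_+;\mathbb R_+)$ such that for every $x_0\in C^0([-r,0];\mathbb R^n)$, $u_0\in L^\infty([-r-\tau,0);\mathbb R)$, $(z_0,w_0)\in\mathbb R^n\times\mathbb R$ and $(\xi,b,d)\in L^\infty_{loc}(\mathbb R_+;\mathbb R\times\mathbb R_+\times\mathbb R^n)$, the solution $(T_r(t)x,\breve T_{r+\tau}(t)u,z(t),w(t))$ of the closed-loop system consisting of the plant $$\dot x(t)=Ax(t)+Bu(t-\tau)+Gd(t),$$ the observer $$\begin{aligned}&\dot z(t)=Az(t)+Bu(t-r-\tau)+p\,(c'z(t)-w(t)),\\&\dot w(t)=c'Az(t)+c'Bu(t-r-\tau),\quad t\in[\tau_i,\tau_{i+1}),\\&w(\tau_{i+1})=c'x(\tau_{i+1}-r)+\xi(\tau_{i+1}),\qquad \tau_{i+1}=\tau_i+T_1\exp(-b(\tau_i)),\quad\tau_0=0,\end{aligned}$$ and the feedback law $$u(t)=k'\exp(A(r+\tau))z(iT_2)+\int_{-r-\tau}^0k'\exp(-As)Bu(iT_2+s)\,ds,\quad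 t\in[iT_2,(i+1)T_2),\ i\in\mathbb Z^+,$$ with initial condition $\breve T_{r+\tau}(0)u=u_0$, $T_r(0)x=x_0$, $(z(0),w(0))=(z_0,w_0)$ and corresponding to the inputs $(\xi,b,d)$ satisfies for all $t\ge0$: $$\begin{aligned}|z(t)|+|w(t)|+\|T_r(t)x\|_r+\|\breve T_{r+\tau}(t)u\|_{r+\tau}\le{}& e^{-\sigma t}M\Big(\sup_{0\le s\le jT_2+\tau}b(s)\Big)\big(\Theta_1|z_0|+\Theta_2|w_0|+\Theta_3\|x_0\|_r+\Theta_4\|u_0\|_{r+\tau}\big)\\&+M\Big(\sup_{0\le s\le jT_2+\tau}b(s)\Big)\Theta_5\sup_{0\le s\le t}\big(e^{-\sigma(t-s)}|\xi(s)|\big)\\&+M\Big(\sup_{0\le s\le jT_2+\tau}b(s)\Big)\Theta_6\sup_{0\le s\le t}\big(e^{-\sigma(t-s)}|d(s)|\big),\end{aligned}$$ where $j=\min\{i\in\mathbb Z^+: iT_2\ge r+T_1\}$.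
   Context: $\mathbb R_+=[0,\infty)$, $\mathbb Z^+=\{0,1,2,\dots\}$; $|\cdot|$ is the Euclidean norm; $'$ denotes transpose. $L^\infty(I;U)$ (resp. $L^\infty_{loc}(I;U)$) is the space of measurable and bounded (resp. locally bounded) functions on the interval $I$ with values in $U$; suprema are actual suprema, not essential ones. For a function $x$, $(T_r(t)x)(s)=x(t+s)$ for $s\in[-r,0]$ and $(\breve T_r(t)x)(s)=x(t+s)$ for $s\in[-r,0)$; $\|x\|_r$ denotes $\sup|x(s)|$ over $[-r,0]$ or $[-r,0)$, respectively. For $r=0$, $C^0([-r,0];\mathbb R^n)=\mathbb R^n$. The input $u$ is scalar, $d$ is a disturbance, $\xi$ a measurement error, and $b\ge0$ an arbitrary perturbation of the sampling schedule, so that the sampling intervals have length at most $T_1$. $\tau$ is the input delay, $r$ the measurement delay. *)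

theory Defs
  imports "HOL-Analysis.Analysis"
begin

section \<open>Matrices\<close>

text \<open>The class-based product and power on \<open>real ^ 'n ^ 'n\<close> are componentwise, so the
  exponential series is written with the matrix product \<open>**\<close>.\<close>

definition matrix_exp :: "real ^ 'n ^ 'n \<Rightarrow> real ^ 'n ^ 'n" where
  "matrix_exp A = (\<Sum>i. (1 / fact i) *\<^sub>R (((**) A ^^ i) (mat 1)))"

text \<open>\<open>outer v w\<close> is the product $v w'$.\<close>

definition outer :: "real ^ 'n \<Rightarrow> real ^ 'n \<Rightarrow> real ^ 'n ^ 'n" where
  "outer v w = columnvector v ** (rowvector w :: real ^ 'n ^ 1)"

definition hurwitz :: "real ^ 'n ^ 'n \<Rightarrow> bool" where
  "hurwitz A \<longleftrightarrow>
     (\<forall>(l :: complex) v. v \<noteq> 0 \<and> map_matrix complex_of_real A *v v = l *s v \<longrightarrow> Re l < 0)"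

section \<open>Function spaces\<close>

text \<open>Only the values on \<open>S\<close> matter. Boundedness is pointwise, not up to null sets.\<close>

definition L_inf :: "real set \<Rightarrow> (real \<Rightarrow> 'a :: euclidean_space) set" where
  "L_inf S = {f. f \<in> borel_measurable (lebesgue_on S) \<and> bounded (f ` S)}"

definition L_inf_loc :: "real set \<Rightarrow> (real \<Rightarrow> 'a :: euclidean_space) set" where
  "L_inf_loc S = {f. f \<in> borel_measurable (lebesgue_on S) \<and>
                     (\<forall>K. compact K \<and> K \<subseteq> S \<longrightarrow> bounded (f ` K))}"

definition sup_norm :: "real set \<Rightarrow> (real \<Rightarrow> 'a :: real_normed_vector) \<Rightarrow> real" where
  "sup_norm S f = (SUP s\<in>S. norm (f s))"

text \<open>The history $T_r(t)x$, or $\breve T_r(t)x$, is \<open>hist t x\<close> considered on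
  \<open>{-r..0}\<close>, or on \<open>{-r..<0}\<close>.\<close>

definition hist :: "real \<Rightarrow> (real \<Rightarrow> 'a) \<Rightarrow> real \<Rightarrow> 'a" where
  "hist t x = (\<lambda>s. x (t + s))"

section \<open>Caratheodory solutions\<close>

text \<open>Absolute continuity on a compact interval; the members of a division are compact
  intervals with pairwise disjoint interiors.\<close>

definition abs_cont_on :: "real \<Rightarrow> real \<Rightarrow> (real \<Rightarrow> 'a :: euclidean_space) \<Rightarrow> bool" where
  "abs_cont_on a b f \<longleftrightarrow>
     (\<forall>\<epsilon>>0. \<exists>\<delta>>0. \<forall>D T. D division_of T \<and> T \<subseteq> {a..b} \<and> (\<Sum>K\<in>D. Sup K - Inf K) < \<delta>
        \<longrightarrow> (\<Sum>K\<in>D. norm (f (Sup K) - f (Inf K))) < \<epsilon>)"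

text \<open>\<open>f\<close> solves $\dot f(t) = g(t)$ on the interval \<open>S\<close>: it is locally absolutely continuous
  and satisfies the equation almost everywhere. The inputs are merely measurable, so the
  equation cannot be required at every point. In the uses below \<open>g\<close> depends on \<open>f\<close>.\<close>

definition solves_on :: "real set \<Rightarrow> (real \<Rightarrow> 'a :: euclidean_space) \<Rightarrow> (real \<Rightarrow> 'a) \<Rightarrow> bool" where
  "solves_on S f g \<longleftrightarrow>
     (\<forall>a b. a \<le> b \<and> {a..b} \<subseteq> S \<longrightarrow> abs_cont_on a b f) \<and>
     (AE t in lebesgue_on S. (f has_vector_derivative g t) (at t within S))"

section \<open>The closed-loop system\<close>

primrec sample_time :: "real \<Rightarrow> (real \<Rightarrow> real) \<Rightarrow> nat \<Rightarrow> real" where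
  "sample_time T1 b 0 = 0"
| "sample_time T1 b (Suc i) = sample_time T1 b i + T1 * exp (- b (sample_time T1 b i))"

definition plant ::
  "real ^ 'n ^ 'n \<Rightarrow> real ^ 'n \<Rightarrow> real ^ 'n ^ 'n \<Rightarrow> real \<Rightarrow> (real \<Rightarrow> real ^ 'n)
     \<Rightarrow> (real \<Rightarrow> real ^ 'n) \<Rightarrow> (real \<Rightarrow> real) \<Rightarrow> bool" where
  "plant A B G \<tau> d x u \<longleftrightarrow>
     solves_on {0..} x (\<lambda>t. A *v x t + u (t - \<tau>) *\<^sub>R B + G *v d t)"

text \<open>The component \<open>z\<close> is never reset, hence (locally absolutely) continuous on \<open>{0..}\<close>;
  \<open>w\<close> is reset at the sampling times and solves its equation on each sampling interval.\<close>

definition observer ::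
  "real ^ 'n ^ 'n \<Rightarrow> real ^ 'n \<Rightarrow> real ^ 'n \<Rightarrow> real ^ 'n \<Rightarrow> real \<Rightarrow> real \<Rightarrow> real
     \<Rightarrow> (real \<Rightarrow> real) \<Rightarrow> (real \<Rightarrow> real)
     \<Rightarrow> (real \<Rightarrow> real ^ 'n) \<Rightarrow> (real \<Rightarrow> real) \<Rightarrow> (real \<Rightarrow> real ^ 'n) \<Rightarrow> (real \<Rightarrow> real) \<Rightarrow> bool" where
  "observer A B c p r \<tau> T1 \<xi> b x u z w \<longleftrightarrow>
     solves_on {0..} z (\<lambda>t. A *v z t + u (t - r - \<tau>) *\<^sub>R B + (c \<bullet> z t - w t) *\<^sub>R p) \<and>
     (\<forall>i. solves_on {sample_time T1 b i ..< sample_time T1 b (Suc i)} w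
            (\<lambda>t. c \<bullet> (A *v z t) + (c \<bullet> B) * u (t - r - \<tau>))) \<and>
     (\<forall>i. w (sample_time T1 b (Suc i)) =
            c \<bullet> x (sample_time T1 b (Suc i) - r) + \<xi> (sample_time T1 b (Suc i)))"

definition feedback ::
  "real ^ 'n ^ 'n \<Rightarrow> real ^ 'n \<Rightarrow> real ^ 'n \<Rightarrow> real \<Rightarrow> real \<Rightarrow> real
     \<Rightarrow> (real \<Rightarrow> real) \<Rightarrow> (real \<Rightarrow> real ^ 'n) \<Rightarrow> bool" where
  "feedback A B k r \<tau> T2 u z \<longleftrightarrow>
     (\<forall>i::nat. \<forall>t\<in>{real i * T2 ..< (real i + 1) * T2}.
        u t = k \<bullet> (matrix_exp ((r + \<tau>) *\<^sub>R A) *v z (real i * T2))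
            + integral {- r - \<tau>..0}
                (\<lambda>s. k \<bullet> (matrix_exp ((- s) *\<^sub>R A) *v (u (real i * T2 + s) *\<^sub>R B))))"

definition closed_loop_solution ::
  "real ^ 'n ^ 'n \<Rightarrow> real ^ 'n \<Rightarrow> real ^ 'n ^ 'n \<Rightarrow> real ^ 'n \<Rightarrow> real ^ 'n \<Rightarrow> real ^ 'n
     \<Rightarrow> real \<Rightarrow> real \<Rightarrow> real \<Rightarrow> real
     \<Rightarrow> (real \<Rightarrow> real ^ 'n) \<Rightarrow> (real \<Rightarrow> real) \<Rightarrow> real ^ 'n \<Rightarrow> real
     \<Rightarrow> (real \<Rightarrow> real) \<Rightarrow> (real \<Rightarrow> real) \<Rightarrow> (real \<Rightarrow> real ^ 'n)
     \<Rightarrow> (real \<Rightarrow> real ^ 'n) \<Rightarrow> (real \<Rightarrow> real) \<Rightarrow> (real \<Rightarrow> real ^ 'n) \<Rightarrow> (real \<Rightarrow> real) \<Rightarrow> bool" where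
  "closed_loop_solution A B G c k p r \<tau> T1 T2 x0 u0 z0 w0 \<xi> b d x u z w \<longleftrightarrow>
     plant A B G \<tau> d x u \<and>
     observer A B c p r \<tau> T1 \<xi> b x u z w \<and>
     feedback A B k r \<tau> T2 u z \<and>
     (\<forall>s\<in>{- r..0}. hist 0 x s = x0 s) \<and>
     (\<forall>s\<in>{- r - \<tau>..<0}. hist 0 u s = u0 s) \<and>
     z 0 = z0 \<and> w 0 = w0"

end

theory Submission
  imports Defs "HOL-Computational_Algebra.Fundamental_Theorem_Algebra"
begin

text \<open>
  Let $y = c'z - w$, so that the observer reads $z' = Az + Bu(t-r-\tau) + py$. The derivatives of
  $c'z$ and $w$ differ only by the injection term, whence $y' = (c'p)y$ between two sampling
  instants. The stability of the closed loop rests on three observations.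

  The observer estimates the delayed state. Its error $e(t) = z(t) - x(t-r)$ satisfies
  $e' = (A+pc')e + p\eta - Gd(t-r)$ for $t \ge r$, where $\eta(t) = c'x(t-r) - w(t)$ is the error of the
  predicted output. At a sampling instant $\eta$ is reset to the measurement error, and its
  derivative $c'(Gd(t-r) - Ae)$ acts for a time of at most $T_1$ before the next reset. Since
  $A+pc'$ is Hurwitz, the loop from $e$ through $\eta$ to $e$ has a gain proportional to $T_1$, and for
  small $T_1$ the error decays exponentially up to the disturbances (\<open>e_le\<close>). The argument uses the
  bound $T_1$ on the sampling intervals, so it holds with the same constants for every $b$, and
  a constant function $M$ suffices.

  The feedback law samples the predictor
  $P(t) = e^{AL}z(t) + \int_{t-L}^t e^{A(t-s)}Bu(s)\,ds$ with $L = r+\tau$: it says that $u(t) = k'P(iT_2)$.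
  The delay cancels in the equation of $P$, which is $P' = AP + Bu + e^{AL}py$
  (\<open>P_solves\<close>). Thus $P' = (A+Bk')P + Bk'(P(iT_2) - P) + e^{AL}py$, where the hold error
  has a gain proportional to $T_2$ and $y$ is already known to decay (\<open>P_le\<close>).

  Finally, $u$ is given by $P$, the state $z$ is recovered from $P$ and $u$, then $w = c'z - y$
  and $x(t-r) = z(t) - e(t)$, and $x$ on the last interval of length $r$ by variation of
  constants. The two feedback loops are closed by one small-gain lemma for exponentially weighted
  maxima (\<open>small_gain\<close>). The same lemma with a growing weight bounds $z$ on $[0,r]$, where $e$
  satisfies no differential equation because the initial history of $x$ is merely continuous.

  Existence of solutions follows from the variation of constants formula and a recursion over the
  cells of a grid (\<open>causal_recursion\<close>), used once for the sampling instants and once for the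
  hold instants. As the inputs are merely measurable, two facts about real functions are needed: the
  fundamental theorem of calculus for absolutely continuous functions (\<open>abs_cont_on_FTC\<close>) and
  the differentiability almost everywhere of indefinite integrals
  (\<open>indefinite_integral_has_vector_derivative_ae\<close>). The exponential decay that the Hurwitz
  property entails is \<open>hurwitz_matrix_exp_decay\<close>.
\<close>

section \<open>Absolutely continuous functions\<close>

text \<open>On the exceptional null set the integrand can be taken to be 0. The gauge enforces the
  derivative estimate at the other tags; at the exceptional tags it confines the intervals to an open
  set of small measure, over which the increments of \<open>f\<close> are small by absolute continuity.\<close>

lemma abs_cont_on_FTC:
  fixes f :: "real \<Rightarrow> 'a::euclidean_space"
  assumes "a \<le> b" and ac: "abs_cont_on a b f" and N: "negligible N"
    and der: "\<And>t. t \<in> {a..b} - N \<Longrightarrow> (f has_vector_derivative g t) (at t within {a..b})"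
  shows "(g has_integral f b - f a) {a..b}"
proof -
  define h where "h t = (if t \<in> N then 0 else g t)" for t
  have "(h has_integral f b - f a) (cbox a b)"
    unfolding has_integral
  proof (intro allI impI)
    fix e :: real assume "e > 0"
    define e1 where "e1 = e / 2 / (b - a + 1)"
    have "e1 > 0" using \<open>e > 0\<close> \<open>a \<le> b\<close> by (simp add: e1_def)
    obtain \<delta> where "\<delta> > 0" and \<delta>: "\<And>D T. D division_of T \<Longrightarrow> T \<subseteq> {a..b} \<Longrightarrow>
        (\<Sum>K\<in>D. Sup K - Inf K) < \<delta> \<Longrightarrow> (\<Sum>K\<in>D. norm (f (Sup K) - f (Inf K))) < e / 2"
      using ac \<open>e > 0\<close> unfolding abs_cont_on_def by (metis half_gt_zero)
    have "N \<in> sets lebesgue" using N negligible_iff_null_sets null_setsD2 by blast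
    then obtain U where U: "open U" "N \<subseteq> U" "U - N \<in> lmeasurable" "emeasure lebesgue (U - N) < ennreal \<delta>"
      using sets_lebesgue_outer_open \<open>\<delta> > 0\<close> by metis
    have Um: "U \<in> lmeasurable" "measure lebesgue U < \<delta>"
    proof -
      have "U = (U - N) \<union> N" using U by blast
      then show "U \<in> lmeasurable"
        using U(3) N by (metis fmeasurable.Un negligible_imp_measurable)
      have "measure lebesgue U = measure lebesgue (U - N)"
        using N by (simp add: measure_Diff_null_set negligible_iff_null_sets \<open>U \<in> lmeasurable\<close> fmeasurableD)
      also have "\<dots> < \<delta>" using U(3,4) \<open>\<delta> > 0\<close>
        by (simp add: emeasure_eq_measure2 ennreal_less_iff)
      finally show "measure lebesgue U < \<delta>" .
    qed
    have "\<forall>x. \<exists>d>0. x \<in> {a..b} - N \<longrightarrow>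
         (\<forall>y\<in>{a..b}. norm (y-x) < d \<longrightarrow> norm (f y - f x - (y-x) *\<^sub>R g x) \<le> e1 * norm (y-x))"
      using der[unfolded has_vector_derivative_def has_derivative_within_alt] \<open>e1 > 0\<close> 
      by (meson zero_less_one)
    then obtain d where d: "\<And>x. 0 < d x"
                 "\<And>x y. \<lbrakk>x \<in> {a..b} - N; y \<in> {a..b}; norm (y-x) < d x\<rbrakk>
                        \<Longrightarrow> norm (f y - f x - (y-x) *\<^sub>R g x) \<le> e1 * norm (y-x)"
      by metis
    define \<gamma> where "\<gamma> x = (if x \<in> N then U else ball x (d x))" for x
    show "\<exists>\<gamma>. gauge \<gamma> \<and> (\<forall>p. p tagged_division_of cbox a b \<and> \<gamma> fine p \<longrightarrow>
            norm ((\<Sum>(x,k)\<in>p. measure lborel k *\<^sub>R h x) - (f b - f a)) < e)"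
    proof (intro exI[of _ \<gamma>] conjI allI impI)
      show "gauge \<gamma>" using U d by (auto simp: gauge_def \<gamma>_def)
      fix p assume "p tagged_division_of cbox a b \<and> \<gamma> fine p"
      then have p: "p tagged_division_of cbox a b" and fine: "\<gamma> fine p" by auto
      have "finite p" using p by blast
      define p1 where "p1 = {q \<in> p. fst q \<in> N}"
      define p2 where "p2 = {q \<in> p. fst q \<notin> N}"
      have pp: "p = p1 \<union> p2" "p1 \<inter> p2 = {}" "p1 \<subseteq> p" "p2 \<subseteq> p" by (auto simp: p1_def p2_def)
      have fin: "finite p1" "finite p2" using \<open>finite p\<close> by (auto simp: p1_def p2_def)
      have ba: "b - a = (\<Sum>(x,K)\<in>p. Sup K - Inf K)" "f b - f a = (\<Sum>(x,K)\<in>p. f(Sup K) - f(Inf K))"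
        using additive_tagged_division_1[where f= "\<lambda>x. x"] additive_tagged_division_1[where f= f]
            \<open>a \<le> b\<close> p by auto
      let ?D = "\<lambda>(x,K). measure lborel K *\<^sub>R h x - (f (Sup K) - f (Inf K))"
      have I2: "(\<Sum>q\<in>p2. norm (?D q)) \<le> (\<Sum>(x,K)\<in>p2. e1 * (Sup K - Inf K))"
      proof (rule sum_mono, safe)
        fix x K assume xK: "(x, K) \<in> p2"
        then have xKp: "(x, K) \<in> p" and xN: "x \<notin> N" by (auto simp: p2_def)
        then obtain u v where k: "K = cbox u v" and "x \<in> K" and kab: "K \<subseteq> cbox a b"
          using p by (metis tagged_division_ofD(2,3,4))
        have "u \<le> v" using \<open>x \<in> K\<close> unfolding k by auto
        have ball: "\<forall>y\<in>K. y \<in> ball x (d x)"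
          using fineD[OF fine xKp] xN by (auto simp: \<gamma>_def)
        have "u \<in> K" "v \<in> K" by (simp_all add: \<open>u \<le> v\<close> k)
        have hx: "h x = g x" using xN by (simp add: h_def)
        have "norm ((v - u) *\<^sub>R h x - (f v - f u)) = norm (f u - f x - (u - x) *\<^sub>R g x - (f v - f x - (v - x) *\<^sub>R g x))"
          by (auto simp: algebra_simps hx)
        also have "\<dots> \<le> norm (f u - f x - (u - x) *\<^sub>R g x) + norm (f v - f x - (v - x) *\<^sub>R g x)"
          by (rule norm_triangle_ineq4)
        also have "\<dots> \<le> e1 * norm (u - x) + e1 * norm (v - x)"
        proof (rule add_mono)
          show "norm (f u - f x - (u - x) *\<^sub>R g x) \<le> e1 * norm (u - x)"
            using \<open>u \<in> K\<close> ball \<open>x \<in> K\<close> kab xN by (intro d) (auto simp: dist_real_def)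
          show "norm (f v - f x - (v - x) *\<^sub>R g x) \<le> e1 * norm (v - x)"
            using \<open>v \<in> K\<close> ball \<open>x \<in> K\<close> kab xN by (intro d) (auto simp: dist_real_def)
        qed
        also have "\<dots> \<le> e1 * (Sup K - Inf K)"
          using \<open>x \<in> K\<close> \<open>u \<le> v\<close> by (auto simp: k field_simps)
        finally show "norm (measure lborel K *\<^sub>R h x - (f (Sup K) - f (Inf K))) \<le> e1 * (Sup K - Inf K)"
          using \<open>u \<le> v\<close> by (simp add: k)
      qed
      have "(\<Sum>(x,K)\<in>p2. e1 * (Sup K - Inf K)) \<le> (\<Sum>(x,K)\<in>p. e1 * (Sup K - Inf K))"
      proof (rule sum_mono2[OF \<open>finite p\<close> pp(4)], safe)
        fix x K assume "(x, K) \<in> p"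
        then obtain u v where k: "K = cbox u v" and "x \<in> K" using p by (metis tagged_division_ofD(2,4))
        then show "0 \<le> e1 * (Sup K - Inf K)" using \<open>e1 > 0\<close> by (auto simp: k)
      qed
      also have "\<dots> = e1 * (b - a)" by (simp add: ba(1) sum_distrib_left split_def)
      also have "\<dots> \<le> e / 2" using \<open>e > 0\<close> \<open>a \<le> b\<close> by (simp add: e1_def field_simps)
      finally have I2': "(\<Sum>q\<in>p2. norm (?D q)) \<le> e / 2" using I2 by linarith
      have part: "p1 tagged_partial_division_of cbox a b"
        using tagged_partial_division_subset[OF _ pp(3)] p by (auto simp: tagged_division_of_def)
      let ?T = "\<Union>(snd ` p1)"
      have t1: "p1 tagged_division_of ?T" using tagged_partial_division_of_Union_self[OF part] .
      have div: "snd ` p1 division_of ?T" using partial_division_of_tagged_division[OF part] .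
      have Tab: "?T \<subseteq> {a..b}" using tagged_partial_division_ofD(3)[OF part] by force
      have TU: "?T \<subseteq> U"
      proof safe
        fix x t K assume "x \<in> snd (t, K)" "(t, K) \<in> p1"
        then show "x \<in> U" using fineD[OF fine, of t K] by (auto simp: \<gamma>_def p1_def)
      qed
      have "(\<Sum>K\<in>snd ` p1. Sup K - Inf K) = (\<Sum>K\<in>snd ` p1. measure lebesgue K)"
      proof (rule sum.cong[OF refl])
        fix K assume "K \<in> snd ` p1"
        then obtain u v where "K = cbox u v" "K \<noteq> {}"
          using division_ofD(3,4)[OF div] by metis
        then show "Sup K - Inf K = measure lebesgue K" by simp
      qed
      also have "\<dots> = measure lebesgue ?T" using content_division[OF div] .
      also have "\<dots> \<le> measure lebesgue U" 
        using Um(1) TU by (intro measure_mono_fmeasurable) (auto intro: lmeasurable_division[OF div] fmeasurableD)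
      also have "\<dots> < \<delta>" by (rule Um)
      finally have small: "(\<Sum>K\<in>snd ` p1. norm (f (Sup K) - f (Inf K))) < e / 2"
        using \<delta>[OF div Tab] by blast
      have "(\<Sum>q\<in>p1. norm (?D q)) = (\<Sum>(x,K)\<in>p1. norm (f (Sup K) - f (Inf K)))"
        by (rule sum.cong) (auto simp: p1_def h_def norm_minus_commute)
      \<comment> \<open>The empty interval has to get the value 0, but \<open>Sup {}\<close> and \<open>Inf {}\<close> are unspecified.\<close>
      also have "\<dots> = (\<Sum>(x,K)\<in>p1. if K = {} then 0 else norm (f (Sup K) - f (Inf K)))"
      proof (rule sum.cong[OF refl], clarify)
        fix x K assume "(x, K) \<in> p1"
        then have "K \<noteq> {}" using tagged_division_ofD(2)[OF t1] by blast
        then show "norm (f (Sup K) - f (Inf K)) = (if K = {} then 0 else norm (f (Sup K) - f (Inf K)))"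
          by simp
      qed
      also have "\<dots> = (\<Sum>K\<in>snd ` p1. if K = {} then 0 else norm (f (Sup K) - f (Inf K)))"
      proof (rule sum.over_tagged_division_lemma[OF t1])
        fix u v :: real assume "box u v = {}"
        then have "u \<ge> v" by simp
        then show "(if cbox u v = {} then 0 else norm (f (Sup (cbox u v)) - f (Inf (cbox u v)))) = 0"
          by (cases "u = v") auto
      qed
      also have "\<dots> = (\<Sum>K\<in>snd ` p1. norm (f (Sup K) - f (Inf K)))"
        using division_ofD(3)[OF div] by (intro sum.cong) auto
      finally have I1: "(\<Sum>q\<in>p1. norm (?D q)) < e / 2" using small by simp
      have "(\<Sum>(x,k)\<in>p. measure lborel k *\<^sub>R h x) - (f b - f a) = (\<Sum>q\<in>p. ?D q)"
        by (simp add: ba(2) split_def sum_subtractf)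
      also have "norm \<dots> \<le> (\<Sum>q\<in>p. norm (?D q))" by (rule norm_sum)
      also have "\<dots> = (\<Sum>q\<in>p1. norm (?D q)) + (\<Sum>q\<in>p2. norm (?D q))"
        unfolding pp(1) by (rule sum.union_disjoint[OF fin pp(2)])
      also have "\<dots> < e" using I1 I2' by linarith
      finally show "norm ((\<Sum>(x,k)\<in>p. measure lborel k *\<^sub>R h x) - (f b - f a)) < e" .
    qed
  qed
  then have "(h has_integral f b - f a) {a..b}" by simp
  then show ?thesis
    by (rule has_integral_spike[OF N, rotated]) (simp add: h_def)
qed

lemma division_interval_ends:
  fixes T :: "real set"
  assumes "D division_of T" "T \<subseteq> {a..b}" "K \<in> D"
  shows "Inf K \<in> {a..b}" "Sup K \<in> {a..b}" "Inf K \<le> Sup K"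
proof -
  obtain u v where "K = cbox u v" "K \<noteq> {}" "K \<subseteq> T"
    using division_ofD(2,3,4)[OF assms(1)] assms(3) by metis
  then have "u \<le> v" "{u..v} \<subseteq> {a..b}" "K = {u..v}" using assms(2) by (auto simp: subset_eq)
  then show "Inf K \<in> {a..b}" "Sup K \<in> {a..b}" "Inf K \<le> Sup K" by auto
qed

text \<open>The common part of the closure properties below: the increments of a sum, a product, a linear
  image or a Lipschitz function are controlled by the increments of the given functions.\<close>

lemma abs_cont_on_dominated:
  assumes f: "abs_cont_on a b f" and g: "abs_cont_on a b g"
    and le: "\<And>s t. a \<le> s \<Longrightarrow> s \<le> t \<Longrightarrow> t \<le> b \<Longrightarrow> norm (h t - h s) \<le> C * (norm (f t - f s) + norm (g t - g s))"
  shows "abs_cont_on a b h"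
  unfolding abs_cont_on_def
proof (intro allI impI)
  fix e :: real assume "e > 0"
  define C' where "C' = max C 1"
  have C': "C' > 0" "C \<le> C'" by (auto simp: C'_def)
  define e' where "e' = e / (2 * C')"
  have "e' > 0" using C' \<open>e > 0\<close> by (simp add: e'_def)
  obtain \<delta>1 where "\<delta>1 > 0" and \<delta>1: "\<And>D T. D division_of T \<Longrightarrow> T \<subseteq> {a..b} \<Longrightarrow>
        (\<Sum>K\<in>D. Sup K - Inf K) < \<delta>1 \<Longrightarrow> (\<Sum>K\<in>D. norm (f (Sup K) - f (Inf K))) < e'"
    using f \<open>e' > 0\<close> unfolding abs_cont_on_def by metis
  obtain \<delta>2 where "\<delta>2 > 0" and \<delta>2: "\<And>D T. D division_of T \<Longrightarrow> T \<subseteq> {a..b} \<Longrightarrow>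
        (\<Sum>K\<in>D. Sup K - Inf K) < \<delta>2 \<Longrightarrow> (\<Sum>K\<in>D. norm (g (Sup K) - g (Inf K))) < e'"
    using g \<open>e' > 0\<close> unfolding abs_cont_on_def by metis
  have "(\<Sum>K\<in>D. norm (h (Sup K) - h (Inf K))) < e"
    if D: "D division_of T" "T \<subseteq> {a..b}" "(\<Sum>K\<in>D. Sup K - Inf K) < min \<delta>1 \<delta>2" for D T
  proof -
    have "(\<Sum>K\<in>D. norm (h (Sup K) - h (Inf K)))
      \<le> (\<Sum>K\<in>D. C' * (norm (f (Sup K) - f (Inf K)) + norm (g (Sup K) - g (Inf K))))"
    proof (rule sum_mono)
      fix K assume K: "K \<in> D"
      have "norm (h (Sup K) - h (Inf K)) \<le> C * (norm (f (Sup K) - f (Inf K)) + norm (g (Sup K) - g (Inf K)))"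
        using division_interval_ends[OF D(1,2) K] by (intro le) auto
      also have "\<dots> \<le> C' * (norm (f (Sup K) - f (Inf K)) + norm (g (Sup K) - g (Inf K)))"
        using C' by (intro mult_right_mono) auto
      finally show "norm (h (Sup K) - h (Inf K)) \<le> C' * (norm (f (Sup K) - f (Inf K)) + norm (g (Sup K) - g (Inf K)))" .
    qed
    also have "\<dots> = C' * ((\<Sum>K\<in>D. norm (f (Sup K) - f (Inf K))) + (\<Sum>K\<in>D. norm (g (Sup K) - g (Inf K))))"
      by (simp add: sum.distrib sum_distrib_left distrib_left)
    also have "\<dots> < C' * (e' + e')"
      using \<delta>1[OF D(1,2)] \<delta>2[OF D(1,2)] D(3) C' by (intro mult_strict_left_mono add_strict_mono) auto
    also have "\<dots> = e" using C' by (simp add: e'_def)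
    finally show ?thesis .
  qed
  then show "\<exists>\<delta>>0. \<forall>D T. D division_of T \<and> T \<subseteq> {a..b} \<and> (\<Sum>K\<in>D. Sup K - Inf K) < \<delta>
        \<longrightarrow> (\<Sum>K\<in>D. norm (h (Sup K) - h (Inf K))) < e"
    using \<open>\<delta>1 > 0\<close> \<open>\<delta>2 > 0\<close> by (intro exI[of _ "min \<delta>1 \<delta>2"]) auto
qed

lemma abs_cont_on_cong:
  assumes "abs_cont_on a b f" "\<And>t. t \<in> {a..b} \<Longrightarrow> g t = f t"
  shows "abs_cont_on a b g"
  by (rule abs_cont_on_dominated[OF assms(1,1), where C=1]) (simp add: assms(2))

lemma lipschitz_imp_abs_cont_on:
  assumes "\<And>x y. x \<in> {a..b} \<Longrightarrow> y \<in> {a..b} \<Longrightarrow> norm (f x - f y) \<le> C * \<bar>x - y\<bar>"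
  shows "abs_cont_on a b f"
proof -
  have id: "abs_cont_on a b (\<lambda>t. t)"
    unfolding abs_cont_on_def
  proof (intro allI impI)
    fix e :: real assume "e > 0"
    have "(\<Sum>K\<in>D. norm (Sup K - Inf K)) < e"
      if D: "D division_of T" "T \<subseteq> {a..b}" "(\<Sum>K\<in>D. Sup K - Inf K) < e" for D T
    proof -
      have "(\<Sum>K\<in>D. norm (Sup K - Inf K)) = (\<Sum>K\<in>D. Sup K - Inf K)"
        using division_interval_ends(3)[OF D(1,2)] by (intro sum.cong) auto
      then show ?thesis using D(3) by simp
    qed
    then show "\<exists>\<delta>>0. \<forall>D T. D division_of T \<and> T \<subseteq> {a..b} \<and> (\<Sum>K\<in>D. Sup K - Inf K) < \<delta>
        \<longrightarrow> (\<Sum>K\<in>D. norm (Sup K - Inf K)) < e"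
      using \<open>e > 0\<close> by blast
  qed
  show ?thesis
  proof (rule abs_cont_on_dominated[OF id id, where C="C / 2"])
    fix s t assume "a \<le> s" "s \<le> t" "t \<le> b"
    then show "norm (f t - f s) \<le> C / 2 * (norm (t - s) + norm (t - s))" using assms[of t s] by (simp add: algebra_simps)
  qed
qed

lemma C1_imp_abs_cont_on:
  fixes f :: "real \<Rightarrow> 'a::euclidean_space"
  assumes der: "\<And>t. t \<in> {a..b} \<Longrightarrow> (f has_vector_derivative f' t) (at t within {a..b})"
    and cont: "continuous_on {a..b} f'"
  shows "abs_cont_on a b f"
proof -
  have "bounded (f' ` {a..b})" using cont compact_continuous_image compact_imp_bounded by blast
  then obtain C where C: "\<And>t. t \<in> {a..b} \<Longrightarrow> norm (f' t) \<le> C"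
    unfolding bounded_iff by blast
  show ?thesis
  proof (rule lipschitz_imp_abs_cont_on)
    fix x y assume "x \<in> {a..b}" "y \<in> {a..b}"
    then show "norm (f x - f y) \<le> C * \<bar>x - y\<bar>"
      using differentiable_bound[of "{a..b}" f "\<lambda>t h. h *\<^sub>R f' t" C x y] der C
      by (auto simp: has_vector_derivative_def onorm_scaleR_left onorm_id bounded_linear_ident)
  qed
qed

lemma abs_cont_on_continuous:
  assumes "abs_cont_on a b f"
  shows "continuous_on {a..b} f"
  unfolding continuous_on_iff
proof (intro ballI allI impI)
  fix x e assume x: "x \<in> {a..b}" and "(e::real) > 0"
  then obtain \<delta> where "\<delta> > 0" and \<delta>: "\<And>D T. D division_of T \<Longrightarrow> T \<subseteq> {a..b} \<Longrightarrow>
        (\<Sum>K\<in>D. Sup K - Inf K) < \<delta> \<Longrightarrow> (\<Sum>K\<in>D. norm (f (Sup K) - f (Inf K))) < e"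
    using assms(1) unfolding abs_cont_on_def by metis
  have *: "dist (f u) (f v) < e" if "u \<le> v" "v - u < \<delta>" "u \<in> {a..b}" "v \<in> {a..b}" for u v
  proof -
    have "{{u..v}} division_of {u..v}" using division_of_self[of u v] that by auto
    then show ?thesis using \<delta>[of "{{u..v}}" "{u..v}"] that by (auto simp: dist_norm norm_minus_commute)
  qed
  have "dist (f y) (f x) < e" if "y \<in> {a..b}" "dist y x < \<delta>" for y
    using *[of x y] *[of y x] x that by (cases "x \<le> y") (auto simp: dist_real_def dist_commute)
  then show "\<exists>d>0. \<forall>x'\<in>{a..b}. dist x' x < d \<longrightarrow> dist (f x') (f x) < e"
    using \<open>\<delta> > 0\<close> by blast
qed

lemma abs_cont_on_bilinear:
  fixes f :: "real \<Rightarrow> 'a::euclidean_space" and g :: "real \<Rightarrow> 'b::euclidean_space"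
    and pr :: "'a \<Rightarrow> 'b \<Rightarrow> 'c::euclidean_space"
  assumes "bounded_bilinear pr" and f: "abs_cont_on a b f" and g: "abs_cont_on a b g"
  shows "abs_cont_on a b (\<lambda>t. pr (f t) (g t))"
proof -
  interpret bounded_bilinear pr by fact
  obtain C where C: "C > 0" "\<And>x y. norm (pr x y) \<le> norm x * norm y * C" using pos_bounded by metis
  have "bounded (f ` {a..b})" "bounded (g ` {a..b})"
    using abs_cont_on_continuous[OF f] abs_cont_on_continuous[OF g] compact_continuous_image
      compact_imp_bounded by blast+
  then obtain M1 M2 where M12: "\<And>t. t \<in> {a..b} \<Longrightarrow> norm (f t) \<le> M1" "\<And>t. t \<in> {a..b} \<Longrightarrow> norm (g t) \<le> M2"
    unfolding bounded_iff by blast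
  define M where "M = max M1 M2"
  have M: "norm (f t) \<le> M" "norm (g t) \<le> M" if "t \<in> {a..b}" for t using M12[OF that] by (auto simp: M_def)
  show ?thesis
  proof (rule abs_cont_on_dominated[OF f g, where C="M * C"])
    fix s t assume st: "a \<le> s" "s \<le> t" "t \<le> b"
    have "pr (f t) (g t) - pr (f s) (g s) = pr (f t - f s) (g t) + pr (f s) (g t - g s)"
      by (simp add: diff_left diff_right)
    also have "norm \<dots> \<le> norm (f t - f s) * norm (g t) * C + norm (f s) * norm (g t - g s) * C"
      by (intro norm_triangle_mono C)
    also have "\<dots> \<le> norm (f t - f s) * M * C + M * norm (g t - g s) * C"
      using M[of s] M[of t] st C(1) by (intro add_mono mult_right_mono mult_left_mono) auto
    finally show "norm (pr (f t) (g t) - pr (f s) (g s)) \<le> M * C * (norm (f t - f s) + norm (g t - g s))"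
      by (simp add: algebra_simps)
  qed
qed

lemma abs_cont_on_add:
  fixes f g :: "real \<Rightarrow> 'a::euclidean_space"
  assumes f: "abs_cont_on a b f" and g: "abs_cont_on a b g"
  shows "abs_cont_on a b (\<lambda>t. f t + g t)"
  by (rule abs_cont_on_dominated[OF f g, where C=1]) (simp add: norm_diff_triangle_ineq)

lemma abs_cont_on_linear:
  assumes "bounded_linear L" "abs_cont_on a b f"
  shows "abs_cont_on a b (\<lambda>t. L (f t))"
proof -
  obtain C where C: "C > 0" "\<And>x. norm (L x) \<le> norm x * C"
    using bounded_linear.pos_bounded[OF assms(1)] by blast
  show ?thesis
  proof (rule abs_cont_on_dominated[OF assms(2,2), where C="C / 2"])
    fix s t
    have "norm (L (f t) - L (f s)) \<le> norm (f t - f s) * C"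
      using C(2)[of "f t - f s"] by (simp add: linear_diff[OF bounded_linear.linear[OF assms(1)]])
    then show "norm (L (f t) - L (f s)) \<le> C / 2 * (norm (f t - f s) + norm (f t - f s))"
      by (simp add: mult.commute)
  qed
qed

section \<open>Differentiability of indefinite integrals\<close>

text \<open>At a point of this set, arbitrarily short intervals have an integral that misses the product
  of length and value by more than \<open>c\<close> times the length. By Vitali's theorem, disjoint
  intervals of this kind cover the set up to a null set; by Henstock's lemma their defects, and hence
  their lengths, have an arbitrarily small sum.\<close>

lemma indefinite_integral_bad_set_negligible:
  fixes g :: "real \<Rightarrow> 'a::euclidean_space"
  assumes g: "g integrable_on {a..b}" and "c > 0"
  defines "F \<equiv> \<lambda>t. integral {a..t} g"
  shows "negligible {t \<in> {a..b}. \<forall>\<delta>>0. \<exists>s\<in>{a..b}. s \<noteq> t \<and> \<bar>s - t\<bar> < \<delta> \<and>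
            norm (F s - F t - (s - t) *\<^sub>R g t) > c * \<bar>s - t\<bar>}" (is "negligible ?E")
  unfolding negligible_outer_le
proof (intro allI impI)
  fix e :: real assume "e > 0"
  have Fdiff: "integral {u..v} g = F v - F u" if "a \<le> u" "u \<le> v" "v \<le> b" for u v
  proof -
    have "F u + integral {u..v} g = F v"
      using Henstock_Kurzweil_Integration.integral_combine[of a u v g] that
        integrable_on_subinterval[OF g, of a v] by (auto simp: F_def)
    then show ?thesis by (simp add: eq_diff_eq add.commute)
  qed
  have "c * e > 0" using assms(2) \<open>e > 0\<close> by simp
  then obtain \<gamma> where "gauge \<gamma>" and \<gamma>: "\<And>p. p tagged_partial_division_of (cbox a b) \<Longrightarrow> \<gamma> fine p \<Longrightarrow>
             sum (\<lambda>(x,k). norm(measure lborel k *\<^sub>R g x - integral k g)) p < c * e"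
    using Henstock_lemma[of g a b "c * e"] g by auto
  define I where "I = (\<lambda>(t::real,s). {min t s..max t s})"
  \<comment> \<open>The index \<open>(t, s)\<close> stands for the interval between a bad point \<open>t\<close> and a witness \<open>s\<close>; its tag is \<open>t\<close>.\<close>
  define K where "K = {(t,s). t \<in> ?E \<and> s \<in> {a..b} \<and> s \<noteq> t \<and>
     norm (F s - F t - (s - t) *\<^sub>R g t) > c * \<bar>s - t\<bar> \<and> I (t,s) \<subseteq> \<gamma> t}"
  define m where "m = (\<lambda>(t::real,s). (t+s)/2)"
  define rd where "rd = (\<lambda>(t::real,s). \<bar>t-s\<bar>/2)"
  have cb: "cball (m i) (rd i) = I i" for i
    by (cases i) (auto simp: m_def rd_def I_def cball_eq_atLeastAtMost min_def max_def abs_if field_simps)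
  have rdK: "0 < rd i" if "i \<in> K" for i using that by (auto simp: K_def rd_def)
  have ex: "\<exists>i. i \<in> K \<and> x \<in> cball (m i) (rd i) \<and> rd i < d" if x: "x \<in> ?E" and "0 < d" for x d
  proof -
    obtain d1 where d1: "d1 > 0" "ball x d1 \<subseteq> \<gamma> x"
      using \<open>gauge \<gamma>\<close> unfolding gauge_def by (meson open_contains_ball)
    then have "min d1 d > 0" using \<open>0 < d\<close> by simp
    then obtain s where s: "s \<in> {a..b}" "s \<noteq> x" "\<bar>s - x\<bar> < min d1 d"
       "norm (F s - F x - (s - x) *\<^sub>R g x) > c * \<bar>s - x\<bar>"
      using x by blast
    have "I (x,s) \<subseteq> ball x d1" using s(3) by (auto simp: I_def dist_real_def)
    then have "(x,s) \<in> K" using s d1(2) x by (auto simp: K_def)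
    moreover have "x \<in> I (x,s)" by (auto simp: I_def)
    moreover have "rd (x,s) < d" using s(3) by (auto simp: rd_def)
    ultimately show ?thesis using cb by blast
  qed
  obtain C where C: "countable C" "C \<subseteq> K"
     "pairwise (\<lambda>i j. disjnt (cball (m i) (rd i)) (cball (m j) (rd j))) C"
     "negligible (?E - (\<Union>i\<in>C. cball (m i) (rd i)))"
    using Vitali_covering_theorem_cballs[of K rd ?E m] rdK ex by blast
  have disj: "disjnt (I i) (I j)" if "i \<in> C" "j \<in> C" "i \<noteq> j" for i j
    using C(3) that unfolding pairwise_def cb by blast
  have Il: "I i \<in> lmeasurable" for i by (auto simp: I_def split: prod.split)
  have bound: "measure lebesgue (\<Union>i\<in>F'. I i) \<le> e" if F': "F' \<subseteq> C" "finite F'" for F'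
  proof -
    define p where "p = (\<lambda>i. (fst i, I i)) ` F'"
    have mem: "fst i \<in> I i" for i by (auto simp: I_def split: prod.split)
    have inj: "inj_on (\<lambda>i. (fst i, I i)) F'"
    proof (rule inj_onI)
      fix i j assume ij: "i \<in> F'" "j \<in> F'" "(fst i, I i) = (fst j, I j)"
      then show "i = j" using disj[of i j] F' mem[of i] by (auto simp: disjnt_iff)
    qed
    have in_ab: "I i \<subseteq> cbox a b" if "i \<in> F'" for i
    proof -
      obtain t s where i: "i = (t,s)" by (cases i)
      then have "(t,s) \<in> K" using that F' C(2) by auto
      then have "t \<in> {a..b}" "s \<in> {a..b}" by (auto simp: K_def)
      then show ?thesis by (auto simp: i I_def min_def max_def split: if_splits)
    qed
    have "p tagged_partial_division_of cbox a b"
      unfolding tagged_partial_division_of_def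
    proof (intro conjI allI impI)
      show "finite p" using F' by (simp add: p_def)
      fix x k assume "(x,k) \<in> p"
      then obtain i where i: "i \<in> F'" "x = fst i" "k = I i" by (auto simp: p_def)
      show "x \<in> k" "k \<subseteq> cbox a b" using mem in_ab i by auto
      show "\<exists>a b. k = cbox a b" using i by (cases i) (auto simp: I_def)
    next
      fix x1 k1 x2 k2 assume "(x1, k1) \<in> p \<and> (x2, k2) \<in> p \<and> (x1, k1) \<noteq> (x2, k2)"
      then obtain i j where "i \<in> F'" "j \<in> F'" "k1 = I i" "k2 = I j" "i \<noteq> j" by (auto simp: p_def)
      then have "k1 \<inter> k2 = {}" using disj[of i j] F' by (auto simp: disjnt_def)
      then show "interior k1 \<inter> interior k2 = {}" using interior_subset by blast
    qed
    moreover have "\<gamma> fine p"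
      unfolding fine_def p_def
    proof clarify
      fix t s x assume i: "(t,s) \<in> F'" and x: "x \<in> I (t,s)"
      have "(t,s) \<in> K" using i F' C(2) by auto
      then show "x \<in> \<gamma> (fst (t,s))" using x by (auto simp: K_def)
    qed
    ultimately have "sum (\<lambda>(x,k). norm (measure lborel k *\<^sub>R g x - integral k g)) p < c * e" by (rule \<gamma>)
    then have less: "(\<Sum>i\<in>F'. norm (measure lborel (I i) *\<^sub>R g (fst i) - integral (I i) g)) < c * e"
      unfolding p_def by (subst (asm) sum.reindex[OF inj]) (simp add: o_def)
    have each: "c * measure lebesgue (I i) \<le> norm (measure lborel (I i) *\<^sub>R g (fst i) - integral (I i) g)"
      if "i \<in> F'" for i
    proof -
      obtain t s where i: "i = (t,s)" by (cases i)
      have K: "(t,s) \<in> K" using that F' C(2) i by auto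
      then have ts: "t \<in> {a..b}" "s \<in> {a..b}" "c * \<bar>s - t\<bar> < norm (F s - F t - (s - t) *\<^sub>R g t)"
        unfolding K_def by blast+
      show ?thesis
      proof (cases "t \<le> s")
        case True
        then have *: "measure lborel (I i) *\<^sub>R g (fst i) - integral (I i) g = - (F s - F t - (s - t) *\<^sub>R g t)"
          using ts Fdiff[of t s] by (simp add: i I_def)
        show ?thesis unfolding * norm_minus_cancel using ts True by (simp add: i I_def)
      next
        case False
        then have *: "measure lborel (I i) *\<^sub>R g (fst i) - integral (I i) g = F s - F t - (s - t) *\<^sub>R g t"
          using ts Fdiff[of s t] by (simp add: i I_def algebra_simps)
        show ?thesis unfolding * using ts False by (simp add: i I_def)
      qed
    qed
    have "c * measure lebesgue (\<Union>i\<in>F'. I i) \<le> c * (\<Sum>i\<in>F'. measure lebesgue (I i))"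
      using assms(2) F'(2) Il by (intro mult_left_mono measure_UNION_le) (auto intro: fmeasurableD)
    also have "\<dots> \<le> (\<Sum>i\<in>F'. norm (measure lborel (I i) *\<^sub>R g (fst i) - integral (I i) g))"
      unfolding sum_distrib_left using each by (intro sum_mono) auto
    also have "\<dots> < c * e" by (rule less)
    finally show ?thesis using assms(2) by simp
  qed
  define N where "N = ?E - (\<Union>i\<in>C. I i)"
  have N: "negligible N" using C(4) unfolding cb N_def .
  let ?T = "(\<Union>i\<in>C. I i) \<union> N"
  have 1: "(\<Union>i\<in>C. I i) \<in> lmeasurable" "measure lebesgue (\<Union>i\<in>C. I i) \<le> e"
    using fmeasurable_UN_bound[OF C(1) Il bound] measure_UN_bound[OF C(1) Il bound] by blast+
  have "?T \<in> lmeasurable" by (intro fmeasurable.Un 1(1) negligible_imp_measurable[OF N])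
  moreover have "measure lebesgue ?T \<le> e"
    using measure_Un_null_set[OF fmeasurableD[OF 1(1)] N[unfolded negligible_iff_null_sets]] 1(2) by simp
  moreover have "?E \<subseteq> ?T" by (auto simp: N_def)
  ultimately show "\<exists>T. ?E \<subseteq> T \<and> T \<in> lmeasurable \<and> measure lebesgue T \<le> e" by blast
qed

lemma indefinite_integral_has_vector_derivative_ae:
  fixes g :: "real \<Rightarrow> 'a::euclidean_space"
  assumes g: "g integrable_on {a..b}"
  obtains N where "negligible N" "\<And>t. t \<in> {a..b} - N \<Longrightarrow>
     ((\<lambda>t. integral {a..t} g) has_vector_derivative g t) (at t within {a..b})"
proof -
  let ?F = "\<lambda>t. integral {a..t} g"
  define E where "E c = {t \<in> {a..b}. \<forall>\<delta>>0. \<exists>s\<in>{a..b}. s \<noteq> t \<and> \<bar>s - t\<bar> < \<delta> \<and>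
            norm (?F s - ?F t - (s - t) *\<^sub>R g t) > c * \<bar>s - t\<bar>}" for c
  define N where "N = (\<Union>n. E (1 / real (Suc n)))"
  have "negligible N" unfolding N_def E_def
    by (intro negligible_Union_nat indefinite_integral_bad_set_negligible[OF g]) auto
  moreover have "(?F has_vector_derivative g t) (at t within {a..b})" if t: "t \<in> {a..b} - N" for t
    unfolding has_vector_derivative_def has_derivative_within_alt
  proof (intro conjI allI impI)
    show "bounded_linear (\<lambda>x. x *\<^sub>R g t)" by (rule bounded_linear_scaleR_left)
    fix e :: real assume "e > 0"
    then obtain n where n: "1 / real (Suc n) < e" using nat_approx_posE by blast
    have "t \<notin> E (1 / real (Suc n))" using t by (auto simp: N_def)
    then have "\<not> (\<forall>\<delta>>0. \<exists>s\<in>{a..b}. s \<noteq> t \<and> \<bar>s - t\<bar> < \<delta> \<and>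
            norm (?F s - ?F t - (s - t) *\<^sub>R g t) > 1 / real (Suc n) * \<bar>s - t\<bar>)"
      using t unfolding E_def by blast
    then obtain \<delta> where \<delta>: "\<delta> > 0" "\<And>s. s \<in> {a..b} \<Longrightarrow> s \<noteq> t \<Longrightarrow> \<bar>s - t\<bar> < \<delta> \<Longrightarrow>
       norm (?F s - ?F t - (s - t) *\<^sub>R g t) \<le> 1 / real (Suc n) * \<bar>s - t\<bar>"
      by (meson not_less)
    have "norm (?F s - ?F t - (s - t) *\<^sub>R g t) \<le> e * norm (s - t)"
      if s: "s \<in> {a..b}" "norm (s - t) < \<delta>" for s
    proof (cases "s = t")
      case False
      then have "norm (?F s - ?F t - (s - t) *\<^sub>R g t) \<le> 1 / real (Suc n) * \<bar>s - t\<bar>" using \<delta>(2) s by simp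
      also have "\<dots> \<le> e * \<bar>s - t\<bar>" using n by (intro mult_right_mono) auto
      finally show ?thesis by simp
    qed simp
    then show "\<exists>d>0. \<forall>y\<in>{a..b}. norm (y - t) < d \<longrightarrow>
        norm (?F y - ?F t - (y - t) *\<^sub>R g t) \<le> e * norm (y - t)"
      using \<delta>(1) by blast
  qed
  ultimately show ?thesis using that by blast
qed

section \<open>The matrix exponential\<close>

definition mpow :: "real ^ 'n ^ 'n \<Rightarrow> nat \<Rightarrow> real ^ 'n ^ 'n" where
  "mpow A i = ((**) A ^^ i) (mat 1)"

lemma mpow_simps [simp]: "mpow A 0 = mat 1" "mpow A (Suc i) = A ** mpow A i"
  by (simp_all add: mpow_def)

lemma mpow_commute: "A ** mpow A i = mpow A i ** A"
proof (induction i)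
  case (Suc i)
  have "A ** mpow A (Suc i) = A ** (mpow A i ** A)" by (simp add: Suc)
  then show ?case by (simp add: matrix_mul_assoc)
qed simp

lemma scaleR_matrix_mult:
  fixes X Y :: "real ^ 'n ^ 'n"
  shows "(t *\<^sub>R X) ** (s *\<^sub>R Y) = (t * s) *\<^sub>R (X ** Y)"
  by (simp add: vec_eq_iff matrix_matrix_mult_def sum_distrib_left mult_ac)

lemma mpow_scaleR: "mpow (t *\<^sub>R A) i = (t ^ i) *\<^sub>R mpow A i"
  by (induction i) (simp_all add: scaleR_matrix_mult)

lemma mpow_entry_bound:
  fixes A :: "real ^ 'n ^ 'n"
  defines "a \<equiv> (\<Sum>j\<in>UNIV. \<Sum>l\<in>UNIV. \<bar>A $ j $ l\<bar>)"
  shows "\<bar>mpow A i $ j $ k\<bar> \<le> a ^ i"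
proof (induction i arbitrary: j k)
  case 0 then show ?case by (simp add: mat_def)
next
  case (Suc i)
  have "a \<ge> 0" unfolding a_def by (intro sum_nonneg) auto
  have "\<bar>mpow A (Suc i) $ j $ k\<bar> \<le> (\<Sum>l\<in>UNIV. \<bar>A $ j $ l\<bar> * \<bar>mpow A i $ l $ k\<bar>)"
    by (simp add: matrix_matrix_mult_def abs_mult[symmetric])
  also have "\<dots> \<le> (\<Sum>l\<in>UNIV. \<bar>A $ j $ l\<bar> * a ^ i)"
    using Suc by (intro sum_mono mult_left_mono) auto
  also have "\<dots> = (\<Sum>l\<in>UNIV. \<bar>A $ j $ l\<bar>) * a ^ i" by (simp add: sum_distrib_right)
  also have "\<dots> \<le> a * a ^ i"
    using \<open>a \<ge> 0\<close> unfolding a_def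
    by (intro mult_right_mono member_le_sum) (auto intro: sum_nonneg)
  finally show ?case by simp
qed

lemma norm_matrix_le:
  fixes M :: "real ^ 'n ^ 'm"
  shows "norm M \<le> (\<Sum>j\<in>UNIV. \<Sum>k\<in>UNIV. \<bar>M $ j $ k\<bar>)"
proof -
  have "norm M \<le> (\<Sum>j\<in>UNIV. norm (M $ j))" unfolding norm_vec_def by (rule L2_set_le_sum) simp
  also have "\<dots> \<le> (\<Sum>j\<in>UNIV. \<Sum>k\<in>UNIV. \<bar>M $ j $ k\<bar>)"
    by (intro sum_mono norm_le_l1_cart)
  finally show ?thesis .
qed

lemma mpow_entry_summable:
  fixes A :: "real ^ 'n ^ 'n"
  shows "summable (\<lambda>i. mpow A i $ j $ k / fact i * t ^ i)"
proof (rule summable_comparison_test')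
  let ?a = "\<Sum>j\<in>UNIV. \<Sum>l\<in>UNIV. \<bar>A $ j $ l\<bar>"
  show "summable (\<lambda>i. inverse (fact i) * (?a * \<bar>t\<bar>) ^ i)"
    by (rule summable_exp)
  fix i :: nat
  have "norm (mpow A i $ j $ k / fact i * t ^ i) = \<bar>mpow A i $ j $ k\<bar> / fact i * \<bar>t\<bar> ^ i"
    by (simp add: abs_mult power_abs)
  also have "\<dots> \<le> ?a ^ i / fact i * \<bar>t\<bar> ^ i"
    by (intro mult_right_mono divide_right_mono mpow_entry_bound) auto
  finally show "norm (mpow A i $ j $ k / fact i * t ^ i) \<le> inverse (fact i) * (?a * \<bar>t\<bar>) ^ i"
    by (simp add: power_mult_distrib field_simps)
qed

lemma matrix_exp_summable:
  fixes A :: "real ^ 'n ^ 'n"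
  shows "summable (\<lambda>i. (1 / fact i) *\<^sub>R mpow A i)"
proof (rule summable_comparison_test')
  show "summable (\<lambda>i. \<Sum>j\<in>UNIV. \<Sum>k\<in>UNIV. \<bar>mpow A i $ j $ k / fact i * 1 ^ i\<bar>)"
  proof (intro summable_sum)
    fix j k
    let ?a = "\<Sum>j\<in>UNIV. \<Sum>l\<in>UNIV. \<bar>A $ j $ l\<bar>"
    show "summable (\<lambda>i. \<bar>mpow A i $ j $ k / fact i * 1 ^ i\<bar>)"
    proof (rule summable_comparison_test')
      show "summable (\<lambda>i. inverse (fact i) * ?a ^ i)" by (rule summable_exp)
      show "norm \<bar>mpow A i $ j $ k / fact i * 1 ^ i\<bar> \<le> inverse (fact i) * ?a ^ i" for i
        using mpow_entry_bound[of A i j k] by (simp add: field_simps)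
    qed
  qed
  show "norm ((1 / fact i) *\<^sub>R mpow A i) \<le> (\<Sum>j\<in>UNIV. \<Sum>k\<in>UNIV. \<bar>mpow A i $ j $ k / fact i * 1 ^ i\<bar>)" for i
    using norm_matrix_le[of "(1 / fact i) *\<^sub>R mpow A i"] by simp
qed

text \<open>Each entry is a real power series in \<open>t\<close> and can be differentiated term by term.\<close>

lemma matrix_exp_entry:
  fixes A :: "real ^ 'n ^ 'n"
  shows "matrix_exp (t *\<^sub>R A) $ j $ k = (\<Sum>i. mpow A i $ j $ k / fact i * t ^ i)"
proof -
  have L: "bounded_linear (\<lambda>M :: real ^ 'n ^ 'n. M $ j $ k)"
    by (rule bounded_linear_compose[OF bounded_linear_vec_nth bounded_linear_vec_nth])
  have "matrix_exp (t *\<^sub>R A) $ j $ k = (\<Sum>i. ((1 / fact i) *\<^sub>R mpow (t *\<^sub>R A) i) $ j $ k)"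
    unfolding matrix_exp_def mpow_def[symmetric]
    using bounded_linear.suminf[OF L matrix_exp_summable[of "t *\<^sub>R A"]] by simp
  then show ?thesis by (simp add: mpow_scaleR mult_ac)
qed

lemma matrix_exp_0 [simp]: "matrix_exp (0 :: real ^ 'n ^ 'n) = mat 1"
proof -
  have "matrix_exp (0 *\<^sub>R A) = mat 1" for A :: "real ^ 'n ^ 'n"
    by (simp only: vec_eq_iff matrix_exp_entry powser_zero mpow_simps) simp
  then show ?thesis by simp
qed

lemma matrix_exp_entry_DERIV:
  fixes A :: "real ^ 'n ^ 'n"
  shows "((\<lambda>t. matrix_exp (t *\<^sub>R A) $ j $ k) has_real_derivative
     (\<Sum>i. mpow A (Suc i) $ j $ k / fact i * t ^ i)) (at t)"
proof -
  have eq: "diffs (\<lambda>i. mpow A i $ j $ k / fact i) = (\<lambda>i. mpow A (Suc i) $ j $ k / fact i)"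
    by (rule ext) (simp add: diffs_def del: mpow_simps of_nat_Suc)
  have "((\<lambda>t. \<Sum>i. mpow A i $ j $ k / fact i * t ^ i) has_real_derivative
     (\<Sum>i. diffs (\<lambda>i. mpow A i $ j $ k / fact i) i * t ^ i)) (at t)"
    by (rule termdiffs_strong_converges_everywhere[OF mpow_entry_summable])
  then show ?thesis unfolding matrix_exp_entry eq .
qed

lemma matrix_exp_series_left:
  fixes A :: "real ^ 'n ^ 'n"
  shows "(\<Sum>i. mpow A (Suc i) $ j $ k / fact i * t ^ i) = (A ** matrix_exp (t *\<^sub>R A)) $ j $ k"
proof -
  have "(\<lambda>i. \<Sum>l\<in>UNIV. A $ j $ l * (mpow A i $ l $ k / fact i * t ^ i)) sums
     (\<Sum>l\<in>UNIV. A $ j $ l * matrix_exp (t *\<^sub>R A) $ l $ k)"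
    unfolding matrix_exp_entry by (intro sums_sum sums_mult summable_sums mpow_entry_summable)
  also have "(\<lambda>i. \<Sum>l\<in>UNIV. A $ j $ l * (mpow A i $ l $ k / fact i * t ^ i))
     = (\<lambda>i. mpow A (Suc i) $ j $ k / fact i * t ^ i)"
    by (simp add: matrix_matrix_mult_def sum_distrib_left sum_distrib_right sum_divide_distrib mult_ac)
  finally show ?thesis by (simp add: sums_iff matrix_matrix_mult_def)
qed

lemma matrix_exp_series_right:
  fixes A :: "real ^ 'n ^ 'n"
  shows "(\<Sum>i. mpow A (Suc i) $ j $ k / fact i * t ^ i) = (matrix_exp (t *\<^sub>R A) ** A) $ j $ k"
proof -
  have "(\<lambda>i. \<Sum>l\<in>UNIV. (mpow A i $ j $ l / fact i * t ^ i) * A $ l $ k) sums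
     (\<Sum>l\<in>UNIV. matrix_exp (t *\<^sub>R A) $ j $ l * A $ l $ k)"
    unfolding matrix_exp_entry by (intro sums_sum sums_mult2 summable_sums mpow_entry_summable)
  also have "(\<lambda>i. \<Sum>l\<in>UNIV. (mpow A i $ j $ l / fact i * t ^ i) * A $ l $ k)
     = (\<lambda>i. mpow A (Suc i) $ j $ k / fact i * t ^ i)"
    unfolding mpow_simps mpow_commute
    by (simp add: matrix_matrix_mult_def sum_distrib_left sum_distrib_right sum_divide_distrib mult_ac)
  finally show ?thesis by (simp add: sums_iff matrix_matrix_mult_def)
qed

lemma matrix_exp_commute:
  fixes A :: "real ^ 'n ^ 'n"
  shows "A ** matrix_exp (t *\<^sub>R A) = matrix_exp (t *\<^sub>R A) ** A"
  by (simp add: vec_eq_iff matrix_exp_series_left[symmetric] matrix_exp_series_right[symmetric] del: mpow_simps)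

lemma has_vector_derivative_vecI:
  fixes f :: "real \<Rightarrow> 'a::euclidean_space ^ 'm"
  assumes "\<And>j. ((\<lambda>t. f t $ j) has_vector_derivative f' $ j) (at t within S)"
  shows "(f has_vector_derivative f') (at t within S)"
  unfolding has_vector_derivative_def has_derivative_componentwise_within[of f]
proof
  fix i :: "'a ^ 'm" assume "i \<in> Basis"
  then obtain j u where i: "i = axis j u" "u \<in> Basis" unfolding Basis_vec_def by blast
  have "((\<lambda>t. f t $ j \<bullet> u) has_derivative (\<lambda>x. (x *\<^sub>R f' $ j) \<bullet> u)) (at t within S)"
    using assms[of j] unfolding has_vector_derivative_def by (rule has_derivative_inner_left)
  then show "((\<lambda>x. f x \<bullet> i) has_derivative (\<lambda>x. (x *\<^sub>R f') \<bullet> i)) (at t within S)"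
    by (simp add: i inner_axis)
qed

lemma matrix_exp_has_vector_derivative:
  fixes A :: "real ^ 'n ^ 'n"
  shows "((\<lambda>t. matrix_exp (t *\<^sub>R A)) has_vector_derivative A ** matrix_exp (t *\<^sub>R A)) (at t within S)"
proof (intro has_vector_derivative_vecI)
  fix j k
  show "((\<lambda>t. matrix_exp (t *\<^sub>R A) $ j $ k) has_vector_derivative (A ** matrix_exp (t *\<^sub>R A)) $ j $ k) (at t within S)"
    using matrix_exp_entry_DERIV[of A j k t] unfolding matrix_exp_series_left
    by (simp add: has_real_derivative_iff_has_vector_derivative has_vector_derivative_at_within)
qed

lemma bounded_bilinear_matrix_vector:
  "bounded_bilinear (\<lambda>(M :: real ^ 'n ^ 'm) v. M *v v)"
  by (subst bilinear_conv_bounded_bilinear[symmetric], unfold bilinear_def)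
    (auto simp: linear_iff matrix_vector_mult_add_rdistrib vec_eq_iff matrix_vector_mult_def
      sum_distrib_left sum.distrib algebra_simps)

lemmas has_vector_derivative_matrix_vector =
  bounded_bilinear.has_vector_derivative[OF bounded_bilinear_matrix_vector]

lemma norm_matrix_vector_le:
  fixes M :: "real ^ 'n ^ 'm"
  shows "norm (M *v v) \<le> (\<Sum>j\<in>UNIV. \<Sum>k\<in>UNIV. \<bar>M $ j $ k\<bar>) * norm v"
proof -
  have "norm (M *v v) \<le> (\<Sum>j\<in>UNIV. \<bar>(M *v v) $ j\<bar>)" by (rule norm_le_l1_cart)
  also have "\<dots> \<le> (\<Sum>j\<in>UNIV. \<Sum>k\<in>UNIV. \<bar>M $ j $ k\<bar> * norm v)"
  proof (rule sum_mono)
    fix j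
    have "\<bar>(M *v v) $ j\<bar> \<le> (\<Sum>k\<in>UNIV. \<bar>M $ j $ k * v $ k\<bar>)"
      unfolding matrix_vector_mult_def by simp
    also have "\<dots> \<le> (\<Sum>k\<in>UNIV. \<bar>M $ j $ k\<bar> * norm v)"
      unfolding abs_mult by (intro sum_mono mult_left_mono component_le_norm_cart) auto
    finally show "\<bar>(M *v v) $ j\<bar> \<le> (\<Sum>k\<in>UNIV. \<bar>M $ j $ k\<bar> * norm v)" .
  qed
  finally show ?thesis by (simp add: sum_distrib_right)
qed

text \<open>The function $\theta \mapsto e^{(T-\theta)A} e^{\theta A}v$ has derivative 0.\<close>

lemma matrix_exp_add:
  fixes A :: "real ^ 'n ^ 'n"
  shows "matrix_exp ((s + t) *\<^sub>R A) = matrix_exp (s *\<^sub>R A) ** matrix_exp (t *\<^sub>R A)"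
proof -
  have "matrix_exp ((s + t) *\<^sub>R A) *v v = (matrix_exp (s *\<^sub>R A) ** matrix_exp (t *\<^sub>R A)) *v v" for v
  proof -
    define T where "T = s + t"
    let ?f = "\<lambda>\<theta>. matrix_exp ((T - \<theta>) *\<^sub>R A) *v (matrix_exp (\<theta> *\<^sub>R A) *v v)"
    have "(?f has_vector_derivative 0) (at \<theta> within UNIV)" for \<theta>
    proof -
      have 1: "((\<lambda>\<theta>. matrix_exp ((T - \<theta>) *\<^sub>R A)) has_vector_derivative
          (-1) *\<^sub>R (matrix_exp ((T - \<theta>) *\<^sub>R A) ** A)) (at \<theta> within UNIV)"
        unfolding matrix_exp_commute[symmetric]
        by (rule vector_diff_chain_within[of "\<lambda>\<theta>. T - \<theta>" "-1" \<theta> UNIV "\<lambda>t. matrix_exp (t *\<^sub>R A)", unfolded o_def])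
          (auto intro!: derivative_eq_intros matrix_exp_has_vector_derivative)
      have 2: "((\<lambda>\<theta>. matrix_exp (\<theta> *\<^sub>R A) *v v) has_vector_derivative
           A *v (matrix_exp (\<theta> *\<^sub>R A) *v v)) (at \<theta> within UNIV)"
        using has_vector_derivative_matrix_vector[OF matrix_exp_has_vector_derivative[of A \<theta> UNIV] has_vector_derivative_const[of v]]
        by (simp add: matrix_vector_mul_assoc)
      show ?thesis
        using has_vector_derivative_matrix_vector[OF 1 2]
        by (simp add: matrix_vector_mul_assoc[symmetric] bounded_bilinear.minus_left[OF bounded_bilinear_matrix_vector])
    qed
    then have "?f t = ?f 0"
      using has_vector_derivative_zero_constant[of UNIV ?f] by (metis UNIV_I convex_UNIV)
    then show ?thesis by (simp add: T_def matrix_vector_mul_assoc)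
  qed
  then show ?thesis by (simp add: matrix_eq)
qed

lemma matrix_exp_inverse:
  fixes A :: "real ^ 'n ^ 'n"
  shows "matrix_exp (t *\<^sub>R A) ** matrix_exp ((- t) *\<^sub>R A) = mat 1"
  using matrix_exp_add[of t "-t" A] by (simp del: scaleR_minus_left)

lemma continuous_on_matrix_exp:
  fixes A :: "real ^ 'n ^ 'n"
  assumes "continuous_on S h"
  shows "continuous_on S (\<lambda>t. matrix_exp (h t *\<^sub>R A))"
proof -
  have "continuous_on UNIV (\<lambda>t. matrix_exp (t *\<^sub>R A))"
    by (rule continuous_on_vector_derivative) (rule matrix_exp_has_vector_derivative)
  then show ?thesis using continuous_on_compose2[OF _ assms] by blast
qed

section \<open>Exponential decay for Hurwitz matrices\<close>

text \<open>The vector $q(A)v$.\<close>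

definition poly_act :: "complex ^ 'n ^ 'n \<Rightarrow> complex poly \<Rightarrow> complex ^ 'n \<Rightarrow> complex ^ 'n" where
  "poly_act A q v = (\<Sum>i\<le>degree q. coeff q i *s ((*v) A ^^ i) v)"

lemma poly_act_eq:
  assumes "degree q \<le> n"
  shows "poly_act A q v = (\<Sum>i\<le>n. coeff q i *s ((*v) A ^^ i) v)"
  unfolding poly_act_def
  using assms by (intro sum.mono_neutral_left) (auto simp: coeff_eq_0)

lemma funpow_matrix_add:
  fixes A :: "complex ^ 'n ^ 'n"
  shows "((*v) A ^^ i) (v + w) = ((*v) A ^^ i) v + ((*v) A ^^ i) (w :: complex ^ 'n)"
  by (induction i) (auto simp: matrix_vector_right_distrib)

lemma vec_scalar_commute: "A *v (l *s v) = l *s (A *v (v :: complex ^ 'n))"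
  by (simp add: vec_eq_iff matrix_vector_mult_def sum_distrib_left mult_ac)

lemma funpow_matrix_scale:
  fixes A :: "complex ^ 'n ^ 'n"
  shows "((*v) A ^^ i) (l *s v) = l *s ((*v) A ^^ i) (v :: complex ^ 'n)"
  by (induction i) (auto simp: vec_scalar_commute)

lemma poly_act_add: "poly_act A q (v + w) = poly_act A q v + poly_act A q w"
  by (simp add: poly_act_def funpow_matrix_add vec.scale_right_distrib sum.distrib)

lemma poly_act_scale: "poly_act A q (l *s v) = l *s poly_act A q v"
  by (simp add: poly_act_def funpow_matrix_scale vec.scale_sum_right mult_ac)

lemma poly_act_mult: "poly_act A q (A *v v) = A *v poly_act A q v"
proof -
  have "((*v) A ^^ i) (A *v v) = A *v ((*v) A ^^ i) v" for i by (induction i) auto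
  then show ?thesis
    by (simp add: poly_act_def vec_scalar_commute[symmetric] linear_sum[OF matrix_vector_mul_linear])
qed

lemma poly_act_linear_factor:
  "poly_act A ([:-l, 1:] * q) v = poly_act A q (A *v v + (- l) *s v)"
proof -
  define n where "n = Suc (degree q)"
  have deg: "degree ([:-l, 1:] * q) \<le> n" "degree q \<le> n"
    using degree_mult_le[of "[:-l, 1:]" q] by (auto simp: n_def)
  have c: "coeff ([:-l, 1:] * q) i = (case i of 0 \<Rightarrow> 0 | Suc j \<Rightarrow> coeff q j) - l * coeff q i" for i
    by (simp add: coeff_pCons split: nat.split)
  have "poly_act A ([:-l, 1:] * q) v =
      (\<Sum>i\<le>n. (case i of 0 \<Rightarrow> 0 | Suc j \<Rightarrow> coeff q j) *s ((*v) A ^^ i) v) + (- l) *s (\<Sum>i\<le>n. coeff q i *s ((*v) A ^^ i) v)"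
    unfolding poly_act_eq[OF deg(1)] c vec.scale_sum_right
    by (simp add: vec.scale_left_diff_distrib sum_subtractf sum_negf vec.scale_minus_left)
  also have "(\<Sum>i\<le>n. (case i of 0 \<Rightarrow> 0 | Suc j \<Rightarrow> coeff q j) *s ((*v) A ^^ i) v) = poly_act A q (A *v v)"
    unfolding n_def sum.atMost_Suc_shift poly_act_def by (simp add: funpow_swap1)
  also have "(\<Sum>i\<le>n. coeff q i *s ((*v) A ^^ i) v) = poly_act A q v" by (rule poly_act_eq[OF deg(2), symmetric])
  finally show ?thesis by (simp only: poly_act_add poly_act_scale)
qed

text \<open>There are more vectors $v, Av, \dots, A^nv$ than dimensions, so they are linearly dependent.\<close>

lemma annihilating_poly_exists:
  fixes A :: "complex ^ 'n ^ 'n"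
  shows "\<exists>q. q \<noteq> 0 \<and> poly_act A q v = 0"
proof -
  define N where "N = CARD('n)"
  define w where "w i = ((*v) A ^^ i) v" for i
  have "\<exists>cf. (\<exists>i\<le>N. cf i \<noteq> 0) \<and> (\<Sum>i\<le>N. cf i *s w i) = 0"
  proof (cases "inj_on w {..N}")
    case False
    then obtain i j where ij: "i \<le> N" "j \<le> N" "i \<noteq> j" "w i = w j" by (auto simp: inj_on_def)
    define cf :: "nat \<Rightarrow> complex" where "cf = (\<lambda>k. (if k = i then 1 else 0) - (if k = j then 1 else 0))"
    have "(\<Sum>k\<le>N. cf k *s w k) = (\<Sum>k\<le>N. if k = i then w k else 0) - (\<Sum>k\<le>N. if k = j then w k else 0)"
      unfolding cf_def vec.scale_left_diff_distrib sum_subtractf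
      by (intro arg_cong2[of _ _ _ _ "(-)"] sum.cong) auto
    also have "\<dots> = 0" using ij by simp
    finally have "(\<Sum>k\<le>N. cf k *s w k) = 0" .
    moreover have "cf i \<noteq> 0" using ij by (simp add: cf_def)
    ultimately show ?thesis using ij(1) by blast
  next
    case True
    let ?S = "w ` {..N}"
    have "card ?S = Suc N" using True by (simp add: card_image)
    moreover have "vec.dim ?S \<le> N" unfolding N_def by (rule dim_subset_UNIV_cart_gen)
    ultimately have "vec.dependent ?S" by (intro vec.dependent_biggerset_general) auto
    then obtain u where u: "\<exists>x\<in>?S. u x \<noteq> 0" "(\<Sum>x\<in>?S. u x *s x) = 0"
      using vec.dependent_finite[of ?S] by auto
    have "(\<Sum>i\<le>N. u (w i) *s w i) = 0" using u(2) by (simp add: sum.reindex[OF True])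
    then show ?thesis using u(1) by (intro exI[of _ "u \<circ> w"]) auto
  qed
  then obtain cf where cf: "\<exists>i\<le>N. cf i \<noteq> 0" "(\<Sum>i\<le>N. cf i *s w i) = 0" by blast
  define q where "q = (\<Sum>i\<le>N. monom (cf i) i)"
  have cq: "coeff q i = (if i \<le> N then cf i else 0)" for i
    by (simp add: q_def coeff_sum)
  have "degree q \<le> N" by (rule degree_le) (simp add: cq)
  then have "poly_act A q v = (\<Sum>i\<le>N. cf i *s w i)"
    by (subst poly_act_eq[where n=N]) (auto simp: cq w_def)
  moreover have "q \<noteq> 0" using cf(1) cq by (metis coeff_0)
  ultimately show ?thesis using cf(2) by auto
qed

definition eig_step :: "complex ^ 'n ^ 'n \<Rightarrow> complex \<Rightarrow> complex ^ 'n \<Rightarrow> complex ^ 'n" where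
  "eig_step A l v = A *v v + (- l) *s v"

text \<open>Split a linear factor $X - l$ off \<open>q\<close>. Either the cofactor annihilates \<open>v\<close>, or it maps
  \<open>v\<close> to an eigenvector for \<open>l\<close>, so that $l$ has negative real part, and it annihilates
  $(A - lI)v$. Such chains of eigenvalues take the place of the Jordan normal form.\<close>

lemma eigenvalue_chain_of_poly:
  fixes A :: "complex ^ 'n ^ 'n"
  assumes eig: "\<And>l v. v \<noteq> 0 \<Longrightarrow> A *v v = l *s v \<Longrightarrow> Re l < 0"
  shows "q \<noteq> 0 \<Longrightarrow> poly_act A q v = 0 \<Longrightarrow> \<exists>ls. (\<forall>l\<in>set ls. Re l < 0) \<and> fold (eig_step A) ls v = 0"
proof (induction "degree q" arbitrary: q v)
  case 0
  then obtain a where "q = [:a:]" "a \<noteq> 0" by (metis degree_eq_zeroE pCons_eq_0_iff)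
  then have "v = 0" using 0 by (simp add: poly_act_def)
  then show ?case by (intro exI[of _ "[]"]) auto
next
  case (Suc n)
  have "\<not> (\<exists>a l. a \<noteq> 0 \<and> l = 0 \<and> q = pCons a l)" using Suc(2) by auto
  then obtain l where "poly q l = 0" using fundamental_theorem_of_algebra_alt by blast
  then obtain q' where q': "q = [:-l, 1:] * q'" by (metis poly_eq_0_iff_dvd dvdE)
  with Suc(3) have "q' \<noteq> 0" by auto
  then have "degree q = Suc (degree q')" unfolding q' by (subst degree_mult_eq) auto
  then have n: "n = degree q'" using Suc(2) by simp
  show ?case
  proof (cases "poly_act A q' v = 0")
    case True
    then show ?thesis using Suc(1)[OF n \<open>q' \<noteq> 0\<close>] by blast
  next
    case False
    have z: "poly_act A q' (eig_step A l v) = 0"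
      using Suc(4) unfolding q' poly_act_linear_factor eig_step_def .
    then have "A *v poly_act A q' v + (- l) *s poly_act A q' v = 0"
      by (simp only: eig_step_def poly_act_add poly_act_scale poly_act_mult)
    then have "A *v poly_act A q' v = l *s poly_act A q' v" by simp
    then have "Re l < 0" using eig False by blast
    moreover obtain ls where "\<forall>l\<in>set ls. Re l < 0" "fold (eig_step A) ls (eig_step A l v) = 0"
      using Suc(1)[OF n \<open>q' \<noteq> 0\<close> z] by blast
    ultimately show ?thesis by (intro exI[of _ "l # ls"]) auto
  qed
qed

abbreviation (input) cmatrix :: "real ^ 'n ^ 'm \<Rightarrow> complex ^ 'n ^ 'm" where
  "cmatrix \<equiv> map_matrix complex_of_real"

lemma cmatrix_mult: "cmatrix (X ** Y) = cmatrix X ** cmatrix (Y :: real ^ 'n ^ 'n)"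
  by (simp add: vec_eq_iff matrix_matrix_mult_def)

lemma cmatrix_exp_has_vector_derivative:
  fixes A :: "real ^ 'n ^ 'n"
  shows "((\<lambda>t. (cmatrix (matrix_exp (t *\<^sub>R A)) *v v) $ j) has_vector_derivative
     (cmatrix (matrix_exp (t *\<^sub>R A)) *v (cmatrix A *v v)) $ j) (at t)"
proof -
  have eq: "(cmatrix M *v v) $ j = (\<Sum>k\<in>UNIV. complex_of_real (M $ j $ k) * v $ k)" for M :: "real ^ 'n ^ 'n"
    by (simp add: matrix_vector_mult_def)
  have "((\<lambda>t. \<Sum>k\<in>UNIV. complex_of_real (matrix_exp (t *\<^sub>R A) $ j $ k) * v $ k) has_vector_derivative
     (\<Sum>k\<in>UNIV. complex_of_real ((matrix_exp (t *\<^sub>R A) ** A) $ j $ k) * v $ k)) (at t)"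
    using matrix_exp_entry_DERIV[of A j _ t] unfolding matrix_exp_series_right
    by (intro has_vector_derivative_sum has_vector_derivative_mult_left)
      (auto simp: has_real_derivative_iff_has_vector_derivative intro!: has_vector_derivative_of_real)
  then show ?thesis unfolding eq[symmetric] cmatrix_mult matrix_vector_mul_assoc .
qed

text \<open>For $v' = (A - lI)v$ the derivative of $e^{-lt}e^{tA}v$ is $e^{-lt}e^{tA}v'$. Integration
  therefore passes the decay rate \<open>\<mu>\<close> from $e^{tA}v'$ to $e^{tA}v$, because the real part of
  \<open>l\<close> is below \<open>-\<mu>\<close>.\<close>

lemma eig_chain_decay:
  fixes A :: "real ^ 'n ^ 'n"
  shows "fold (eig_step (cmatrix A)) ls v = 0 \<Longrightarrow> (\<forall>l\<in>set ls. Re l < - \<mu>) \<Longrightarrow>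
     \<exists>K\<ge>0. \<forall>t\<ge>0. \<forall>j. norm ((cmatrix (matrix_exp (t *\<^sub>R A)) *v v) $ j) \<le> K * exp (- \<mu> * t)"
proof (induction ls arbitrary: v)
  case Nil
  then show ?case by (intro exI[of _ 0]) simp
next
  case (Cons l ls)
  define v' where "v' = eig_step (cmatrix A) l v"
  let ?y = "\<lambda>v t j. (cmatrix (matrix_exp (t *\<^sub>R A)) *v v) $ j"
  obtain K where K: "K \<ge> 0" "\<And>t j. t \<ge> 0 \<Longrightarrow> norm (?y v' t j) \<le> K * exp (- \<mu> * t)"
    using Cons.IH[of v'] Cons.prems unfolding v'_def by (simp only: fold_simps set_simps) (meson insertCI)
  define \<alpha> where "\<alpha> = - Re l - \<mu>"
  have "\<alpha> > 0" using Cons.prems(2) by (auto simp: \<alpha>_def)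
  have main: "norm (?y v t j) \<le> (norm v + K / \<alpha>) * exp (- \<mu> * t)" if "t \<ge> 0" for t j
  proof -
    define h where "h t = exp (- l * of_real t) * ?y v t j" for t
    define \<phi> where "\<phi> t = K / \<alpha> * exp (\<alpha> * t)" for t
    have hd: "(h has_vector_derivative exp (- l * of_real s) * ?y v' s j) (at s)" for s
    proof -
      have "((\<lambda>s. exp (- l * of_real s)) has_vector_derivative (- l) * exp (- l * of_real s)) (at s)"
        by (auto intro!: derivative_eq_intros has_vector_derivative_real_field)
      from has_vector_derivative_mult[OF this cmatrix_exp_has_vector_derivative[of A v j s]]
      have hh: "(h has_vector_derivative exp (- l * of_real s) * ?y (cmatrix A *v v) s j
          + (- l) * exp (- l * of_real s) * ?y v s j) (at s)" unfolding h_def .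
      have yv': "?y v' s j = ?y (cmatrix A *v v) s j + (- l) * ?y v s j"
        by (simp only: v'_def eig_step_def matrix_vector_right_distrib vec_scalar_commute
            vector_add_component vector_smult_component)
      have eq: "exp (- l * of_real s) * ?y (cmatrix A *v v) s j + (- l) * exp (- l * of_real s) * ?y v s j
         = exp (- l * of_real s) * ?y v' s j"
        unfolding yv' by (simp add: algebra_simps)
      show ?thesis using hh unfolding eq .
    qed
    have pd: "(\<phi> has_vector_derivative K * exp (\<alpha> * s)) (at s)" for s
      unfolding \<phi>_def has_real_derivative_iff_has_vector_derivative[symmetric]
      using \<open>\<alpha> > 0\<close> by (auto intro!: derivative_eq_intros)
    have "norm (h t - h 0) \<le> \<phi> t"
    proof (cases "t = 0")
      case True
      then show ?thesis using K(1) \<open>\<alpha> > 0\<close> by (simp add: \<phi>_def)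
    next
      case False
      have "norm (h t - h 0) \<le> \<phi> t - \<phi> 0"
      proof (rule differentiable_bound_general)
        show "0 < t" using False that by simp
        show "continuous_on {0..t} h" "continuous_on {0..t} \<phi>"
          by (rule continuous_on_vector_derivative, rule has_vector_derivative_at_within, rule hd pd)+
        show "norm (exp (- l * of_real s) * ?y v' s j) \<le> K * exp (\<alpha> * s)" if "0 < s" "s < t" for s
        proof -
          have "norm (exp (- l * of_real s) * ?y v' s j) = exp (- Re l * s) * norm (?y v' s j)"
            by (simp add: norm_mult)
          also have "\<dots> \<le> exp (- Re l * s) * (K * exp (- \<mu> * s))"
            using K(2)[of s j] that by (intro mult_left_mono) auto
          also have "\<dots> = K * exp (\<alpha> * s)"
            by (simp add: \<alpha>_def mult_exp_exp algebra_simps)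
          finally show ?thesis .
        qed
      qed (use hd pd in auto)
      moreover have "\<phi> 0 \<ge> 0" using K(1) \<open>\<alpha> > 0\<close> by (simp add: \<phi>_def)
      ultimately show ?thesis by linarith
    qed
    moreover have "norm (h 0) \<le> norm v * exp (\<alpha> * t)"
    proof -
      have "cmatrix (mat 1 :: real ^ 'n ^ 'n) = mat 1" by (simp add: vec_eq_iff mat_def)
      then have "h 0 = v $ j" by (simp add: h_def)
      then have "norm (h 0) \<le> norm v" by (simp add: Finite_Cartesian_Product.norm_nth_le)
      also have "\<dots> \<le> norm v * exp (\<alpha> * t)" using \<open>\<alpha> > 0\<close> that by (simp add: mult_le_cancel_left1)
      finally show ?thesis .
    qed
    ultimately have "norm (h t) \<le> norm v * exp (\<alpha> * t) + \<phi> t"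
      using norm_triangle_sub[of "h t" "h 0"] by linarith
    then have hb: "norm (h t) \<le> (norm v + K / \<alpha>) * exp (\<alpha> * t)" by (simp add: \<phi>_def algebra_simps)
    have "?y v t j = exp (l * of_real t) * h t" by (simp add: h_def mult_exp_exp flip: mult.assoc)
    then have "norm (?y v t j) = exp (Re l * t) * norm (h t)" by (simp add: norm_mult)
    also have "\<dots> \<le> exp (Re l * t) * ((norm v + K / \<alpha>) * exp (\<alpha> * t))" by (intro mult_left_mono hb) auto
    also have "\<dots> = (norm v + K / \<alpha>) * exp (- \<mu> * t)" by (simp add: \<alpha>_def mult_exp_exp algebra_simps)
    finally show ?thesis .
  qed
  have "norm v + K / \<alpha> \<ge> 0" using K(1) \<open>\<alpha> > 0\<close> by simp
  then show ?case using main by blast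
qed

theorem hurwitz_matrix_exp_decay:
  fixes A :: "real ^ 'n ^ 'n"
  assumes "hurwitz A"
  shows "\<exists>K>0. \<exists>\<mu>>0. \<forall>t\<ge>0. \<forall>v. norm (matrix_exp (t *\<^sub>R A) *v v) \<le> K * exp (- \<mu> * t) * norm v"
proof -
  have "\<exists>ls. (\<forall>l\<in>set ls. Re l < 0) \<and> fold (eig_step (cmatrix A)) ls (axis j 1) = 0" for j
  proof -
    obtain q where "q \<noteq> 0" "poly_act (cmatrix A) q (axis j 1) = 0" using annihilating_poly_exists by blast
    then show ?thesis
      using assms by (intro eigenvalue_chain_of_poly[of "cmatrix A" q]) (auto simp: hurwitz_def)
  qed
  then obtain ls where ls: "\<And>j l. l \<in> set (ls j) \<Longrightarrow> Re l < 0"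
     "\<And>j. fold (eig_step (cmatrix A)) (ls j) (axis j 1) = 0" by metis
  define S where "S = insert (- 1) (\<Union>j. set (ls j))"
  have "finite S" "S \<noteq> {}" "\<And>l. l \<in> S \<Longrightarrow> Re l < 0" using ls(1) by (auto simp: S_def)
  define \<mu> where "\<mu> = Min ((\<lambda>l. - Re l) ` S) / 2"
  have "Min ((\<lambda>l. - Re l) ` S) > 0"
    using \<open>finite S\<close> \<open>S \<noteq> {}\<close> \<open>\<And>l. l \<in> S \<Longrightarrow> Re l < 0\<close> by (subst Min_gr_iff) auto
  then have "\<mu> > 0" by (simp add: \<mu>_def)
  have less: "Re l < - \<mu>" if "l \<in> set (ls j)" for l j
  proof -
    have "l \<in> S" using that by (auto simp: S_def)
    then have "Min ((\<lambda>l. - Re l) ` S) \<le> - Re l" using \<open>finite S\<close> by auto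
    then have "2 * \<mu> \<le> - Re l" by (simp add: \<mu>_def)
    then show ?thesis using \<open>\<mu> > 0\<close> by linarith
  qed
  have "\<exists>K\<ge>0. \<forall>t\<ge>0. \<forall>i. norm ((cmatrix (matrix_exp (t *\<^sub>R A)) *v axis j 1) $ i) \<le> K * exp (- \<mu> * t)" for j
    using eig_chain_decay[OF ls(2)[of j]] less by blast
  then obtain K where K: "\<And>j. K j \<ge> 0"
    "\<And>t i j. t \<ge> 0 \<Longrightarrow> norm ((cmatrix (matrix_exp (t *\<^sub>R A)) *v axis j 1) $ i) \<le> K j * exp (- \<mu> * t)" by metis
  have entry: "\<bar>matrix_exp (t *\<^sub>R A) $ i $ j\<bar> \<le> K j * exp (- \<mu> * t)" if "t \<ge> 0" for t i j
  proof -
    have "(cmatrix (matrix_exp (t *\<^sub>R A)) *v axis j 1) $ i = complex_of_real (matrix_exp (t *\<^sub>R A) $ i $ j)"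
      by (simp add: matrix_vector_mult_def axis_def if_distrib cong: if_cong)
    then show ?thesis using K(2)[OF that, where i=i and j=j] by simp
  qed
  define K' where "K' = (\<Sum>i\<in>(UNIV::'n set). \<Sum>j\<in>UNIV. K j) + 1"
  have "norm (matrix_exp (t *\<^sub>R A) *v v) \<le> K' * exp (- \<mu> * t) * norm v" if "t \<ge> 0" for t v
  proof -
    have "norm (matrix_exp (t *\<^sub>R A) *v v) \<le> (\<Sum>i\<in>UNIV. \<Sum>j\<in>UNIV. \<bar>matrix_exp (t *\<^sub>R A) $ i $ j\<bar>) * norm v"
      by (rule norm_matrix_vector_le)
    also have "\<dots> \<le> (\<Sum>i\<in>(UNIV::'n set). \<Sum>j\<in>UNIV. K j * exp (- \<mu> * t)) * norm v"
      using entry[OF that] by (intro mult_right_mono sum_mono) auto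
    also have "\<dots> \<le> K' * exp (- \<mu> * t) * norm v"
      unfolding K'_def sum_distrib_right[symmetric] by (intro mult_right_mono) auto
    finally show ?thesis .
  qed
  moreover have "K' > 0" unfolding K'_def using K(1) by (intro add_nonneg_pos sum_nonneg) auto
  ultimately show ?thesis using \<open>\<mu> > 0\<close> by blast
qed

section \<open>Locally bounded integrable functions\<close>

text \<open>The class of right-hand sides: it contains the inputs, is stable under sums, linear images,
  time shifts and products with continuous functions, and boundedness makes indefinite integrals
  locally Lipschitz.\<close>

definition admissible :: "real \<Rightarrow> (real \<Rightarrow> 'a::euclidean_space) \<Rightarrow> bool" where
  "admissible a g \<longleftrightarrow> (\<forall>b. bounded (g ` {a..b}) \<and> g integrable_on {a..b})"

lemma admissibleD:
  assumes "admissible a g" "a \<le> c"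
  shows "bounded (g ` {c..b})" "g integrable_on {c..b}" "g absolutely_integrable_on {c..b}"
proof -
  have sub: "{c..b} \<subseteq> {a..b}" using assms(2) by auto
  show b: "bounded (g ` {c..b})"
    by (rule bounded_subset[OF _ image_mono[OF sub]]) (use assms(1) in \<open>simp add: admissible_def\<close>)
  show i: "g integrable_on {c..b}"
    by (rule integrable_on_subinterval[OF _ sub]) (use assms(1) in \<open>simp add: admissible_def\<close>)
  obtain C where "\<And>t. t \<in> {c..b} \<Longrightarrow> norm (g t) \<le> C" using b unfolding bounded_iff by blast
  then show "g absolutely_integrable_on {c..b}"
    using i by (intro absolutely_integrable_integrable_bound[where g="\<lambda>_. C"]) auto
qed

lemma admissible_mono: "admissible a g \<Longrightarrow> a \<le> c \<Longrightarrow> admissible c g"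
  unfolding admissible_def[of c] using admissibleD by blast

lemma admissible_add:
  assumes "admissible a f" "admissible a g" shows "admissible a (\<lambda>t. f t + g t)"
  unfolding admissible_def
proof (intro allI conjI)
  fix b
  show "bounded ((\<lambda>t. f t + g t) ` {a..b})"
    using assms unfolding admissible_def by (intro bounded_plus_comp) auto
  show "(\<lambda>t. f t + g t) integrable_on {a..b}"
    using assms unfolding admissible_def by (intro integrable_add) auto
qed

lemma admissible_linear:
  assumes "bounded_linear L" "admissible a f" shows "admissible a (\<lambda>t. L (f t))"
  unfolding admissible_def
proof (intro allI conjI)
  fix b
  show "bounded ((\<lambda>t. L (f t)) ` {a..b})"
    using assms bounded_linear_image[of "f ` {a..b}" L] unfolding admissible_def by (auto simp: image_image)
  show "(\<lambda>t. L (f t)) integrable_on {a..b}"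
    using assms integrable_linear[of f _ L] unfolding admissible_def by (auto simp: o_def)
qed

lemma admissible_shift:
  assumes "admissible a f" shows "admissible (a + h) (\<lambda>t. f (t - h))"
  unfolding admissible_def
proof (intro allI conjI)
  fix b
  have "(\<lambda>t. f (t - h)) ` {a + h..b} \<subseteq> f ` {a..b - h}" by (auto intro!: imageI)
  then show "bounded ((\<lambda>t. f (t - h)) ` {a + h..b})"
    using assms bounded_subset unfolding admissible_def by blast
  show "(\<lambda>t. f (t - h)) integrable_on {a + h..b}"
    using integrable_on_shift_Icc_real[of f "-h" "a + h" b] assms unfolding admissible_def
    by (simp add: o_def)
qed

lemma admissible_bilinear:
  fixes f :: "real \<Rightarrow> 'a::euclidean_space" and g :: "real \<Rightarrow> 'b::euclidean_space"
    and pr :: "'a \<Rightarrow> 'b \<Rightarrow> 'c::euclidean_space"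
  assumes pr: "bounded_bilinear pr" and f: "continuous_on {a..} f" and g: "admissible a g"
  shows "admissible a (\<lambda>t. pr (f t) (g t))"
  unfolding admissible_def
proof (intro allI conjI)
  fix b
  have fc: "continuous_on {a..b} f" using f by (rule continuous_on_subset) auto
  then have bf: "bounded (f ` {a..b})" by (auto intro: compact_imp_bounded compact_continuous_image)
  note ga = admissibleD[OF g order_refl, where b=b]
  have "(\<lambda>t. pr (f t) (g t)) absolutely_integrable_on {a..b}"
  proof (rule absolutely_integrable_bounded_measurable_product[OF _ _ _ bf ga(3)])
    show "bilinear pr" using pr bilinear_conv_bounded_bilinear by blast
    show "f \<in> borel_measurable (lebesgue_on {a..b})"
      using fc by (rule continuous_imp_measurable_on_sets_lebesgue) simp
  qed simp
  then show "(\<lambda>t. pr (f t) (g t)) integrable_on {a..b}"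
    using absolutely_integrable_on_def by blast
  obtain C where C: "\<And>x y. norm (pr x y) \<le> norm x * norm y * C" "C > 0"
    using bounded_bilinear.pos_bounded[OF pr] by metis
  obtain C1 where C1: "\<And>t. t \<in> {a..b} \<Longrightarrow> norm (f t) \<le> C1" using bf unfolding bounded_iff by blast
  obtain C2 where C2: "\<And>t. t \<in> {a..b} \<Longrightarrow> norm (g t) \<le> C2" using ga(1) unfolding bounded_iff by blast
  have "norm (pr (f t) (g t)) \<le> C1 * C2 * C" if "t \<in> {a..b}" for t
  proof -
    have "norm (f t) * norm (g t) * C \<le> C1 * C2 * C"
      using C1[OF that] C2[OF that] C(2) order_trans[OF norm_ge_zero C1[OF that]]
      by (intro mult_right_mono mult_mono) simp_all
    then show ?thesis using C(1) order_trans by blast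
  qed
  then show "bounded ((\<lambda>t. pr (f t) (g t)) ` {a..b})" unfolding bounded_iff by blast
qed

lemma bounded_measurable_integrable_on:
  fixes g :: "real \<Rightarrow> 'a::euclidean_space"
  assumes "g \<in> borel_measurable (lebesgue_on S)" "{a..b} \<subseteq> S" "bounded (g ` {a..b})"
  shows "g integrable_on {a..b}"
proof -
  obtain C where C: "\<And>t. t \<in> {a..b} \<Longrightarrow> norm (g t) \<le> C" using assms(3) unfolding bounded_iff by blast
  have "g \<in> borel_measurable (lebesgue_on {a..b})"
    using measurable_restrict_mono[OF assms(1,2)] .
  then show ?thesis
    by (rule measurable_bounded_by_integrable_imp_integrable[where g="\<lambda>_. C"]) (simp_all add: C integrable_const_ivl)
qed

lemma L_inf_loc_admissible:
  assumes "g \<in> L_inf_loc {0..}" shows "admissible 0 g"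
proof -
  have "bounded (g ` {0..b})" for b using assms by (auto simp: L_inf_loc_def)
  then show ?thesis using assms bounded_measurable_integrable_on[of g "{0..}" 0]
    unfolding admissible_def L_inf_loc_def by auto
qed

section \<open>Grids of the half-line\<close>

text \<open>The sampling instants and the hold instants are grids; the half-line is partitioned into the
  cells between consecutive grid points.\<close>

definition grid :: "(nat \<Rightarrow> real) \<Rightarrow> bool" where
  "grid \<theta> \<longleftrightarrow> \<theta> 0 = 0 \<and> (\<forall>i. \<theta> i < \<theta> (Suc i)) \<and> (\<forall>T. \<exists>i. T < \<theta> i)"

lemma grid_strict_mono: "grid \<theta> \<Longrightarrow> strict_mono \<theta>"
  by (simp add: grid_def strict_mono_Suc_iff)

lemma grid_cell:
  assumes "grid \<theta>" "t \<ge> 0"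
  obtains i where "\<theta> i \<le> t" "t < \<theta> (Suc i)"
proof -
  define n where "n = (LEAST i. t < \<theta> i)"
  have ex: "\<exists>i. t < \<theta> i" using assms by (auto simp: grid_def)
  have n: "t < \<theta> n" unfolding n_def using ex by (rule LeastI_ex)
  have "n \<noteq> 0"
  proof
    assume "n = 0"
    then show False using n assms by (simp add: grid_def)
  qed
  then obtain i where "n = Suc i" using not0_implies_Suc by blast
  moreover then have "\<theta> i \<le> t" using not_less_Least[of i "\<lambda>i. t < \<theta> i"] n_def by auto
  ultimately show ?thesis using that n by blast
qed

lemma grid_cell_unique:
  assumes "grid \<theta>" "\<theta> i \<le> t" "t < \<theta> (Suc i)" "\<theta> j \<le> t" "t < \<theta> (Suc j)"
  shows "i = j"
proof -
  note m = grid_strict_mono[OF assms(1)]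
  have "\<theta> i < \<theta> (Suc j)" "\<theta> j < \<theta> (Suc i)" using assms by auto
  then show ?thesis using strict_mono_less[OF m] by (simp add: less_Suc_eq_le le_antisym)
qed

lemma grid_nonneg: "grid \<theta> \<Longrightarrow> \<theta> i \<ge> 0"
  using strict_mono_less_eq[OF grid_strict_mono, of \<theta> 0 i] by (simp add: grid_def)

lemma admissible_piecewise:
  fixes f :: "real \<Rightarrow> 'a::euclidean_space"
  assumes "grid \<theta>" and c: "\<And>i. continuous_on {\<theta> i..\<theta> (Suc i)} (g i)"
    and eq: "\<And>i t. \<theta> i \<le> t \<Longrightarrow> t < \<theta> (Suc i) \<Longrightarrow> f t = g i t"
  shows "admissible 0 f"
proof -
  have step: "bounded (f ` {\<theta> i..\<theta> (Suc i)}) \<and> f integrable_on {\<theta> i..\<theta> (Suc i)}" for i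
  proof
    have "bounded (g i ` {\<theta> i..\<theta> (Suc i)})"
      using c by (auto intro: compact_imp_bounded compact_continuous_image)
    then have b: "bounded (insert (f (\<theta> (Suc i))) (g i ` {\<theta> i..\<theta> (Suc i)}))" by simp
    have "f t \<in> insert (f (\<theta> (Suc i))) (g i ` {\<theta> i..\<theta> (Suc i)})" if "t \<in> {\<theta> i..\<theta> (Suc i)}" for t
      using eq[of i t] that by (cases "t = \<theta> (Suc i)") auto
    then show "bounded (f ` {\<theta> i..\<theta> (Suc i)})" by (intro bounded_subset[OF b]) blast
    have "g i integrable_on {\<theta> i..\<theta> (Suc i)}" using c by (rule integrable_continuous_interval)
    then show "f integrable_on {\<theta> i..\<theta> (Suc i)}"
      by (rule integrable_spike[where S="{\<theta> (Suc i)}"]) (simp_all add: eq)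
  qed
  have all: "bounded (f ` {0..\<theta> n}) \<and> f integrable_on {0..\<theta> n}" for n
  proof (induction n)
    case 0
    have "f integrable_on {0::real}" using integrable_on_refl[of f 0] by simp
    then show ?case using assms(1) by (simp add: grid_def)
  next
    case (Suc n)
    have le: "0 \<le> \<theta> n" "\<theta> n \<le> \<theta> (Suc n)" using grid_nonneg[OF assms(1)] assms(1) 
      by (auto simp: grid_def less_imp_le)
    have "{0..\<theta> (Suc n)} = {0..\<theta> n} \<union> {\<theta> n..\<theta> (Suc n)}" using le by auto
    then show ?case
      using Suc step[of n] Henstock_Kurzweil_Integration.integrable_combine[OF le, of f] by (auto simp: image_Un)
  qed
  show ?thesis unfolding admissible_def
  proof
    fix b
    obtain n where "b < \<theta> n" using assms(1) by (auto simp: grid_def)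
    then have sub: "{0..b} \<subseteq> {0..\<theta> n}" by auto
    have "bounded (f ` {0..b})" by (rule bounded_subset[OF _ image_mono[OF sub]]) (simp add: all)
    moreover have "f integrable_on {0..b}" by (rule integrable_on_subinterval[OF _ sub]) (simp add: all)
    ultimately show "bounded (f ` {0..b}) \<and> f integrable_on {0..b}" ..
  qed
qed

section \<open>Caratheodory solutions and variation of constants\<close>

lemma AE_lebesgue_on_iff_negligible:
  assumes "S \<in> sets lebesgue"
  shows "(AE t in lebesgue_on S. P t) \<longleftrightarrow> (\<exists>N. negligible N \<and> (\<forall>t\<in>S - N. P t))"
proof -
  have "(AE t in lebesgue_on S. P t) \<longleftrightarrow> (AE t in lebesgue. t \<in> S \<longrightarrow> P t)"
    using assms by (simp add: AE_restrict_space_iff)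
  also have "\<dots> \<longleftrightarrow> (\<exists>N\<in>null_sets lebesgue. {t. \<not> (t \<in> S \<longrightarrow> P t)} \<subseteq> N)"
    by (simp add: eventually_ae_filter)
  also have "\<dots> \<longleftrightarrow> (\<exists>N. negligible N \<and> (\<forall>t\<in>S - N. P t))"
    unfolding negligible_iff_null_sets by auto
  finally show ?thesis .
qed

lemma solves_on_iff:
  assumes "S \<in> sets lebesgue"
  shows "solves_on S f g \<longleftrightarrow> (\<forall>a b. a \<le> b \<and> {a..b} \<subseteq> S \<longrightarrow> abs_cont_on a b f) \<and>
     (\<exists>N. negligible N \<and> (\<forall>t\<in>S - N. (f has_vector_derivative g t) (at t within S)))"
  unfolding solves_on_def AE_lebesgue_on_iff_negligible[OF assms] ..

lemma solves_on_subset: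
  assumes "solves_on S f g" "S' \<subseteq> S" "S \<in> sets lebesgue" "S' \<in> sets lebesgue"
  shows "solves_on S' f g"
  using assms unfolding solves_on_iff[OF assms(3)] solves_on_iff[OF assms(4)]
  by (meson DiffD1 DiffD2 DiffI has_vector_derivative_within_subset subset_iff subset_trans)

lemma solves_on_cong:
  assumes "solves_on S f g" "\<And>t. t \<in> S \<Longrightarrow> f' t = f t" "\<And>t. t \<in> S \<Longrightarrow> g' t = g t" "S \<in> sets lebesgue"
  shows "solves_on S f' g'"
  unfolding solves_on_iff[OF assms(4)]
proof
  show "\<forall>a b. a \<le> b \<and> {a..b} \<subseteq> S \<longrightarrow> abs_cont_on a b f'"
  proof (intro allI impI)
    fix a b assume ab: "a \<le> b \<and> {a..b} \<subseteq> S"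
    then have "abs_cont_on a b f" using assms(1) by (simp add: solves_on_def)
    then show "abs_cont_on a b f'" by (rule abs_cont_on_cong) (use ab assms(2) in auto)
  qed
  obtain N where N: "negligible N" "\<forall>t\<in>S - N. (f has_vector_derivative g t) (at t within S)"
    using assms(1) unfolding solves_on_iff[OF assms(4)] by blast
  have "(f' has_vector_derivative g' t) (at t within S)" if "t \<in> S - N" for t
    using that N(2) assms(2,3) by (metis DiffD1 has_vector_derivative_transform)
  then show "\<exists>N. negligible N \<and> (\<forall>t\<in>S - N. (f' has_vector_derivative g' t) (at t within S))"
    using N(1) by blast
qed

lemma solves_on_add:
  assumes "solves_on S f1 g1" "solves_on S f2 g2" "S \<in> sets lebesgue"
  shows "solves_on S (\<lambda>t. f1 t + f2 t) (\<lambda>t. g1 t + g2 t)"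
proof -
  obtain N1 N2 where N: "negligible N1" "\<forall>t\<in>S - N1. (f1 has_vector_derivative g1 t) (at t within S)"
    "negligible N2" "\<forall>t\<in>S - N2. (f2 has_vector_derivative g2 t) (at t within S)"
    using assms(1,2) unfolding solves_on_iff[OF assms(3)] by metis
  have "negligible (N1 \<union> N2)" using N(1,3) by (rule negligible_Un)
  moreover have "\<forall>t\<in>S - (N1 \<union> N2). ((\<lambda>t. f1 t + f2 t) has_vector_derivative g1 t + g2 t) (at t within S)"
    using N(2,4) by (simp add: has_vector_derivative_add)
  moreover have "abs_cont_on a b (\<lambda>t. f1 t + f2 t)" if "a \<le> b \<and> {a..b} \<subseteq> S" for a b
    using assms(1,2) that by (intro abs_cont_on_add) (simp_all add: solves_on_def)
  ultimately show ?thesis unfolding solves_on_iff[OF assms(3)] by metis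
qed

lemma solves_on_linear:
  assumes "bounded_linear L" "solves_on S f g" "S \<in> sets lebesgue"
  shows "solves_on S (\<lambda>t. L (f t)) (\<lambda>t. L (g t))"
proof -
  obtain N where N: "negligible N" "\<forall>t\<in>S - N. (f has_vector_derivative g t) (at t within S)"
    using assms(2) unfolding solves_on_iff[OF assms(3)] by metis
  have "\<forall>t\<in>S - N. ((\<lambda>t. L (f t)) has_vector_derivative L (g t)) (at t within S)"
    using N(2) by (simp add: bounded_linear.has_vector_derivative[OF assms(1)])
  moreover have "abs_cont_on a b (\<lambda>t. L (f t))" if "a \<le> b \<and> {a..b} \<subseteq> S" for a b
    using assms(2) that by (intro abs_cont_on_linear[OF assms(1)]) (simp_all add: solves_on_def)
  ultimately show ?thesis unfolding solves_on_iff[OF assms(3)] using N(1) by metis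
qed

lemma solves_on_bilinear:
  fixes f1 :: "real \<Rightarrow> 'a::euclidean_space" and f2 :: "real \<Rightarrow> 'b::euclidean_space"
    and pr :: "'a \<Rightarrow> 'b \<Rightarrow> 'c::euclidean_space"
  assumes pr: "bounded_bilinear pr" and "solves_on S f1 g1" "solves_on S f2 g2" "S \<in> sets lebesgue"
  shows "solves_on S (\<lambda>t. pr (f1 t) (f2 t)) (\<lambda>t. pr (f1 t) (g2 t) + pr (g1 t) (f2 t))"
proof -
  obtain N1 N2 where N: "negligible N1" "\<forall>t\<in>S - N1. (f1 has_vector_derivative g1 t) (at t within S)"
    "negligible N2" "\<forall>t\<in>S - N2. (f2 has_vector_derivative g2 t) (at t within S)"
    using assms(2,3) unfolding solves_on_iff[OF assms(4)] by metis
  have "negligible (N1 \<union> N2)" using N(1,3) by (rule negligible_Un)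
  moreover have "\<forall>t\<in>S - (N1 \<union> N2). ((\<lambda>t. pr (f1 t) (f2 t)) has_vector_derivative
      pr (f1 t) (g2 t) + pr (g1 t) (f2 t)) (at t within S)"
    using N(2,4) by (simp add: bounded_bilinear.has_vector_derivative[OF pr])
  moreover have "abs_cont_on a b (\<lambda>t. pr (f1 t) (f2 t))" if "a \<le> b \<and> {a..b} \<subseteq> S" for a b
    using assms(2,3) that by (intro abs_cont_on_bilinear[OF pr]) (simp_all add: solves_on_def)
  ultimately show ?thesis unfolding solves_on_iff[OF assms(4)] by metis
qed

lemma C1_solves_on:
  fixes f :: "real \<Rightarrow> 'a::euclidean_space"
  assumes der: "\<And>t. t \<in> S \<Longrightarrow> (f has_vector_derivative g t) (at t within S)"
    and cont: "continuous_on S g" and "S \<in> sets lebesgue"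
  shows "solves_on S f g"
  unfolding solves_on_iff[OF assms(3)]
proof (intro conjI allI impI)
  fix a b assume "a \<le> b \<and> {a..b} \<subseteq> S"
  then have sub: "{a..b} \<subseteq> S" ..
  show "abs_cont_on a b f"
  proof (rule C1_imp_abs_cont_on[where f'=g])
    show "(f has_vector_derivative g t) (at t within {a..b})" if "t \<in> {a..b}" for t
      using has_vector_derivative_within_subset[OF der sub] sub that by blast
    show "continuous_on {a..b} g" by (rule continuous_on_subset[OF cont sub])
  qed
next
  show "\<exists>N. negligible N \<and> (\<forall>t\<in>S - N. (f has_vector_derivative g t) (at t within S))"
    by (rule exI[of _ "{}"]) (simp add: der)
qed

lemma abs_cont_on_shift:
  assumes "abs_cont_on a b f"
  shows "abs_cont_on (a + h) (b + h) (\<lambda>t. f (t - h))"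
  unfolding abs_cont_on_def
proof (intro allI impI)
  fix e :: real assume "e > 0"
  then obtain \<delta> where "\<delta> > 0" and \<delta>: "\<And>D T. D division_of T \<Longrightarrow> T \<subseteq> {a..b} \<Longrightarrow>
        (\<Sum>K\<in>D. Sup K - Inf K) < \<delta> \<Longrightarrow> (\<Sum>K\<in>D. norm (f (Sup K) - f (Inf K))) < e"
    using assms(1) unfolding abs_cont_on_def by metis
  have "(\<Sum>K\<in>D. norm (f (Sup K - h) - f (Inf K - h))) < e"
    if D: "D division_of T" "T \<subseteq> {a+h..b+h}" "(\<Sum>K\<in>D. Sup K - Inf K) < \<delta>" for D T
  proof -
    let ?s = "(+) (- h)"
    let ?D = "(`) ?s ` D"
    have d: "?D division_of (?s ` T)"
    proof (rule division_ofI)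
      show "finite ?D" using division_ofD(1)[OF D(1)] by simp
      show "\<Union>?D = ?s ` T" unfolding division_ofD(6)[OF D(1), symmetric] by blast
      fix K assume "K \<in> ?D"
      then obtain K0 where K0: "K0 \<in> D" "K = ?s ` K0" by blast
      show "K \<subseteq> ?s ` T" "K \<noteq> {}" using K0 division_ofD(2,3)[OF D(1)] by auto
      obtain u v where "K0 = cbox u v" using division_ofD(4)[OF D(1)] K0 by metis
      then have "K = cbox (u - h) (v - h)" using K0 by simp
      then show "\<exists>a b. K = cbox a b" by blast
      fix K' assume "K' \<in> ?D" "K \<noteq> K'"
      then obtain K1 where K1: "K1 \<in> D" "K' = ?s ` K1" by blast
      then have "interior K0 \<inter> interior K1 = {}" 
        using division_ofD(5)[OF D(1)] K0 \<open>K \<noteq> K'\<close> by blast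
      then have "?s ` interior K0 \<inter> ?s ` interior K1 = {}" by auto
      then show "interior K \<inter> interior K' = {}"
        unfolding K0 K1 interior_translation .
    qed
    have sub: "?s ` T \<subseteq> {a..b}" using D(2) by force
    have "inj ?s" by (simp add: inj_on_def)
    then have inj: "inj_on ((`) ?s) D" by (intro inj_onI) (simp only: inj_image_eq_iff)
    have si: "Sup (?s ` K) = Sup K - h \<and> Inf (?s ` K) = Inf K - h" if KD: "K \<in> D" for K
    proof -
      obtain u v where "K = cbox u v" "K \<noteq> {}" using division_ofD(3,4)[OF D(1) KD] by blast
      then have uv: "K = {u..v}" "u \<le> v" by auto
      have "?s ` K = {u - h..v - h}" unfolding uv by simp
      then show ?thesis using uv by simp
    qed
    have "(\<Sum>K\<in>?D. Sup K - Inf K) = (\<Sum>K\<in>D. Sup K - Inf K)"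
      unfolding sum.reindex[OF inj] o_def using si by (intro sum.cong) auto
    then have "(\<Sum>K\<in>?D. norm (f (Sup K) - f (Inf K))) < e" using \<delta>[OF d sub] D(3) by simp
    also have "(\<Sum>K\<in>?D. norm (f (Sup K) - f (Inf K))) = (\<Sum>K\<in>D. norm (f (Sup K - h) - f (Inf K - h)))"
      unfolding sum.reindex[OF inj] o_def using si by (intro sum.cong) auto
    finally show ?thesis .
  qed
  then show "\<exists>\<delta>>0. \<forall>D T. D division_of T \<and> T \<subseteq> {a + h..b + h} \<and> (\<Sum>K\<in>D. Sup K - Inf K) < \<delta> \<longrightarrow>
           (\<Sum>K\<in>D. norm (f (Sup K - h) - f (Inf K - h))) < e" using \<open>\<delta> > 0\<close> by blast
qed

lemma solves_on_shift:
  assumes "solves_on {a..} f g"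
  shows "solves_on {a + h..} (\<lambda>t. f (t - h)) (\<lambda>t. g (t - h))"
proof -
  have m: "{a..} \<in> sets lebesgue" "{a + h..} \<in> sets lebesgue" by auto
  obtain N where N: "negligible N" "\<forall>t\<in>{a..} - N. (f has_vector_derivative g t) (at t within {a..})"
    using assms unfolding solves_on_iff[OF m(1)] by blast
  show ?thesis unfolding solves_on_iff[OF m(2)]
  proof (intro conjI allI impI exI ballI)
    fix c d assume "c \<le> d \<and> {c..d} \<subseteq> {a + h..}"
    then have "abs_cont_on (c - h) (d - h) f" using assms by (auto simp: solves_on_def)
    then show "abs_cont_on c d (\<lambda>t. f (t - h))" using abs_cont_on_shift[of "c - h" "d - h" f h] by simp
  next
    show "negligible ((+) h ` N)" using N(1) by (rule negligible_translation)
    fix t assume "t \<in> {a + h..} - (+) h ` N"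
    then have "t - h \<in> {a..} - N" by (auto simp: image_iff algebra_simps)
    then have "(f has_vector_derivative g (t - h)) (at (t - h) within {a..})" using N(2) by blast
    then have "(f has_vector_derivative g (t - h)) (at (t - h) within (\<lambda>t. t - h) ` {a + h..})"
      by (rule has_vector_derivative_within_subset) auto
    then have "((f \<circ> (\<lambda>t. t - h)) has_vector_derivative 1 *\<^sub>R g (t - h)) (at t within {a + h..})"
      by (intro vector_diff_chain_within) (auto intro!: derivative_eq_intros)
    then show "((\<lambda>t. f (t - h)) has_vector_derivative g (t - h)) (at t within {a + h..})" by (simp add: o_def)
  qed
qed

lemma solves_on_has_integral:
  assumes "solves_on S f g" "a \<le> b" "{a..b} \<subseteq> S" "S \<in> sets lebesgue"
  shows "(g has_integral f b - f a) {a..b}"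
proof -
  obtain N where N: "negligible N" "\<forall>t\<in>S - N. (f has_vector_derivative g t) (at t within S)"
    using assms(1) unfolding solves_on_iff[OF assms(4)] by blast
  have "abs_cont_on a b f" using assms by (simp add: solves_on_def)
  then show ?thesis
  proof (rule abs_cont_on_FTC[OF assms(2) _ N(1)])
    fix t assume "t \<in> {a..b} - N"
    then have "(f has_vector_derivative g t) (at t within S)" using N(2) assms(3) by blast
    then show "(f has_vector_derivative g t) (at t within {a..b})"
      by (rule has_vector_derivative_within_subset[OF _ assms(3)])
  qed
qed

text \<open>The product $e^{(b-s)A}f(s)$ is absolutely continuous and has the derivative $e^{(b-s)A}g(s)$
  almost everywhere. For the gauge integral, integrability of this derivative is part of the
  conclusion.\<close>

lemma variation_of_constants:
  fixes A :: "real ^ 'n ^ 'n"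
  assumes f: "solves_on S f (\<lambda>t. A *v f t + g t)" and ab: "a \<le> b" "{a..b} \<subseteq> S" and S: "S \<in> sets lebesgue"
  shows "((\<lambda>s. matrix_exp ((b - s) *\<^sub>R A) *v g s) has_integral
     f b - matrix_exp ((b - a) *\<^sub>R A) *v f a) {a..b}"
proof -
  have 1: "solves_on S (\<lambda>s. matrix_exp ((b - s) *\<^sub>R A)) (\<lambda>s. (-1) *\<^sub>R (matrix_exp ((b - s) *\<^sub>R A) ** A))"
  proof (rule C1_solves_on[OF _ _ S])
    show "((\<lambda>s. matrix_exp ((b - s) *\<^sub>R A)) has_vector_derivative (-1) *\<^sub>R (matrix_exp ((b - t) *\<^sub>R A) ** A)) (at t within S)" for t
      unfolding matrix_exp_commute[symmetric]
      by (rule vector_diff_chain_within[of "\<lambda>s. b - s" "-1" t S "\<lambda>t. matrix_exp (t *\<^sub>R A)", unfolded o_def])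
          (auto intro!: derivative_eq_intros matrix_exp_has_vector_derivative)
    have "bounded_linear (\<lambda>M. M ** A)"
      by (rule linear_conv_bounded_linear[THEN iffD1])
       (auto simp: linear_iff matrix_matrix_mult_def vec_eq_iff sum.distrib sum_distrib_left algebra_simps)
    then have "continuous_on S (\<lambda>s. matrix_exp ((b - s) *\<^sub>R A) ** A)"
      by (intro bounded_linear.continuous_on[of "\<lambda>M. M ** A"] continuous_on_matrix_exp continuous_intros)
    then show "continuous_on S (\<lambda>s. (-1) *\<^sub>R (matrix_exp ((b - s) *\<^sub>R A) ** A))"
      by (intro continuous_intros)
  qed
  have "solves_on S (\<lambda>s. matrix_exp ((b - s) *\<^sub>R A) *v f s) (\<lambda>s. matrix_exp ((b - s) *\<^sub>R A) *v g s)"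
    by (rule solves_on_cong[OF solves_on_bilinear[OF bounded_bilinear_matrix_vector 1 f S] _ _ S])
      (auto simp: matrix_vector_right_distrib matrix_vector_mul_assoc[symmetric]
        bounded_bilinear.minus_left[OF bounded_bilinear_matrix_vector])
  from solves_on_has_integral[OF this ab S] show ?thesis by simp
qed

text \<open>Here $f(t) = e^{tA}h(t)$, where \<open>h\<close> is an indefinite integral of a locally bounded
  function: it is locally Lipschitz, and differentiable almost everywhere.\<close>

lemma solves_on_of_variation_of_constants:
  fixes A :: "real ^ 'n ^ 'n"
  assumes g: "admissible 0 g"
    and f: "\<And>t. t \<ge> 0 \<Longrightarrow> f t = matrix_exp (t *\<^sub>R A) *v init + integral {0..t} (\<lambda>s. matrix_exp ((t - s) *\<^sub>R A) *v g s)"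
  shows "solves_on {0..} f (\<lambda>t. A *v f t + g t)"
proof -
  define G where "G s = matrix_exp ((- s) *\<^sub>R A) *v g s" for s
  define h where "h t = init + integral {0..t} G" for t
  have m: "{0::real..} \<in> sets lebesgue" by simp
  have G: "admissible 0 G" unfolding G_def
    by (intro admissible_bilinear[OF bounded_bilinear_matrix_vector] g continuous_on_matrix_exp continuous_intros)
  have fh: "f t = matrix_exp (t *\<^sub>R A) *v h t" if "t \<ge> 0" for t
  proof -
    have "matrix_exp (t *\<^sub>R A) *v integral {0..t} G = integral {0..t} (\<lambda>s. matrix_exp (t *\<^sub>R A) *v G s)"
      using integral_linear[OF admissibleD(2)[OF G order_refl] matrix_vector_mul_bounded_linear[of "matrix_exp (t *\<^sub>R A)"], of t]
      by (simp add: o_def)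
    also have "\<dots> = integral {0..t} (\<lambda>s. matrix_exp ((t - s) *\<^sub>R A) *v g s)"
      using matrix_exp_add[of t "- _" A] by (simp add: G_def matrix_vector_mul_assoc)
    finally show ?thesis using f[OF that] by (simp add: h_def matrix_vector_right_distrib)
  qed
  have h: "solves_on {0..} h G"
    unfolding solves_on_iff[OF m]
  proof (intro conjI allI impI)
    fix a b :: real assume ab: "a \<le> b \<and> {a..b} \<subseteq> {0..}"
    then have "a \<ge> 0" by auto
    obtain C where C: "\<And>t. t \<in> {0..b} \<Longrightarrow> norm (G t) \<le> C"
      using admissibleD(1)[OF G order_refl, of b] unfolding bounded_iff by blast
    have le: "norm (h y - h x) \<le> C * \<bar>y - x\<bar>" if "0 \<le> x" "x \<le> y" "y \<le> b" for x y
    proof -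
      have "h y - h x = integral {x..y} G"
        using Henstock_Kurzweil_Integration.integral_combine[OF that(1,2) admissibleD(2)[OF G order_refl]]
        by (simp add: h_def algebra_simps)
      also have "norm \<dots> \<le> C * (y - x)"
      proof -
        have "G integrable_on {x..y}" using that by (intro admissibleD(2)[OF G])
        then have "norm (integral {x..y} G) \<le> integral {x..y} (\<lambda>_. C)"
          using that C by (intro Henstock_Kurzweil_Integration.integral_norm_bound_integral) (simp_all add: integrable_const_ivl)
        then show ?thesis using that by (simp add: mult.commute)
      qed
      finally show ?thesis using that by simp
    qed
    show "abs_cont_on a b h"
    proof (rule lipschitz_imp_abs_cont_on)
      fix x y assume "x \<in> {a..b}" "y \<in> {a..b}"
      then show "norm (h x - h y) \<le> C * \<bar>x - y\<bar>"
        using le[of x y] le[of y x] \<open>a \<ge> 0\<close> by (cases "x \<le> y") (auto simp: norm_minus_commute abs_minus_commute)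
    qed
  next
    have "\<exists>N. negligible N \<and> (\<forall>t\<in>{0..real n} - N. ((\<lambda>t. integral {0..t} G) has_vector_derivative G t) (at t within {0..real n}))" for n
      using indefinite_integral_has_vector_derivative_ae[OF admissibleD(2)[OF G order_refl, of "real n"]] by metis
    then obtain N where N: "\<And>n. negligible (N n)"
       "\<And>n t. t \<in> {0..real n} - N n \<Longrightarrow> ((\<lambda>t. integral {0..t} G) has_vector_derivative G t) (at t within {0..real n})"
      by metis
    have "(h has_vector_derivative G t) (at t within {0..})" if t: "t \<in> {0..} - (\<Union>n. N n)" for t
    proof -
      obtain n where "t < real n" using reals_Archimedean2 by blast
      then have "((\<lambda>t. integral {0..t} G) has_vector_derivative G t) (at t within {0..real n})"
        using N(2)[of t n] t by auto
      moreover have "at t within {0..real n} = at t within {0..}"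
        using \<open>t < real n\<close> by (intro at_within_nhd[of _ "{..<real n}"]) auto
      ultimately show ?thesis unfolding h_def by (auto intro!: derivative_eq_intros)
    qed
    then show "\<exists>N. negligible N \<and> (\<forall>t\<in>{0..} - N. (h has_vector_derivative G t) (at t within {0..}))"
      using N(1) by (intro exI[of _ "\<Union>n. N n"]) (auto intro: negligible_Union_nat)
  qed
  have 1: "solves_on {0..} (\<lambda>t. matrix_exp (t *\<^sub>R A)) (\<lambda>t. A ** matrix_exp (t *\<^sub>R A))"
  proof (rule C1_solves_on[OF _ _ m])
    show "continuous_on {0..} (\<lambda>t. A ** matrix_exp (t *\<^sub>R A))"
    proof (rule bounded_linear.continuous_on[of "\<lambda>M. A ** M"])
      show "bounded_linear (\<lambda>M. A ** M)"
        by (rule linear_conv_bounded_linear[THEN iffD1])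
         (auto simp: linear_iff matrix_matrix_mult_def vec_eq_iff sum.distrib sum_distrib_left algebra_simps)
      show "continuous_on {0..} (\<lambda>t. matrix_exp (t *\<^sub>R A))" by (intro continuous_on_matrix_exp continuous_intros)
    qed
  qed (rule matrix_exp_has_vector_derivative)
  have cancel: "matrix_exp (t *\<^sub>R A) *v G t = g t" for t
    by (simp add: G_def matrix_vector_mul_assoc matrix_exp_inverse del: scaleR_minus_left)
  show ?thesis
    by (rule solves_on_cong[OF solves_on_bilinear[OF bounded_bilinear_matrix_vector 1 h m] _ _ m])
      (auto simp: fh cancel matrix_vector_mul_assoc)
qed

lemma solves_on_scalar_linear:
  fixes y :: "real \<Rightarrow> real"
  assumes y: "solves_on S y (\<lambda>t. a * y t)" and ab: "s \<le> t" "{s..t} \<subseteq> S" and S: "S \<in> sets lebesgue"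
  shows "y t = exp (a * (t - s)) * y s"
proof -
  have 1: "solves_on S (\<lambda>t. exp (- a * t)) (\<lambda>t. - a * exp (- a * t))"
  proof (rule C1_solves_on[OF _ _ S])
    show "((\<lambda>t. exp (- a * t)) has_vector_derivative - a * exp (- a * t)) (at t within S)" for t
      unfolding has_real_derivative_iff_has_vector_derivative[symmetric]
      by (auto intro!: derivative_eq_intros)
  qed (intro continuous_intros)
  have "solves_on S (\<lambda>t. exp (- a * t) * y t) (\<lambda>t. 0)"
    by (rule solves_on_cong[OF solves_on_bilinear[OF bounded_bilinear_mult 1 y S] _ _ S]) auto
  from solves_on_has_integral[OF this ab S] have "exp (- a * t) * y t - exp (- a * s) * y s = 0"
    using has_integral_unique has_integral_0 by blast
  then have "exp (a * t) * (exp (- a * t) * y t) = exp (a * t) * (exp (- a * s) * y s)" by simp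
  then show ?thesis by (simp add: mult_exp_exp flip: mult.assoc, simp add: algebra_simps)
qed

lemma solves_on_continuous:
  assumes "solves_on {a..} f g" shows "continuous_on {a..} f"
proof -
  have c: "continuous_on {a..n} f" for n
  proof (cases "a \<le> n")
    case True
    then have "abs_cont_on a n f" using assms by (simp add: solves_on_def)
    then show ?thesis by (rule abs_cont_on_continuous)
  qed simp
  have "continuous (at t within {a..}) f" if "t \<ge> a" for t
  proof -
    have "continuous (at t within {a..t+1}) f" using c[of "t+1"] that by (simp add: continuous_on_eq_continuous_within)
    moreover have "at t within {a..t+1} = at t within {a..}" by (intro at_within_nhd[of _ "{..<t+1}"]) auto
    ultimately show ?thesis by (simp only:)
  qed
  then show ?thesis by (simp add: continuous_on_eq_continuous_within)
qed

section \<open>Existence of solutions of the closed loop\<close>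

text \<open>The values on the \<open>i\<close>-th cell are prescribed in terms of the values before that cell. In
  the proof, \<open>F i\<close> is correct before the \<open>i\<close>-th grid point.\<close>

lemma causal_recursion:
  fixes H :: "nat \<Rightarrow> (real \<Rightarrow> 'a) \<Rightarrow> real \<Rightarrow> 'a"
  assumes g: "grid \<theta>"
    and causal: "\<And>i f g t. (\<And>s. s < \<theta> i \<Longrightarrow> f s = g s) \<Longrightarrow> H i f t = H i g t"
  obtains f where "\<And>t. t < 0 \<Longrightarrow> f t = init t"
    "\<And>i t. \<theta> i \<le> t \<Longrightarrow> t < \<theta> (Suc i) \<Longrightarrow> f t = H i f t"
proof -
  define F where "F = rec_nat init (\<lambda>i Fi t. if \<theta> i \<le> t \<and> t < \<theta> (Suc i) then H i Fi t else Fi t)"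
  have F0: "F 0 = init" by (simp add: F_def)
  have FS: "F (Suc i) t = (if \<theta> i \<le> t \<and> t < \<theta> (Suc i) then H i (F i) t else F i t)" for i t
    by (simp add: F_def)
  define cell where "cell t = (THE i. \<theta> i \<le> t \<and> t < \<theta> (Suc i))" for t
  have cell: "cell t = i" if "\<theta> i \<le> t" "t < \<theta> (Suc i)" for i t
    unfolding cell_def using that grid_cell_unique[OF g] by blast
  define f where "f t = (if t < 0 then init t else F (Suc (cell t)) t)" for t
  have pos: "t \<ge> 0" if "\<theta> i \<le> t" for i t using grid_nonneg[OF g, of i] that by simp
  have agree: "F i t = f t" if "t < \<theta> i" for i t
    using that
  proof (induction i)
    case 0
    then show ?case using g by (simp add: F0 f_def grid_def)
  next
    case (Suc i)
    show ?case
    proof (cases "\<theta> i \<le> t")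
      case True
      then show ?thesis using cell[OF True Suc.prems] pos[OF True] by (simp add: f_def)
    next
      case False
      then show ?thesis using Suc.IH by (simp add: FS)
    qed
  qed
  show ?thesis
  proof
    show "f t = init t" if "t < 0" for t using that by (simp add: f_def)
    show "f t = H i f t" if "\<theta> i \<le> t" "t < \<theta> (Suc i)" for i t
    proof -
      have "f t = F (Suc i) t" using agree[OF that(2)] by simp
      also have "\<dots> = H i (F i) t" using that by (simp add: FS)
      also have "\<dots> = H i f t" by (rule causal) (rule agree)
      finally show ?thesis .
    qed
  qed
qed

text \<open>If the sampling instants were bounded, then \<open>b\<close> would be bounded on a compact interval that
  contains them, and their distances would be bounded from below.\<close>

lemma grid_sample_time:
  assumes "T1 > 0" and b: "b \<in> L_inf_loc {0..}"
  shows "grid (sample_time T1 b)"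
proof -
  let ?\<theta> = "sample_time T1 b"
  have inc: "?\<theta> i < ?\<theta> (Suc i)" for i using assms(1) by simp
  have nn: "?\<theta> i \<ge> 0" for i by (induction i) (use assms(1) in \<open>auto intro: add_nonneg_nonneg\<close>)
  have "\<exists>i. T < ?\<theta> i" for T
  proof (rule ccontr)
    assume "\<not> (\<exists>i. T < ?\<theta> i)"
    then have le: "?\<theta> i \<le> T" for i by (simp add: not_less)
    have "bounded (b ` {0..T})" using b by (auto simp: L_inf_loc_def)
    then obtain C where C: "\<And>t. t \<in> {0..T} \<Longrightarrow> norm (b t) \<le> C" unfolding bounded_iff by blast
    have low: "real i * (T1 * exp (- C)) \<le> ?\<theta> i" for i
    proof (induction i)
      case (Suc i)
      have "b (?\<theta> i) \<le> C" using C[of "?\<theta> i"] nn le by auto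
      then have "T1 * exp (- C) \<le> T1 * exp (- b (?\<theta> i))" using assms(1) by simp
      with Suc show ?case by (simp add: algebra_simps)
    qed simp
    have "T1 * exp (- C) > 0" using assms(1) by simp
    then obtain n where "T < real n * (T1 * exp (- C))" using ex_less_of_nat_mult by blast
    then show False using low[of n] le[of n] by linarith
  qed
  then show ?thesis using inc by (simp add: grid_def)
qed

lemma grid_multiples: "T > 0 \<Longrightarrow> grid (\<lambda>i. real i * T)"
  using ex_less_of_nat_mult[of T] by (auto simp: grid_def algebra_simps)

lemma sample_step_le:
  assumes "T1 > 0" "\<And>t. t \<ge> 0 \<Longrightarrow> b t \<ge> 0" "grid (sample_time T1 b)"
  shows "sample_time T1 b (Suc i) \<le> sample_time T1 b i + T1"
  using assms grid_nonneg[OF assms(3), of i] by simp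

lemma admissible_input:
  fixes u :: "real \<Rightarrow> real"
  assumes u0: "u0 \<in> L_inf {-L..<0}" and eq: "\<And>s. s \<in> {-L..<0} \<Longrightarrow> u s = u0 s"
    and u: "admissible 0 u" and "L > 0"
  shows "admissible (-L) u"
proof -
  have ends: "f integrable_on {-L..<0} \<longleftrightarrow> f integrable_on {-L..0}" for f :: "real \<Rightarrow> real"
    by (rule integrable_spike_set_eq, rule negligible_subset[of "{0}"]) auto
  have bu0: "bounded (u0 ` {-L..<0})" using u0 by (simp add: L_inf_def)
  then obtain C where C: "\<And>s. s \<in> {-L..<0} \<Longrightarrow> norm (u0 s) \<le> C" unfolding bounded_iff by blast
  have "u0 integrable_on {-L..<0}"
  proof (rule measurable_bounded_by_integrable_imp_integrable[where g="\<lambda>_. C"])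
    show "u0 \<in> borel_measurable (lebesgue_on {-L..<0})" using u0 by (simp add: L_inf_def)
    show "(\<lambda>_. C) integrable_on {-L..<0}"
      unfolding ends by (rule integrable_const_ivl)
  qed (use C in simp_all)
  then have "u integrable_on {-L..<0}" by (rule integrable_eq) (simp add: eq)
  then have i: "u integrable_on {-L..0}" unfolding ends .
  show ?thesis unfolding admissible_def
  proof
    fix b :: real
    define m where "m = max b 0"
    have "{-L..m} = {-L..<0} \<union> {0..m}" using \<open>L > 0\<close> by (auto simp: m_def)
    moreover have "u ` {-L..<0} = u0 ` {-L..<0}" using eq by auto
    ultimately have "bounded (u ` {-L..m})" using bu0 admissibleD(1)[OF u order_refl] by (simp add: image_Un)
    moreover have "u integrable_on {-L..m}"
      using Henstock_Kurzweil_Integration.integrable_combine[OF _ _ i admissibleD(2)[OF u order_refl, of m]] \<open>L > 0\<close>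
      by (simp add: m_def)
    moreover have sub: "{-L..b} \<subseteq> {-L..m}" by (auto simp: m_def)
    ultimately show "bounded (u ` {-L..b}) \<and> u integrable_on {-L..b}"
      using bounded_subset[OF _ image_mono[OF sub], of u] integrable_on_subinterval[OF _ sub, of u] by simp
  qed
qed

lemma integral_cong_except_end:
  assumes "\<And>s. s < t \<Longrightarrow> f s = g s"
  shows "integral {a..t} f = integral {a..t::real} g"
  by (rule integral_spike[of "{t}"]) (auto simp: assms)

text \<open>By variation of constants, \<open>x\<close> is a functional of \<open>u\<close>, and \<open>z\<close> is a functional of
  \<open>u\<close> and $y = c'z - w$. On a sampling interval \<open>y\<close> is an exponential whose initial value is
  determined by the past, so a causal recursion yields \<open>y\<close> for every \<open>u\<close>. The resulting
  \<open>z\<close> depends causally on \<open>u\<close>, and a second causal recursion over the holding periods solves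
  the feedback law for \<open>u\<close>.\<close>

lemma closed_loop_exists:
  fixes A G :: "real ^ 'n ^ 'n" and B c k p :: "real ^ 'n" and r \<tau> :: real
  assumes r: "r \<ge> 0" and \<tau>: "\<tau> \<ge> 0" and L: "r + \<tau> > 0" and T1: "T1 > 0" and T2: "T2 > 0"
    and u0: "u0 \<in> L_inf {- r - \<tau>..<0}" and b: "b \<in> L_inf_loc {0..}" and d: "d \<in> L_inf_loc {0..}"
  shows "\<exists>x u z w. closed_loop_solution A B G c k p r \<tau> T1 T2 x0 u0 z0 w0 \<xi> b d x u z w"
proof -
  define \<theta> where "\<theta> = sample_time T1 b"
  have \<theta>: "grid \<theta>" unfolding \<theta>_def by (rule grid_sample_time[OF T1 b])
  have \<theta>0: "\<theta> 0 = 0" by (simp add: \<theta>_def)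
  have grid2: "grid (\<lambda>i. real i * T2)" by (rule grid_multiples[OF T2])
  define X where "X u t = (if t \<le> 0 then x0 t else matrix_exp (t *\<^sub>R A) *v x0 0 +
     integral {0..t} (\<lambda>s. matrix_exp ((t - s) *\<^sub>R A) *v (u (s - \<tau>) *\<^sub>R B + G *v d s)))" for u t
  define Z where "Z u y t = matrix_exp (t *\<^sub>R A) *v z0 +
     integral {0..t} (\<lambda>s. matrix_exp ((t - s) *\<^sub>R A) *v (u (s - r - \<tau>) *\<^sub>R B + y s *\<^sub>R p))"
    for u :: "real \<Rightarrow> real" and y :: "real \<Rightarrow> real" and t
  define reset where "reset u i = (if i = 0 then w0 else c \<bullet> X u (\<theta> i - r) + \<xi> (\<theta> i))" for u i
  define HY where "HY u i y t = exp ((c \<bullet> p) * (t - \<theta> i)) * (c \<bullet> Z u y (\<theta> i) - reset u i)" for u i y t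
  have Zc: "Z u y t = Z u' y' t" if "\<And>s. s < t \<Longrightarrow> u s = u' s" "\<And>s. s < t \<Longrightarrow> y s = y' s" for u u' y y' t
    unfolding Z_def using r \<tau> by (intro arg_cong2[of _ _ _ _ "(+)"] refl integral_cong_except_end) (simp add: that)
  have Xc: "X u t = X u' t" if "\<And>s. s < t \<Longrightarrow> u s = u' s" for u u' t
  proof -
    have "integral {0..t} (\<lambda>s. matrix_exp ((t - s) *\<^sub>R A) *v (u (s - \<tau>) *\<^sub>R B + G *v d s))
      = integral {0..t} (\<lambda>s. matrix_exp ((t - s) *\<^sub>R A) *v (u' (s - \<tau>) *\<^sub>R B + G *v d s))"
      using \<tau> by (intro integral_cong_except_end) (simp add: that)
    then show ?thesis by (simp add: X_def)
  qed
  have reset_c: "reset u i = reset u' i" if "\<And>s. s < \<theta> i \<Longrightarrow> u s = u' s" for u u' i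
    unfolding reset_def using r by (simp, intro impI arg_cong[of _ _ "(\<bullet>) c"] Xc that) simp
  have "\<exists>y. \<forall>i t. \<theta> i \<le> t \<longrightarrow> t < \<theta> (Suc i) \<longrightarrow> y t = HY u i y t" for u
  proof -
    have c: "HY u i f t = HY u i g t" if "\<And>s. s < \<theta> i \<Longrightarrow> f s = g s" for i f g t
      using Zc[of "\<theta> i" u u f g] that by (simp add: HY_def)
    show ?thesis
    proof (rule causal_recursion[where H="HY u" and init="\<lambda>_. 0", OF \<theta> c])
      fix f assume "\<And>i t. \<theta> i \<le> t \<Longrightarrow> t < \<theta> (Suc i) \<Longrightarrow> f t = HY u i f t"
      then show ?thesis by blast
    qed assumption
  qed
  then obtain Y where Y: "\<And>u i t. \<theta> i \<le> t \<Longrightarrow> t < \<theta> (Suc i) \<Longrightarrow> Y u t = HY u i (Y u) t"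
    by metis
  \<comment> \<open>Causality of \<open>Y\<close>, by induction on the sampling intervals.\<close>
  have Yc: "Y u t = Y u' t" if u: "\<And>s. s < T \<Longrightarrow> u s = u' s" and t: "0 \<le> t" "t < T" for u u' t T
  proof -
    have "\<forall>t. 0 \<le> t \<longrightarrow> t < \<theta> i \<longrightarrow> t < T \<longrightarrow> Y u t = Y u' t" for i
    proof (induction i)
      case 0
      then show ?case by (simp add: \<theta>0)
    next
      case (Suc i)
      show ?case
      proof (intro allI impI)
        fix t assume t: "0 \<le> t" "t < \<theta> (Suc i)" "t < T"
        show "Y u t = Y u' t"
        proof (cases "t < \<theta> i")
          case True
          then show ?thesis using Suc t by blast
        next
          case False
          have "integral {0..\<theta> i} (\<lambda>s. matrix_exp ((\<theta> i - s) *\<^sub>R A) *v (u (s - r - \<tau>) *\<^sub>R B + Y u s *\<^sub>R p))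
            = integral {0..\<theta> i} (\<lambda>s. matrix_exp ((\<theta> i - s) *\<^sub>R A) *v (u' (s - r - \<tau>) *\<^sub>R B + Y u' s *\<^sub>R p))"
            using r \<tau> False t Suc u by (intro integral_spike[of "{\<theta> i}"]) auto
          then have "Z u (Y u) (\<theta> i) = Z u' (Y u') (\<theta> i)" by (simp add: Z_def)
          moreover have "reset u i = reset u' i" using False t u by (intro reset_c) auto
          ultimately show ?thesis using False t Y[of i t u] Y[of i t u'] by (simp add: HY_def)
        qed
      qed
    qed
    moreover obtain i where "t < \<theta> i" using \<theta> by (auto simp: grid_def)
    ultimately show ?thesis using t by blast
  qed
  have ZYc: "Z u (Y u) t = Z u' (Y u') t" if u: "\<And>s. s < t \<Longrightarrow> u s = u' s" for u u' t
  proof -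
    have "integral {0..t} (\<lambda>s. matrix_exp ((t - s) *\<^sub>R A) *v (u (s - r - \<tau>) *\<^sub>R B + Y u s *\<^sub>R p))
      = integral {0..t} (\<lambda>s. matrix_exp ((t - s) *\<^sub>R A) *v (u' (s - r - \<tau>) *\<^sub>R B + Y u' s *\<^sub>R p))"
      using r \<tau> u Yc[OF u] by (intro integral_spike[of "{t}"]) auto
    then show ?thesis by (simp add: Z_def)
  qed
  define HU where "HU i u (t::real) = k \<bullet> (matrix_exp ((r + \<tau>) *\<^sub>R A) *v Z u (Y u) (real i * T2))
            + integral {- r - \<tau>..0} (\<lambda>s. k \<bullet> (matrix_exp ((- s) *\<^sub>R A) *v (u (real i * T2 + s) *\<^sub>R B)))"
    for i u t
  have HUc: "HU i u t = HU i u' t" if "\<And>s. s < real i * T2 \<Longrightarrow> u s = u' s" for i u u' t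
    unfolding HU_def using that
    by (intro arg_cong2[of _ _ _ _ "(+)"] arg_cong[of _ _ "\<lambda>v. k \<bullet> (matrix_exp ((r + \<tau>) *\<^sub>R A) *v v)"]
        ZYc integral_cong_except_end) simp_all
  obtain u where u: "\<And>t. t < 0 \<Longrightarrow> u t = u0 t"
     "\<And>i t. real i * T2 \<le> t \<Longrightarrow> t < real (Suc i) * T2 \<Longrightarrow> u t = HU i u t"
    by (rule causal_recursion[where H=HU and init=u0, OF grid2 HUc]) blast+
  define y where "y = Y u"
  define z where "z = Z u y"
  define w where "w t = c \<bullet> z t - y t" for t
  define x where "x = X u"
  have ua0: "admissible 0 u"
    by (rule admissible_piecewise[OF grid2, where g="\<lambda>i t. HU i u 0"])
      (use u(2) in \<open>auto simp: HU_def\<close>)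
  have uL: "admissible (- (r + \<tau>)) u"
    by (rule admissible_input[OF _ _ ua0 L, of u0]) (use u0 u(1) in simp_all)
  have da: "admissible 0 d" using d by (rule L_inf_loc_admissible)
  have uB: "admissible 0 (\<lambda>s. u (s - h) *\<^sub>R B)" if "h \<le> r + \<tau>" for h
  proof -
    have "admissible (- h) u" using admissible_mono[OF uL] that by simp
    from admissible_shift[OF this, of h] have "admissible 0 (\<lambda>s. u (s - h))" by simp
    then show ?thesis by (rule admissible_linear[OF bounded_linear_scaleR_left])
  qed
  have ydef: "y t = exp ((c \<bullet> p) * (t - \<theta> i)) * (c \<bullet> z (\<theta> i) - reset u i)" if "\<theta> i \<le> t" "t < \<theta> (Suc i)" for i t
    using Y[OF that, of u] by (simp add: y_def z_def HY_def)
  have ya: "admissible 0 y"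
    by (rule admissible_piecewise[OF \<theta>, where g="\<lambda>i t. exp ((c \<bullet> p) * (t - \<theta> i)) * (c \<bullet> z (\<theta> i) - reset u i)"])
      (auto intro!: continuous_intros ydef)
  have m0: "{0::real..} \<in> sets lebesgue" by simp
  have zs: "solves_on {0..} z (\<lambda>t. A *v z t + (u (t - r - \<tau>) *\<^sub>R B + y t *\<^sub>R p))"
  proof (rule solves_on_of_variation_of_constants[where init=z0])
    show "admissible 0 (\<lambda>t. u (t - r - \<tau>) *\<^sub>R B + y t *\<^sub>R p)"
      using uB[of "r + \<tau>"] admissible_linear[OF bounded_linear_scaleR_left ya, of p]
      by (intro admissible_add) (simp_all add: diff_diff_eq)
  qed (simp add: z_def Z_def)
  have xs: "solves_on {0..} x (\<lambda>t. A *v x t + (u (t - \<tau>) *\<^sub>R B + G *v d t))"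
  proof (rule solves_on_of_variation_of_constants[where init="x0 0"])
    show "admissible 0 (\<lambda>t. u (t - \<tau>) *\<^sub>R B + G *v d t)"
      using uB[of \<tau>] r admissible_linear[OF matrix_vector_mul_bounded_linear da, of G]
      by (intro admissible_add) simp_all
  qed (simp add: x_def X_def)
  have "plant A B G \<tau> d x u"
    unfolding plant_def by (rule solves_on_cong[OF xs _ _ m0]) (simp_all add: add.assoc)
  moreover have "observer A B c p r \<tau> T1 \<xi> b x u z w"
    unfolding observer_def \<theta>_def[symmetric]
  proof (intro conjI allI)
    show "solves_on {0..} z (\<lambda>t. A *v z t + u (t - r - \<tau>) *\<^sub>R B + (c \<bullet> z t - w t) *\<^sub>R p)"
      by (rule solves_on_cong[OF zs _ _ m0]) (simp_all add: add.assoc w_def)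
  next
    fix i
    let ?S = "{\<theta> i..<\<theta> (Suc i)}"
    have mS: "?S \<in> sets lebesgue" by simp
    have sub: "?S \<subseteq> {0..}" using grid_nonneg[OF \<theta>, of i] by auto
    define yi where "yi = c \<bullet> z (\<theta> i) - reset u i"
    have "solves_on ?S (\<lambda>t. exp ((c \<bullet> p) * (t - \<theta> i)) * yi) (\<lambda>t. (c \<bullet> p) * (exp ((c \<bullet> p) * (t - \<theta> i)) * yi))"
    proof (rule C1_solves_on[OF _ _ mS])
      show "((\<lambda>t. exp ((c \<bullet> p) * (t - \<theta> i)) * yi) has_vector_derivative (c \<bullet> p) * (exp ((c \<bullet> p) * (t - \<theta> i)) * yi)) (at t within ?S)" for t
        unfolding has_real_derivative_iff_has_vector_derivative[symmetric]
        by (auto intro!: derivative_eq_intros)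
    qed (intro continuous_intros)
    then have 1: "solves_on ?S y (\<lambda>t. (c \<bullet> p) * y t)"
      by (rule solves_on_cong[OF _ _ _ mS]) (auto simp: ydef yi_def)
    have 2: "solves_on ?S (\<lambda>t. c \<bullet> z t) (\<lambda>t. c \<bullet> (A *v z t + (u (t - r - \<tau>) *\<^sub>R B + y t *\<^sub>R p)))"
      by (rule solves_on_linear[OF bounded_linear_inner_right solves_on_subset[OF zs sub m0 mS] mS])
    show "solves_on ?S w (\<lambda>t. c \<bullet> (A *v z t) + (c \<bullet> B) * u (t - r - \<tau>))"
      by (rule solves_on_cong[OF solves_on_add[OF 2 solves_on_linear[OF bounded_linear_minus[OF bounded_linear_ident] 1 mS] mS] _ _ mS])
        (auto simp: w_def inner_add_right mult_ac)
  next
    fix i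
    have "y (\<theta> (Suc i)) = c \<bullet> z (\<theta> (Suc i)) - (c \<bullet> x (\<theta> (Suc i) - r) + \<xi> (\<theta> (Suc i)))"
      using ydef[of "Suc i" "\<theta> (Suc i)"] \<theta> by (simp add: grid_def reset_def x_def)
    then show "w (\<theta> (Suc i)) = c \<bullet> x (\<theta> (Suc i) - r) + \<xi> (\<theta> (Suc i))" by (simp add: w_def)
  qed
  moreover have "feedback A B k r \<tau> T2 u z"
    unfolding feedback_def using u(2) by (auto simp: HU_def z_def y_def algebra_simps)
  moreover have z0: "z 0 = z0" by (simp add: z_def Z_def)
  moreover have "w 0 = w0"
  proof -
    have "0 < \<theta> (Suc 0)" using \<theta> \<theta>0 unfolding grid_def by metis
    then show ?thesis using ydef[of 0 0] z0 by (simp add: w_def \<theta>0 reset_def)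
  qed
  moreover have "hist 0 x s = x0 s" if "s \<in> {-r..0}" for s using that by (simp add: hist_def x_def X_def)
  moreover have "hist 0 u s = u0 s" if "s \<in> {- r - \<tau>..<0}" for s using that u(1) by (simp add: hist_def)
  ultimately show ?thesis unfolding closed_loop_solution_def by blast
qed

section \<open>Exponentially weighted estimates\<close>

text \<open>A convenient upper bound of the operator norm.\<close>

definition mnorm :: "real ^ 'n ^ 'm \<Rightarrow> real" where
  "mnorm M = (\<Sum>j\<in>UNIV. \<Sum>k\<in>UNIV. \<bar>M $ j $ k\<bar>)"

lemma mnorm_nonneg [simp]: "mnorm M \<ge> 0"
  unfolding mnorm_def by (intro sum_nonneg) auto

lemma norm_mult_mnorm: "norm (M *v v) \<le> mnorm M * norm v"
  unfolding mnorm_def by (rule norm_matrix_vector_le)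

lemma outer_mult: "outer v w *v x = (w \<bullet> x) *\<^sub>R (v :: real ^ 'n)"
proof -
  have "(outer v w *v x) $ i = (\<Sum>j\<in>UNIV. v $ i * w $ j * x $ j)" for i
    by (simp add: outer_def matrix_vector_mult_def matrix_matrix_mult_def columnvector_def rowvector_def)
  then show ?thesis
    by (simp add: vec_eq_iff inner_vec_def sum_distrib_left mult_ac)
qed

text \<open>The right end point is left out because a delayed input can leave its initial history there.\<close>

lemma has_integral_norm_le:
  fixes g :: "real \<Rightarrow> 'a::euclidean_space"
  assumes g: "(g has_integral I) {a..b}" and B: "(B has_integral J) {a..b}"
    and le: "\<And>s. a \<le> s \<Longrightarrow> s < b \<Longrightarrow> norm (g s) \<le> B s"
  shows "norm I \<le> J"
proof -
  define g' where "g' s = (if s = b then 0 else g s)" for s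
  define B' where "B' s = (if s = b then 0 else B s)" for s
  have g': "(g' has_integral I) {a..b}"
    by (rule has_integral_spike[OF negligible_sing[of b] _ g]) (simp add: g'_def)
  have B': "(B' has_integral J) {a..b}"
    by (rule has_integral_spike[OF negligible_sing[of b] _ B]) (simp add: B'_def)
  have "norm (integral {a..b} g') \<le> integral {a..b} B'"
    using g' B' le
    by (intro Henstock_Kurzweil_Integration.integral_norm_bound_integral has_integral_integrable)
      (auto simp: g'_def B'_def)
  then show ?thesis using g' B' by (simp add: integral_unique)
qed

lemma has_integral_norm_le_const:
  fixes g :: "real \<Rightarrow> 'a::euclidean_space"
  assumes g: "(g has_integral I) {a..b}" and "a \<le> b"
    and le: "\<And>s. a \<le> s \<Longrightarrow> s < b \<Longrightarrow> norm (g s) \<le> C"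
  shows "norm I \<le> C * (b - a)"
proof -
  have "((\<lambda>_. C) has_integral (C * (b - a))) {a..b}"
    using has_integral_const_real[of C a b] assms(2) by (simp add: mult.commute)
  from has_integral_norm_le[OF g this le] show ?thesis by simp
qed

lemma has_integral_exp:
  fixes \<rho> :: real
  assumes "\<rho> \<noteq> 0" "a \<le> b"
  shows "((\<lambda>s. exp (\<rho> * s)) has_integral (exp (\<rho> * b) - exp (\<rho> * a)) / \<rho>) {a..b}"
proof -
  have "((\<lambda>s. exp (\<rho> * s)) has_integral exp (\<rho> * b) / \<rho> - exp (\<rho> * a) / \<rho>) {a..b}"
    using assms
    by (intro fundamental_theorem_of_calculus)
      (auto intro!: derivative_eq_intros simp flip: has_real_derivative_iff_has_vector_derivative)
  then show ?thesis by (simp add: diff_divide_distrib)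
qed

text \<open>A time shift of at most \<open>h\<close> costs the factor \<open>exp h\<close>, uniformly in \<open>\<sigma>\<close>.\<close>

lemma exp_shift:
  fixes \<sigma> :: real
  assumes "0 < \<sigma>" "\<sigma> \<le> 1" "0 \<le> h" "t - h \<le> s"
  shows "exp (- \<sigma> * s) \<le> exp h * exp (- \<sigma> * t)"
proof -
  have "\<sigma> * (t - s) \<le> \<sigma> * h" using assms by (intro mult_left_mono) auto
  also have "\<dots> \<le> h" using mult_right_mono[of \<sigma> 1 h] assms by simp
  finally show ?thesis unfolding exp_add[symmetric] exp_le_cancel_iff by (simp add: algebra_simps)
qed

text \<open>The maximum $N$ of $\phi(s)e^{-\rho s}$, if it is positive, satisfies $N \le C + N/2$.\<close>

lemma small_gain:
  fixes \<phi> :: "real \<Rightarrow> real"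
  assumes cont: "continuous_on {a..T} \<phi>" and "0 \<le> C"
    and step: "\<And>N t. N \<ge> 0 \<Longrightarrow> (\<And>s. s \<in> {a..T} \<Longrightarrow> \<phi> s \<le> N * exp (\<rho> * s)) \<Longrightarrow> t \<in> {a..T} \<Longrightarrow>
       \<phi> t \<le> (C + N / 2) * exp (\<rho> * t)"
    and t: "t \<in> {a..T}"
  shows "\<phi> t \<le> 2 * C * exp (\<rho> * t)"
proof -
  let ?f = "\<lambda>s. \<phi> s * exp (- (\<rho> * s))"
  have "continuous_on {a..T} ?f" by (intro continuous_intros cont)
  then obtain m where m: "m \<in> {a..T}" "\<And>s. s \<in> {a..T} \<Longrightarrow> ?f s \<le> ?f m"
    using continuous_attains_sup[of "{a..T}" ?f] t by auto
  have conv: "\<phi> s = ?f s * exp (\<rho> * s)" for s by (simp add: mult_exp_exp mult.assoc)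
  define N where "N = max (?f m) 0"
  have le: "\<phi> s \<le> N * exp (\<rho> * s)" if "s \<in> {a..T}" for s
    by (subst conv) (use m(2)[OF that] in \<open>intro mult_right_mono, auto simp: N_def\<close>)
  have "?f m \<le> C + N / 2"
  proof -
    have "?f m \<le> (C + N / 2) * exp (\<rho> * m) * exp (- (\<rho> * m))"
      using step[OF _ le m(1)] by (intro mult_right_mono) (auto simp: N_def)
    then show ?thesis by (simp add: mult_exp_exp mult.assoc)
  qed
  then have "N \<le> 2 * C" using \<open>0 \<le> C\<close> unfolding N_def by (cases "?f m \<le> 0") auto
  then have "N * exp (\<rho> * t) \<le> 2 * C * exp (\<rho> * t)" by (intro mult_right_mono) auto
  then show ?thesis using le[OF t] by linarith
qed

text \<open>By \<open>2 * \<sigma> \<le> \<mu>\<close>, the convolution of the kernel $e^{-\mu t}$ with $e^{-\sigma t}$ is at most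
  $(2/\mu)e^{-\sigma t}$.\<close>

lemma decay_iss:
  fixes H :: "real ^ 'n ^ 'n"
  assumes K: "0 < K" and \<sigma>: "0 < \<sigma>" "2 * \<sigma> \<le> \<mu>"
    and decay: "\<And>t v. t \<ge> 0 \<Longrightarrow> norm (matrix_exp (t *\<^sub>R H) *v v) \<le> K * exp (- \<mu> * t) * norm v"
    and f: "solves_on {a..} f (\<lambda>t. H *v f t + g t)" and "a \<le> t" and "0 \<le> \<gamma>"
    and g: "\<And>s. s \<in> {a..t} \<Longrightarrow> norm (g s) \<le> \<gamma> * exp (- \<sigma> * s)"
  shows "norm (f t) \<le> (K * exp (\<sigma> * a) * norm (f a) + 2 * K / \<mu> * \<gamma>) * exp (- \<sigma> * t)"
proof -
  define I where "I = f t - matrix_exp ((t - a) *\<^sub>R H) *v f a"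
  have I: "((\<lambda>s. matrix_exp ((t - s) *\<^sub>R H) *v g s) has_integral I) {a..t}"
    unfolding I_def using \<open>a \<le> t\<close> by (intro variation_of_constants[OF f]) auto
  have \<mu>: "\<mu> - \<sigma> > 0" "\<mu> > 0" using \<sigma> by auto
  have J: "((\<lambda>s. K * \<gamma> * exp (- \<mu> * t) * exp ((\<mu> - \<sigma>) * s)) has_integral
       K * \<gamma> * exp (- \<mu> * t) * ((exp ((\<mu> - \<sigma>) * t) - exp ((\<mu> - \<sigma>) * a)) / (\<mu> - \<sigma>))) {a..t}"
    using \<mu> \<open>a \<le> t\<close> by (intro has_integral_mult_right has_integral_exp) auto
  have "norm I \<le> K * \<gamma> * exp (- \<mu> * t) * ((exp ((\<mu> - \<sigma>) * t) - exp ((\<mu> - \<sigma>) * a)) / (\<mu> - \<sigma>))"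
  proof (rule has_integral_norm_le[OF I J])
    fix s assume s: "a \<le> s" "s < t"
    have "norm (matrix_exp ((t - s) *\<^sub>R H) *v g s) \<le> K * exp (- \<mu> * (t - s)) * norm (g s)"
      using s by (intro decay) auto
    also have "\<dots> \<le> K * exp (- \<mu> * (t - s)) * (\<gamma> * exp (- \<sigma> * s))"
      using g[of s] s K by (intro mult_left_mono) auto
    also have "\<dots> = K * \<gamma> * exp (- \<mu> * t) * exp ((\<mu> - \<sigma>) * s)"
      by (simp add: exp_add[symmetric] algebra_simps exp_diff exp_minus divide_simps)
    finally show "norm (matrix_exp ((t - s) *\<^sub>R H) *v g s) \<le> K * \<gamma> * exp (- \<mu> * t) * exp ((\<mu> - \<sigma>) * s)" .
  qed
  also have "\<dots> \<le> K * \<gamma> * exp (- \<mu> * t) * (exp ((\<mu> - \<sigma>) * t) * (2 / \<mu>))"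
  proof (rule mult_left_mono)
    have "(exp ((\<mu> - \<sigma>) * t) - exp ((\<mu> - \<sigma>) * a)) / (\<mu> - \<sigma>) \<le> exp ((\<mu> - \<sigma>) * t) / (\<mu> - \<sigma>)"
      using \<mu> by (intro divide_right_mono) auto
    also have "\<dots> \<le> exp ((\<mu> - \<sigma>) * t) / (\<mu> / 2)"
      using \<mu> \<sigma> by (intro divide_left_mono) auto
    finally show "(exp ((\<mu> - \<sigma>) * t) - exp ((\<mu> - \<sigma>) * a)) / (\<mu> - \<sigma>) \<le> exp ((\<mu> - \<sigma>) * t) * (2 / \<mu>)" by simp
  qed (use K \<open>0 \<le> \<gamma>\<close> in auto)
  also have "\<dots> = 2 * K / \<mu> * \<gamma> * (exp (- \<mu> * t) * exp ((\<mu> - \<sigma>) * t))" by simp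
  also have "exp (- \<mu> * t) * exp ((\<mu> - \<sigma>) * t) = exp (- \<sigma> * t)" by (simp add: exp_add[symmetric] algebra_simps)
  finally have 1: "norm I \<le> 2 * K / \<mu> * \<gamma> * exp (- \<sigma> * t)" .
  have "norm (matrix_exp ((t - a) *\<^sub>R H) *v f a) \<le> K * exp (- \<mu> * (t - a)) * norm (f a)"
    using \<open>a \<le> t\<close> by (intro decay) auto
  also have "\<dots> \<le> K * exp (- \<sigma> * (t - a)) * norm (f a)"
    using K \<sigma> \<open>a \<le> t\<close> by (intro mult_right_mono mult_left_mono) (auto intro!: mult_right_mono)
  also have "exp (- \<sigma> * (t - a)) = exp (\<sigma> * a) * exp (- \<sigma> * t)" by (simp add: exp_add[symmetric] algebra_simps)
  finally have 2: "norm (matrix_exp ((t - a) *\<^sub>R H) *v f a) \<le> K * (exp (\<sigma> * a) * exp (- \<sigma> * t)) * norm (f a)" .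
  have "norm (f t) \<le> norm I + norm (matrix_exp ((t - a) *\<^sub>R H) *v f a)"
    unfolding I_def using norm_triangle_ineq[of "f t - matrix_exp ((t - a) *\<^sub>R H) *v f a" "matrix_exp ((t - a) *\<^sub>R H) *v f a"] by simp
  then show ?thesis using 1 2 by (simp add: algebra_simps)
qed

section \<open>The initial phase\<close>

text \<open>A solution of the closed loop. Periods of at most 1 keep the factors $e^{\sigma T_1}$ and
  $e^{\sigma T_2}$ at most $e$.\<close>

locale closed_loop =
  fixes A G :: "real ^ 'n ^ 'n" and B c k p :: "real ^ 'n" and r \<tau> T1 T2 :: real
    and u0 \<xi> b :: "real \<Rightarrow> real" and d x :: "real \<Rightarrow> real ^ 'n" and u :: "real \<Rightarrow> real"
    and z :: "real \<Rightarrow> real ^ 'n" and w :: "real \<Rightarrow> real"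
  assumes r: "r \<ge> 0" and \<tau>: "\<tau> \<ge> 0" and L: "r + \<tau> > 0"
    and T1: "0 < T1" "T1 \<le> 1" and T2: "0 < T2" "T2 \<le> 1"
    and u0: "u0 \<in> L_inf {- r - \<tau>..<0}" and uu0: "\<And>s. s \<in> {- r - \<tau>..<0} \<Longrightarrow> u s = u0 s"
    and b: "b \<in> L_inf_loc {0..}" "\<And>t. t \<ge> 0 \<Longrightarrow> b t \<ge> 0"
    and plant: "plant A B G \<tau> d x u" and observer: "observer A B c p r \<tau> T1 \<xi> b x u z w"
    and feedback: "feedback A B k r \<tau> T2 u z"
begin

abbreviation \<theta> :: "nat \<Rightarrow> real" where "\<theta> \<equiv> sample_time T1 b"

text \<open>The injection term of the observer.\<close>

definition y :: "real \<Rightarrow> real" where "y t = c \<bullet> z t - w t"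

lemma grid_\<theta>: "grid \<theta>" by (rule grid_sample_time[OF T1(1) b(1)])

lemma \<theta>_step: "\<theta> (Suc i) \<le> \<theta> i + T1" by (rule sample_step_le[OF T1(1) b(2) grid_\<theta>])

lemma \<theta>_nonneg: "\<theta> i \<ge> 0" by (rule grid_nonneg[OF grid_\<theta>])

lemma half_line [simp]: "{a::real..} \<in> sets lebesgue" by simp

lemma z_solves: "solves_on {0..} z (\<lambda>t. A *v z t + (u (t - r - \<tau>) *\<^sub>R B + y t *\<^sub>R p))"
proof -
  have "solves_on {0..} z (\<lambda>t. A *v z t + u (t - r - \<tau>) *\<^sub>R B + (c \<bullet> z t - w t) *\<^sub>R p)"
    using observer by (simp add: observer_def)
  then show ?thesis by (rule solves_on_cong[OF _ refl _ half_line]) (simp add: y_def add.assoc)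
qed

lemma x_solves: "solves_on {0..} x (\<lambda>t. A *v x t + (u (t - \<tau>) *\<^sub>R B + G *v d t))"
proof -
  have "solves_on {0..} x (\<lambda>t. A *v x t + u (t - \<tau>) *\<^sub>R B + G *v d t)"
    using plant by (simp add: plant_def)
  then show ?thesis by (rule solves_on_cong[OF _ refl _ half_line]) (simp add: add.assoc)
qed

lemma w_solves: "solves_on {\<theta> i..<\<theta> (Suc i)} w (\<lambda>t. c \<bullet> (A *v z t) + (c \<bullet> B) * u (t - r - \<tau>))"
  using observer unfolding observer_def by blast

lemma w_reset: "w (\<theta> (Suc i)) = c \<bullet> x (\<theta> (Suc i) - r) + \<xi> (\<theta> (Suc i))"
  using observer unfolding observer_def by blast

text \<open>The derivatives of $c'z$ and $w$ differ by $(c'p)y$.\<close>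

lemma y_cell:
  assumes "\<theta> i \<le> t" "t < \<theta> (Suc i)"
  shows "y t = exp ((c \<bullet> p) * (t - \<theta> i)) * y (\<theta> i)"
proof -
  let ?S = "{\<theta> i..<\<theta> (Suc i)}"
  have mS: "?S \<in> sets lebesgue" by simp
  have sub: "?S \<subseteq> {0..}" using \<theta>_nonneg[of i] by auto
  have 2: "solves_on ?S (\<lambda>t. c \<bullet> z t) (\<lambda>t. c \<bullet> (A *v z t + (u (t - r - \<tau>) *\<^sub>R B + y t *\<^sub>R p)))"
    by (rule solves_on_linear[OF bounded_linear_inner_right solves_on_subset[OF z_solves sub half_line mS] mS])
  have "solves_on ?S y (\<lambda>t. (c \<bullet> p) * y t)"
    by (rule solves_on_cong[OF solves_on_add[OF 2 solves_on_linear[OF bounded_linear_minus[OF bounded_linear_ident] w_solves mS] mS] _ _ mS])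
      (auto simp: y_def inner_add_right mult_ac)
  then show ?thesis using assms by (intro solves_on_scalar_linear[OF _ _ _ mS]) auto
qed

lemma y_admissible: "admissible 0 y"
  by (rule admissible_piecewise[OF grid_\<theta>, where g="\<lambda>i t. exp ((c \<bullet> p) * (t - \<theta> i)) * y (\<theta> i)"])
    (auto intro!: continuous_intros y_cell simp del: sample_time.simps)

lemma u_admissible: "admissible (- r - \<tau>) u"
proof -
  have "admissible 0 u"
  proof (rule admissible_piecewise[OF grid_multiples[OF T2(1)]])
    fix i t assume t: "real i * T2 \<le> t" "t < real (Suc i) * T2"
    have c: "s \<in> {real i * T2..<(real i + 1) * T2}" if "s = t \<or> s = real i * T2" for s
      using t that T2 by (auto simp: algebra_simps)
    show "u t = u (real i * T2)"
      by (rule trans[OF feedback[unfolded feedback_def, rule_format, OF c] sym[OF feedback[unfolded feedback_def, rule_format, OF c]]]) simp_all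
  qed simp
  then have "admissible (- (r + \<tau>)) u"
    using admissible_input[of u0 "r + \<tau>" u] u0 uu0 L by simp
  then show ?thesis by simp
qed

lemma norm_y_le:
  assumes "\<theta> i \<le> t" "t < \<theta> (Suc i)"
  shows "\<bar>y t\<bar> \<le> exp \<bar>c \<bullet> p\<bar> * \<bar>y (\<theta> i)\<bar>"
proof -
  have "(c \<bullet> p) * (t - \<theta> i) \<le> \<bar>c \<bullet> p\<bar> * 1"
    using assms \<theta>_step[of i] T1 by (intro mult_mono) (simp_all del: sample_time.simps)
  then have "exp ((c \<bullet> p) * (t - \<theta> i)) \<le> exp \<bar>c \<bullet> p\<bar>" by simp
  then show ?thesis unfolding y_cell[OF assms] abs_mult by (intro mult_right_mono) auto
qed

end

text \<open>One number \<open>D\<close> bounds the initial data and the weighted perturbations. All estimates are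
  multiples of \<open>D\<close>, with factors that are defined from the system and the gains alone, so
  that they are the same for all solutions.\<close>

locale closed_loop_data = closed_loop A G B c k p r \<tau> T1 T2 u0 \<xi> b d x u z w
  for A G :: "real ^ 'n ^ 'n" and B c k p r \<tau> T1 T2 u0 \<xi> b d x u z w +
  fixes T D \<sigma> :: real
  assumes T: "0 \<le> T" and D: "0 \<le> D" and \<sigma>: "0 < \<sigma>" "\<sigma> \<le> 1"
    and z_init: "norm (z 0) \<le> D" and w_init: "\<bar>w 0\<bar> \<le> D"
    and x_init: "\<And>s. s \<in> {- r..0} \<Longrightarrow> norm (x s) \<le> D"
    and u_init: "\<And>s. s \<in> {- r - \<tau>..<0} \<Longrightarrow> \<bar>u s\<bar> \<le> D"
    and \<xi>_le: "\<And>s. s \<in> {0..T} \<Longrightarrow> \<bar>\<xi> s\<bar> \<le> D * exp (- \<sigma> * s)"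
    and d_le: "\<And>s. s \<in> {0..T} \<Longrightarrow> norm (d s) \<le> D * exp (- \<sigma> * s)"
begin

text \<open>The measurements that are available up to the time \<open>r\<close> belong to the initial history
  of \<open>x\<close>, which is bounded by \<open>D\<close>.\<close>

lemma y_init_phase:
  assumes t: "t \<in> {0..T}" "t \<le> r"
  obtains s where "s \<in> {0..t}" "\<bar>y t\<bar> \<le> exp \<bar>c \<bullet> p\<bar> * (norm c * norm (z s) + (2 + norm c) * D)"
proof -
  obtain i where i: "\<theta> i \<le> t" "t < \<theta> (Suc i)" using grid_cell[OF grid_\<theta>, of t] t by auto
  have w: "\<bar>w (\<theta> i)\<bar> \<le> (2 + norm c) * D"
  proof (cases i)
    case 0
    have "1 * D \<le> (2 + norm c) * D" using D by (intro mult_right_mono) auto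
    then show ?thesis using 0 w_init by simp
  next
    case (Suc j)
    have "\<theta> (Suc j) - r \<in> {- r..0}" using i(1) t(2) \<theta>_nonneg[of "Suc j"] Suc by (auto simp del: sample_time.simps)
    then have "norm c * norm (x (\<theta> (Suc j) - r)) \<le> norm c * D" using x_init by (intro mult_left_mono) auto
    then have 1: "\<bar>c \<bullet> x (\<theta> (Suc j) - r)\<bar> \<le> norm c * D" using Cauchy_Schwarz_ineq2 order_trans by blast
    have "\<theta> (Suc j) \<in> {0..T}" using i(1) t \<theta>_nonneg[of "Suc j"] Suc by (auto simp del: sample_time.simps)
    then have "\<bar>\<xi> (\<theta> (Suc j))\<bar> \<le> D * exp (- \<sigma> * \<theta> (Suc j))" by (rule \<xi>_le)
    also have "\<dots> \<le> D * 1" using D \<sigma> \<theta>_nonneg[of "Suc j"]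
      by (intro mult_left_mono) (simp_all del: sample_time.simps)
    finally have 2: "\<bar>\<xi> (\<theta> (Suc j))\<bar> \<le> D" by simp
    have "\<bar>w (\<theta> i)\<bar> \<le> norm c * D + D" unfolding Suc w_reset using 1 2 by linarith
    also have "\<dots> \<le> (2 + norm c) * D" using D by (simp add: algebra_simps)
    finally show ?thesis .
  qed
  have "\<bar>y (\<theta> i)\<bar> \<le> norm c * norm (z (\<theta> i)) + (2 + norm c) * D"
    unfolding y_def using w Cauchy_Schwarz_ineq2[of c "z (\<theta> i)"] by linarith
  then have "exp \<bar>c \<bullet> p\<bar> * \<bar>y (\<theta> i)\<bar> \<le> exp \<bar>c \<bullet> p\<bar> * (norm c * norm (z (\<theta> i)) + (2 + norm c) * D)"
    by (intro mult_left_mono) auto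
  then have "\<bar>y t\<bar> \<le> exp \<bar>c \<bullet> p\<bar> * (norm c * norm (z (\<theta> i)) + (2 + norm c) * D)"
    using norm_y_le[OF i] by linarith
  moreover have "\<theta> i \<in> {0..t}" using i \<theta>_nonneg by simp
  ultimately show ?thesis using that by blast
qed

lemma u_delayed_init:
  assumes "s \<in> {0..<r}" shows "\<bar>u (s - r - \<tau>)\<bar> \<le> D"
  using assms \<tau> by (intro u_init) auto

text \<open>The factor that \<open>z_init_phase\<close> yields at the time \<open>r\<close>.\<close>

definition Cz0 :: real where
  "Cz0 = 2 * (1 + norm B + norm p * exp \<bar>c \<bullet> p\<bar> * (2 + norm c)) *
     exp (2 * (mnorm A + norm p * exp \<bar>c \<bullet> p\<bar> * norm c + 1) * r)"

text \<open>The right-hand side of the equation of \<open>z\<close> is bounded by \<open>\<alpha>\<close> times the maximum of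
  \<open>z\<close> so far plus \<open>\<beta>\<close>. With the growing weight \<open>exp (lam * t)\<close>, integration
  gains the factor \<open>1 / lam\<close>, and \<open>\<alpha> / lam\<close> is at most 1/2.\<close>

lemma z_init_phase:
  assumes t: "t \<in> {0..T}" "t \<le> r"
  shows "norm (z t) \<le> Cz0 * D"
proof -
  define E where "E = exp \<bar>c \<bullet> p\<bar>"
  define \<alpha> where "\<alpha> = mnorm A + norm p * E * norm c"
  define lam where "lam = 2 * (\<alpha> + 1)"
  define \<beta> where "\<beta> = (norm B + norm p * E * (2 + norm c)) * D"
  have E: "E > 0" by (simp add: E_def)
  have \<alpha>: "\<alpha> \<ge> 0" unfolding \<alpha>_def using E by auto
  have lam: "lam > 0" "lam \<ge> 1" "2 * \<alpha> \<le> lam" unfolding lam_def using \<alpha> by auto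
  have \<beta>: "\<beta> \<ge> 0" unfolding \<beta>_def using E D by auto
  have "norm (z t) \<le> 2 * (D + \<beta>) * exp (lam * t)"
  proof (rule small_gain[where a=0 and T=t])
    show "continuous_on {0..t} (\<lambda>t. norm (z t))"
      using solves_on_continuous[OF z_solves] by (intro continuous_intros) (auto intro: continuous_on_subset)
    show "0 \<le> D + \<beta>" using D \<beta> by simp
    show "t \<in> {0..t}" using t by simp
    fix N t' assume N: "N \<ge> 0" "\<And>s. s \<in> {0..t} \<Longrightarrow> norm (z s) \<le> N * exp (lam * s)" and t': "t' \<in> {0..t}"
    have I: "((\<lambda>t. A *v z t + (u (t - r - \<tau>) *\<^sub>R B + y t *\<^sub>R p)) has_integral z t' - z 0) {0..t'}"
      using t' by (intro solves_on_has_integral[OF z_solves]) auto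
    have J: "((\<lambda>s. (\<alpha> * N + \<beta>) * exp (lam * s)) has_integral
        (\<alpha> * N + \<beta>) * ((exp (lam * t') - exp (lam * 0)) / lam)) {0..t'}"
      using t' lam by (intro has_integral_mult_right has_integral_exp) auto
    have "norm (z t' - z 0) \<le> (\<alpha> * N + \<beta>) * ((exp (lam * t') - exp (lam * 0)) / lam)"
    proof (rule has_integral_norm_le[OF I J])
      fix s assume s: "0 \<le> s" "s < t'"
      have zs: "norm (z s) \<le> N * exp (lam * s)" using N(2)[of s] s t' by simp
      have e1: "exp (lam * s) \<ge> 1" using lam s by simp
      have 1: "norm (A *v z s) \<le> mnorm A * (N * exp (lam * s))"
        using norm_mult_mnorm[of A "z s"] mult_left_mono[OF zs mnorm_nonneg[of A]] by linarith
      have 2: "norm (u (s - r - \<tau>) *\<^sub>R B) \<le> norm B * D"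
        using mult_right_mono[OF u_delayed_init[of s], of "norm B"] s t' t by (simp add: mult.commute)
      obtain q where q: "q \<in> {0..s}" "\<bar>y s\<bar> \<le> E * (norm c * norm (z q) + (2 + norm c) * D)"
        unfolding E_def using y_init_phase[of s] s t' t by auto
      have "norm (z q) \<le> N * exp (lam * q)" using N(2)[of q] q s t' by simp
      also have "\<dots> \<le> N * exp (lam * s)" using q(1) lam N(1) by (intro mult_left_mono) auto
      finally have "E * (norm c * norm (z q) + (2 + norm c) * D) \<le> E * (norm c * (N * exp (lam * s)) + (2 + norm c) * D)"
        using E by (intro mult_left_mono add_right_mono) auto
      then have "\<bar>y s\<bar> \<le> E * (norm c * (N * exp (lam * s)) + (2 + norm c) * D)" using q(2) by linarith
      then have "\<bar>y s\<bar> * norm p \<le> (E * (norm c * (N * exp (lam * s)) + (2 + norm c) * D)) * norm p"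
        by (rule mult_right_mono) simp
      then have 3: "norm (y s *\<^sub>R p) \<le> norm p * (E * (norm c * (N * exp (lam * s)) + (2 + norm c) * D))"
        unfolding norm_scaleR by (simp only: mult.commute[of _ "norm p"])
      have "norm (A *v z s + (u (s - r - \<tau>) *\<^sub>R B + y s *\<^sub>R p)) \<le>
         mnorm A * (N * exp (lam * s)) + (norm B * D + norm p * (E * (norm c * (N * exp (lam * s)) + (2 + norm c) * D)))"
        by (intro norm_triangle_mono 1 2 3)
      also have "\<dots> = \<alpha> * N * exp (lam * s) + \<beta>" by (simp add: \<alpha>_def \<beta>_def algebra_simps)
      also have "\<dots> \<le> (\<alpha> * N + \<beta>) * exp (lam * s)"
        using mult_left_mono[OF e1 \<beta>] by (simp add: algebra_simps)
      finally show "norm (A *v z s + (u (s - r - \<tau>) *\<^sub>R B + y s *\<^sub>R p)) \<le> (\<alpha> * N + \<beta>) * exp (lam * s)" .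
    qed
    also have "\<dots> \<le> (\<alpha> * N + \<beta>) * (exp (lam * t') / lam)"
      using \<alpha> \<beta> N(1) lam by (intro mult_left_mono divide_right_mono) auto
    also have "\<dots> = (\<alpha> / lam * N + \<beta> / lam) * exp (lam * t')"
      by (simp add: algebra_simps add_divide_distrib)
    also have "\<dots> \<le> (1 / 2 * N + \<beta>) * exp (lam * t')"
    proof (intro mult_right_mono add_mono)
      show "\<alpha> / lam \<le> 1 / 2" using lam by (simp add: field_simps)
      show "\<beta> / lam \<le> \<beta>" using lam \<beta> by (simp add: divide_le_eq mult_le_cancel_left1)
    qed (use N in auto)
    finally have "norm (z t' - z 0) \<le> (N / 2 + \<beta>) * exp (lam * t')" by simp
    moreover have "norm (z 0) \<le> D * exp (lam * t')"
    proof -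
      have "D * 1 \<le> D * exp (lam * t')" using D lam t' by (intro mult_left_mono) auto
      then show ?thesis using z_init by linarith
    qed
    ultimately show "norm (z t') \<le> (D + \<beta> + N / 2) * exp (lam * t')"
      using norm_triangle_sub[of "z t'" "z 0"] by (simp add: algebra_simps)
  qed
  also have "\<dots> \<le> 2 * (D + \<beta>) * exp (lam * r)"
    using D \<beta> lam t by (intro mult_left_mono) auto
  also have "\<dots> = Cz0 * D" by (simp add: Cz0_def \<beta>_def lam_def \<alpha>_def E_def algebra_simps)
  finally show ?thesis .
qed

lemma Cz0_nonneg: "Cz0 \<ge> 0" unfolding Cz0_def by (intro mult_nonneg_nonneg add_nonneg_nonneg) auto

definition Cy0 :: real where "Cy0 = exp \<bar>c \<bullet> p\<bar> * (norm c * Cz0 + (2 + norm c))"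

lemma Cy0_nonneg: "Cy0 \<ge> 0" unfolding Cy0_def using Cz0_nonneg by (intro mult_nonneg_nonneg add_nonneg_nonneg) auto

lemma y_init_le:
  assumes t: "t \<in> {0..T}" "t \<le> r"
  shows "\<bar>y t\<bar> \<le> Cy0 * D"
proof -
  obtain s where s: "s \<in> {0..t}" "\<bar>y t\<bar> \<le> exp \<bar>c \<bullet> p\<bar> * (norm c * norm (z s) + (2 + norm c) * D)"
    using y_init_phase[OF t] by blast
  have "norm (z s) \<le> Cz0 * D" using z_init_phase[of s] s t by auto
  then have "exp \<bar>c \<bullet> p\<bar> * (norm c * norm (z s) + (2 + norm c) * D) \<le> exp \<bar>c \<bullet> p\<bar> * (norm c * (Cz0 * D) + (2 + norm c) * D)"
    by (intro mult_left_mono add_right_mono) auto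
  then show ?thesis using s(2) by (simp add: Cy0_def algebra_simps)
qed

section \<open>The observer error\<close>

text \<open>The error of the observer, which estimates the delayed state, and the error of the predicted
  output.\<close>

definition e :: "real \<Rightarrow> real ^ 'n" where "e t = z t - x (t - r)"
definition \<eta> :: "real \<Rightarrow> real" where "\<eta> t = c \<bullet> x (t - r) - w t"

lemma y_eq: "y t = c \<bullet> e t + \<eta> t" by (simp add: y_def e_def \<eta>_def inner_diff_right)

lemma xr_solves: "solves_on {r..} (\<lambda>t. x (t - r)) (\<lambda>t. A *v x (t - r) + (u (t - r - \<tau>) *\<^sub>R B + G *v d (t - r)))"
  using solves_on_shift[OF x_solves, of r] by simp

lemma z_solves_r: "solves_on {r..} z (\<lambda>t. A *v z t + (u (t - r - \<tau>) *\<^sub>R B + y t *\<^sub>R p))"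
  using r by (intro solves_on_subset[OF z_solves]) auto

lemma e_solves: "solves_on {r..} e (\<lambda>t. (A + outer p c) *v e t + (\<eta> t *\<^sub>R p - G *v d (t - r)))"
proof (rule solves_on_cong[OF solves_on_add[OF z_solves_r
        solves_on_linear[OF bounded_linear_minus[OF bounded_linear_ident] xr_solves half_line] half_line] _ _ half_line])
  show "e t = z t + - x (t - r)" for t by (simp add: e_def)
  show "(A + outer p c) *v e t + (\<eta> t *\<^sub>R p - G *v d (t - r)) = A *v z t + (u (t - r - \<tau>) *\<^sub>R B + y t *\<^sub>R p) +
        - (A *v x (t - r) + (u (t - r - \<tau>) *\<^sub>R B + G *v d (t - r)))" for t
    by (simp add: matrix_vector_mult_add_rdistrib outer_mult y_eq scaleR_add_left)
      (simp add: e_def matrix_vector_mult_diff_distrib)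
qed

text \<open>The coefficients of the data and of the error \<open>e\<close> in \<open>\<eta>_le\<close>.\<close>

definition \<eta>a :: real where "\<eta>a = exp 1 * (1 + (norm c + (norm c * Cz0 + Cy0)) * exp r + norm c * mnorm G * exp r)"
definition \<eta>b :: real where "\<eta>b = exp 1 * norm c * mnorm A"

lemma \<eta>a_nonneg: "\<eta>a \<ge> 0" unfolding \<eta>a_def using Cz0_nonneg Cy0_nonneg
  by (intro mult_nonneg_nonneg add_nonneg_nonneg) auto

lemma \<eta>b_nonneg: "\<eta>b \<ge> 0" unfolding \<eta>b_def by auto

lemma d_delayed_le:
  assumes "s \<in> {r..T}" shows "norm (d (s - r)) \<le> exp r * (D * exp (- \<sigma> * s))"
proof -
  have "norm (d (s - r)) \<le> D * exp (- \<sigma> * (s - r))" using assms r by (intro d_le) auto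
  also have "\<dots> \<le> D * (exp r * exp (- \<sigma> * s))" using D \<sigma> r by (intro mult_left_mono exp_shift) auto
  finally show ?thesis by (simp add: mult_ac)
qed

text \<open>In a sampling interval after \<open>r\<close>, \<open>\<eta>\<close> starts from the measurement error and changes
  for a time of at most \<open>T1\<close>. In the interval that contains \<open>r\<close>, it starts at the time
  \<open>r\<close> from the bound of the initial phase.\<close>

lemma \<eta>_le:
  assumes N: "N \<ge> 0" "\<And>s. s \<in> {r..T} \<Longrightarrow> norm (e s) \<le> N * exp (- \<sigma> * s)" and t: "t \<in> {r..T}"
  shows "\<bar>\<eta> t\<bar> \<le> (\<eta>a * D + T1 * \<eta>b * N) * exp (- \<sigma> * t)"
proof -
  obtain i where i: "\<theta> i \<le> t" "t < \<theta> (Suc i)" using grid_cell[OF grid_\<theta>, of t] t r by auto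
  define s0 where "s0 = max r (\<theta> i)"
  let ?S = "{s0..<\<theta> (Suc i)}"
  have s0: "s0 \<le> t" "r \<le> s0" "\<theta> i \<le> s0" "t \<le> s0 + T1" "s0 \<ge> 0"
    using i t \<theta>_step[of i] r by (auto simp: s0_def max_def simp del: sample_time.simps)
  have e1: "exp (- \<sigma> * s) \<le> exp 1 * exp (- \<sigma> * t)" if "s0 \<le> s" for s
    using \<sigma> s0 T1 that by (intro exp_shift) auto
  have mS: "?S \<in> sets lebesgue" by simp
  have 1: "solves_on ?S (\<lambda>t. c \<bullet> x (t - r)) (\<lambda>t. c \<bullet> (A *v x (t - r) + (u (t - r - \<tau>) *\<^sub>R B + G *v d (t - r))))"
    using s0 by (intro solves_on_linear[OF bounded_linear_inner_right] solves_on_subset[OF xr_solves]) auto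
  have 2: "solves_on ?S w (\<lambda>t. c \<bullet> (A *v z t) + (c \<bullet> B) * u (t - r - \<tau>))"
    using s0 by (intro solves_on_subset[OF w_solves]) auto
  have "solves_on ?S \<eta> (\<lambda>t. c \<bullet> (G *v d (t - r)) - c \<bullet> (A *v e t))"
  proof (rule solves_on_cong[OF solves_on_add[OF 1 solves_on_linear[OF bounded_linear_minus[OF bounded_linear_ident] 2 mS] mS] _ _ mS])
    show "\<eta> t = c \<bullet> x (t - r) + - w t" for t by (simp add: \<eta>_def)
    show "c \<bullet> (G *v d (t - r)) - c \<bullet> (A *v e t) = c \<bullet> (A *v x (t - r) + (u (t - r - \<tau>) *\<^sub>R B + G *v d (t - r))) +
         - (c \<bullet> (A *v z t) + c \<bullet> B * u (t - r - \<tau>))" for t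
      by (simp add: e_def matrix_vector_mult_diff_distrib inner_add_right inner_diff_right)
  qed
  then have I: "((\<lambda>t. c \<bullet> (G *v d (t - r)) - c \<bullet> (A *v e t)) has_integral \<eta> t - \<eta> s0) {s0..t}"
    using s0 i by (intro solves_on_has_integral[OF _ _ _ mS]) (auto simp del: sample_time.simps)
  define C where "C = norm c * mnorm G * (exp r * D * (exp 1 * exp (- \<sigma> * t))) + norm c * mnorm A * (N * (exp 1 * exp (- \<sigma> * t)))"
  have "norm (\<eta> t - \<eta> s0) \<le> C * (t - s0)"
  proof (rule has_integral_norm_le_const[OF I s0(1)])
    fix s assume s: "s0 \<le> s" "s < t"
    then have sr: "s \<in> {r..T}" using s0 t by auto
    have "norm (d (s - r)) \<le> exp r * (D * exp (- \<sigma> * s))" by (rule d_delayed_le[OF sr])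
    also have "\<dots> \<le> exp r * (D * (exp 1 * exp (- \<sigma> * t)))" using D e1[OF s(1)] by (intro mult_left_mono) auto
    finally have d: "norm (d (s - r)) \<le> exp r * D * (exp 1 * exp (- \<sigma> * t))" by (simp add: mult_ac)
    have "norm (e s) \<le> N * exp (- \<sigma> * s)" by (rule N(2)[OF sr])
    also have "\<dots> \<le> N * (exp 1 * exp (- \<sigma> * t))" using N(1) e1[OF s(1)] by (intro mult_left_mono) auto
    finally have es: "norm (e s) \<le> N * (exp 1 * exp (- \<sigma> * t))" .
    have cM: "\<bar>c \<bullet> (M *v v)\<bar> \<le> norm c * mnorm M * q" if "norm v \<le> q" for v :: "real ^ 'n" and M :: "real ^ 'n ^ 'n" and q
    proof -
      have "\<bar>c \<bullet> (M *v v)\<bar> \<le> norm c * norm (M *v v)" by (rule Cauchy_Schwarz_ineq2)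
      also have "\<dots> \<le> norm c * (mnorm M * norm v)" by (intro mult_left_mono norm_mult_mnorm) auto
      also have "\<dots> \<le> norm c * (mnorm M * q)" using that by (intro mult_left_mono) auto
      finally show ?thesis by (simp add: mult_ac)
    qed
    have "norm (c \<bullet> (G *v d (s - r)) - c \<bullet> (A *v e s)) \<le> \<bar>c \<bullet> (G *v d (s - r))\<bar> + \<bar>c \<bullet> (A *v e s)\<bar>"
      using norm_triangle_ineq4[of "c \<bullet> (G *v d (s - r))" "c \<bullet> (A *v e s)"] by simp
    also have "\<dots> \<le> C" unfolding C_def by (intro add_mono cM d es)
    finally show "norm (c \<bullet> (G *v d (s - r)) - c \<bullet> (A *v e s)) \<le> C" .
  qed
  also have "C * (t - s0) \<le> C * T1" using s0 D N(1) unfolding C_def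
    by (intro mult_left_mono add_nonneg_nonneg mult_nonneg_nonneg) auto
  finally have inc: "\<bar>\<eta> t - \<eta> s0\<bar> \<le> C * T1" by simp
  have start: "\<bar>\<eta> s0\<bar> \<le> exp 1 * (1 + (norm c + (norm c * Cz0 + Cy0)) * exp r) * D * exp (- \<sigma> * t)"
  proof (cases "\<theta> i \<le> r")
    case True
    then have "s0 = r" by (simp add: s0_def)
    have rT: "r \<in> {0..T}" using t r by auto
    have "\<bar>c \<bullet> x 0\<bar> \<le> norm c * D"
      using Cauchy_Schwarz_ineq2[of c "x 0"] mult_left_mono[OF x_init[of 0], of "norm c"] r by simp
    moreover have "\<bar>w r\<bar> \<le> (norm c * Cz0 + Cy0) * D"
    proof -
      have "\<bar>c \<bullet> z r\<bar> \<le> norm c * (Cz0 * D)"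
        using Cauchy_Schwarz_ineq2[of c "z r"] mult_left_mono[OF z_init_phase[OF rT], of "norm c"] by simp
      moreover have "w r = c \<bullet> z r - y r" by (simp add: y_def)
      ultimately show ?thesis using y_init_le[OF rT] by (simp add: algebra_simps)
    qed
    ultimately have "\<bar>\<eta> s0\<bar> \<le> (norm c + (norm c * Cz0 + Cy0)) * D"
      unfolding \<open>s0 = r\<close> \<eta>_def by (simp add: algebra_simps)
    also have "\<dots> \<le> (norm c + (norm c * Cz0 + Cy0)) * D * (exp r * (exp 1 * exp (- \<sigma> * t)))"
    proof -
      have "1 = exp (- \<sigma> * 0)" by simp
      also have "\<dots> \<le> exp r * exp (- \<sigma> * s0)" using \<open>s0 = r\<close> \<sigma> r by (intro exp_shift) auto
      also have "\<dots> \<le> exp r * (exp 1 * exp (- \<sigma> * t))" using e1[of s0] by (intro mult_left_mono) auto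
      finally have "1 \<le> exp r * (exp 1 * exp (- \<sigma> * t))" .
      from mult_left_mono[OF this, of "(norm c + (norm c * Cz0 + Cy0)) * D"] show ?thesis
        using D Cz0_nonneg Cy0_nonneg by simp
    qed
    also have "\<dots> \<le> exp 1 * (1 + (norm c + (norm c * Cz0 + Cy0)) * exp r) * D * exp (- \<sigma> * t)"
      using D by (simp add: algebra_simps)
    finally show ?thesis .
  next
    case False
    then have si: "s0 = \<theta> i" by (simp add: s0_def)
    have "i \<noteq> 0" using False r by (cases i) auto
    then obtain j where j: "i = Suc j" using not0_implies_Suc by blast
    have "\<bar>\<eta> s0\<bar> = \<bar>\<xi> (\<theta> i)\<bar>" unfolding \<eta>_def si j w_reset by simp
    also have "\<dots> \<le> D * exp (- \<sigma> * \<theta> i)" using \<theta>_nonneg[of i] i t by (intro \<xi>_le) auto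
    also have "\<dots> \<le> D * (exp 1 * exp (- \<sigma> * t))" using D e1[of s0] si by (intro mult_left_mono) auto
    also have "\<dots> \<le> exp 1 * (1 + (norm c + (norm c * Cz0 + Cy0)) * exp r) * D * exp (- \<sigma> * t)"
    proof -
      have "1 \<le> 1 + (norm c + (norm c * Cz0 + Cy0)) * exp r" using Cz0_nonneg Cy0_nonneg by simp
      from mult_left_mono[OF this, of "D * (exp 1 * exp (- \<sigma> * t))"] show ?thesis using D by (simp add: mult_ac)
    qed
    finally show ?thesis .
  qed
  have "C * T1 \<le> (exp 1 * norm c * mnorm G * exp r * D + T1 * \<eta>b * N) * exp (- \<sigma> * t)"
  proof -
    have "norm c * mnorm G * (exp r * D * (exp 1 * exp (- \<sigma> * t))) * T1 \<le> norm c * mnorm G * (exp r * D * (exp 1 * exp (- \<sigma> * t))) * 1"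
      using D T1 by (intro mult_left_mono) auto
    then show ?thesis by (simp add: C_def \<eta>b_def algebra_simps)
  qed
  then show ?thesis using inc start by (simp add: \<eta>a_def algebra_simps)
qed

lemma decay_ge_one: "s \<le> 0 \<Longrightarrow> 1 \<le> exp (- \<sigma> * s)"
  using \<sigma> by (simp add: mult_nonneg_nonpos)

definition Ce :: "real \<Rightarrow> real \<Rightarrow> real" where
  "Ce K \<mu> = 2 * (K * exp r * (Cz0 + 1) + 2 * K / \<mu> * (norm p * \<eta>a + mnorm G * exp r))"

lemma Ce_nonneg: "0 < K \<Longrightarrow> 0 < \<mu> \<Longrightarrow> Ce K \<mu> \<ge> 0"
  unfolding Ce_def using Cz0_nonneg \<eta>a_nonneg
  by (intro mult_nonneg_nonneg add_nonneg_nonneg divide_nonneg_nonneg) auto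

text \<open>The perturbation \<open>\<eta>\<close> contains \<open>e\<close> itself, with a factor proportional to \<open>T1\<close>; the
  assumption \<open>gain\<close> makes this loop a contraction.\<close>

lemma e_le:
  assumes "r \<le> T" and K: "0 < K" and \<mu>: "2 * \<sigma> \<le> \<mu>"
    and decay: "\<And>t v. t \<ge> 0 \<Longrightarrow> norm (matrix_exp (t *\<^sub>R (A + outer p c)) *v v) \<le> K * exp (- \<mu> * t) * norm v"
    and gain: "T1 * (2 * K / \<mu> * norm p * \<eta>b) \<le> 1 / 2"
    and t: "t \<in> {r..T}"
  shows "norm (e t) \<le> Ce K \<mu> * D * exp (- \<sigma> * t)"
proof -
  have \<mu>0: "\<mu> > 0" using \<mu> \<sigma> by simp
  define C where "C = (K * exp r * (Cz0 + 1) + 2 * K / \<mu> * (norm p * \<eta>a + mnorm G * exp r)) * D"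
  have er: "norm (e r) \<le> (Cz0 + 1) * D"
  proof -
    have "norm (e r) \<le> norm (z r) + norm (x 0)" unfolding e_def using norm_triangle_ineq4[of "z r" "x (r - r)"] by simp
    also have "\<dots> \<le> Cz0 * D + D" using r \<open>r \<le> T\<close> by (intro add_mono z_init_phase x_init) auto
    finally show ?thesis by (simp add: algebra_simps)
  qed
  have "norm (e t) \<le> 2 * C * exp (- \<sigma> * t)"
  proof (rule small_gain[where a=r and T=T, OF _ _ _ t])
    show "continuous_on {r..T} (\<lambda>t. norm (e t))"
      using solves_on_continuous[OF e_solves] by (intro continuous_intros) (auto intro: continuous_on_subset)
    show "0 \<le> C" unfolding C_def using K \<mu>0 Cz0_nonneg \<eta>a_nonneg D
      by (intro mult_nonneg_nonneg add_nonneg_nonneg divide_nonneg_nonneg) auto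
    fix N t assume N: "N \<ge> 0" "\<And>s. s \<in> {r..T} \<Longrightarrow> norm (e s) \<le> N * exp (- \<sigma> * s)" and t: "t \<in> {r..T}"
    define \<gamma> where "\<gamma> = norm p * (\<eta>a * D + T1 * \<eta>b * N) + mnorm G * (exp r * D)"
    have "norm (e t) \<le> (K * exp (\<sigma> * r) * norm (e r) + 2 * K / \<mu> * \<gamma>) * exp (- \<sigma> * t)"
    proof (rule decay_iss[OF K \<sigma>(1) \<mu> decay e_solves])
      show "0 \<le> \<gamma>" unfolding \<gamma>_def using N(1) D T1 \<eta>a_nonneg \<eta>b_nonneg
        by (intro mult_nonneg_nonneg add_nonneg_nonneg) auto
      fix s assume s: "s \<in> {r..t}"
      then have sT: "s \<in> {r..T}" using t by auto
      have "norm (\<eta> s *\<^sub>R p - G *v d (s - r)) \<le> norm (\<eta> s *\<^sub>R p) + norm (G *v d (s - r))"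
        by (rule norm_triangle_ineq4)
      also have "\<dots> \<le> norm p * ((\<eta>a * D + T1 * \<eta>b * N) * exp (- \<sigma> * s)) + mnorm G * (exp r * (D * exp (- \<sigma> * s)))"
      proof (rule add_mono)
        show "norm (\<eta> s *\<^sub>R p) \<le> norm p * ((\<eta>a * D + T1 * \<eta>b * N) * exp (- \<sigma> * s))"
          using mult_left_mono[OF \<eta>_le[OF N sT], of "norm p"] by (simp add: mult.commute[of _ "norm p"])
        show "norm (G *v d (s - r)) \<le> mnorm G * (exp r * (D * exp (- \<sigma> * s)))"
          by (rule order_trans[OF norm_mult_mnorm]) (intro mult_left_mono d_delayed_le sT mnorm_nonneg)
      qed
      also have "\<dots> = \<gamma> * exp (- \<sigma> * s)" by (simp add: \<gamma>_def algebra_simps)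
      finally show "norm (\<eta> s *\<^sub>R p - G *v d (s - r)) \<le> \<gamma> * exp (- \<sigma> * s)" .
    qed (use t in auto)
    also have "\<dots> \<le> (C + N / 2) * exp (- \<sigma> * t)"
    proof (rule mult_right_mono)
      have "\<sigma> * r \<le> r" using \<sigma> r mult_right_mono[of \<sigma> 1 r] by simp
      then have "K * exp (\<sigma> * r) * norm (e r) \<le> K * exp r * ((Cz0 + 1) * D)"
        using er K by (intro mult_mono) auto
      moreover have "2 * K / \<mu> * \<gamma> = 2 * K / \<mu> * (norm p * \<eta>a + mnorm G * exp r) * D + T1 * (2 * K / \<mu> * norm p * \<eta>b) * N"
        by (simp add: \<gamma>_def algebra_simps add_divide_distrib)
      moreover have "T1 * (2 * K / \<mu> * norm p * \<eta>b) * N \<le> 1 / 2 * N" using N(1) by (intro mult_right_mono gain) auto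
      moreover have "C = K * exp r * ((Cz0 + 1) * D) + 2 * K / \<mu> * (norm p * \<eta>a + mnorm G * exp r) * D"
        by (simp add: C_def algebra_simps)
      ultimately show "K * exp (\<sigma> * r) * norm (e r) + 2 * K / \<mu> * \<gamma> \<le> C + N / 2"
        by linarith
    qed simp
    finally show "norm (e t) \<le> (C + N / 2) * exp (- \<sigma> * t)" .
  qed
  then show ?thesis by (simp add: C_def Ce_def mult_ac)
qed

definition Cy :: "real \<Rightarrow> real \<Rightarrow> real" where
  "Cy K \<mu> = Cy0 * exp r + (norm c * Ce K \<mu> + \<eta>a + \<eta>b * Ce K \<mu>)"

lemma Cy_nonneg: "0 < K \<Longrightarrow> 0 < \<mu> \<Longrightarrow> Cy K \<mu> \<ge> 0"
  unfolding Cy_def using Cy0_nonneg \<eta>a_nonneg \<eta>b_nonneg Ce_nonneg[of K \<mu>] by simp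

lemma y_le:
  assumes K: "0 < K" and \<mu>: "2 * \<sigma> \<le> \<mu>"
    and decay: "\<And>t v. t \<ge> 0 \<Longrightarrow> norm (matrix_exp (t *\<^sub>R (A + outer p c)) *v v) \<le> K * exp (- \<mu> * t) * norm v"
    and gain: "T1 * (2 * K / \<mu> * norm p * \<eta>b) \<le> 1 / 2"
    and t: "t \<in> {0..T}"
  shows "\<bar>y t\<bar> \<le> Cy K \<mu> * D * exp (- \<sigma> * t)"
proof -
  have \<mu>0: "\<mu> > 0" using \<mu> \<sigma> by simp
  note nn = Cy0_nonneg \<eta>a_nonneg \<eta>b_nonneg Ce_nonneg[OF K \<mu>0] Cy_nonneg[OF K \<mu>0]
  show ?thesis
  proof (cases "t \<le> r")
    case True
    have "exp (- \<sigma> * 0) \<le> exp r * exp (- \<sigma> * t)" using \<sigma> r True by (intro exp_shift) auto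
    then have "Cy0 * D * 1 \<le> Cy0 * D * (exp r * exp (- \<sigma> * t))" using nn D by (intro mult_left_mono) auto
    moreover have "Cy0 * exp r * (D * exp (- \<sigma> * t)) \<le> Cy K \<mu> * (D * exp (- \<sigma> * t))"
      using nn D unfolding Cy_def by (intro mult_right_mono) auto
    ultimately show ?thesis using y_init_le[OF t True] by (simp add: mult_ac)
  next
    case False
    then have rT: "r \<le> T" and tr: "t \<in> {r..T}" using t by auto
    have el: "norm (e s) \<le> Ce K \<mu> * D * exp (- \<sigma> * s)" if "s \<in> {r..T}" for s
      by (rule e_le[OF rT K \<mu> _ gain that]) (rule decay)
    have "\<bar>\<eta> t\<bar> \<le> (\<eta>a * D + T1 * \<eta>b * (Ce K \<mu> * D)) * exp (- \<sigma> * t)"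
      using nn D el by (intro \<eta>_le tr) auto
    also have "\<dots> \<le> (\<eta>a * D + 1 * \<eta>b * (Ce K \<mu> * D)) * exp (- \<sigma> * t)"
      using nn D T1 by (intro mult_right_mono add_left_mono) auto
    finally have "\<bar>\<eta> t\<bar> \<le> (\<eta>a + \<eta>b * Ce K \<mu>) * (D * exp (- \<sigma> * t))" by (simp add: algebra_simps)
    moreover have "\<bar>c \<bullet> e t\<bar> \<le> norm c * Ce K \<mu> * (D * exp (- \<sigma> * t))"
      using Cauchy_Schwarz_ineq2[of c "e t"] mult_left_mono[OF el[OF tr], of "norm c"] by (simp add: mult_ac)
    ultimately have "\<bar>y t\<bar> \<le> (norm c * Ce K \<mu> + \<eta>a + \<eta>b * Ce K \<mu>) * (D * exp (- \<sigma> * t))"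
      unfolding y_eq by (simp add: algebra_simps)
    also have "\<dots> \<le> Cy K \<mu> * (D * exp (- \<sigma> * t))"
      using nn D unfolding Cy_def by (intro mult_right_mono) auto
    finally show ?thesis by (simp add: mult_ac)
  qed
qed

end

section \<open>The predictor\<close>

context closed_loop
begin

text \<open>The response at the time \<open>t\<close> to the input on the interval from \<open>a\<close> to \<open>a'\<close>.\<close>

definition J :: "real \<Rightarrow> real \<Rightarrow> real \<Rightarrow> real ^ 'n" where
  "J a a' t = integral {a..a'} (\<lambda>s. matrix_exp ((t - s) *\<^sub>R A) *v (u s *\<^sub>R B))"

text \<open>A prediction of $x(t+\tau)$ from the estimate $z(t)$ of $x(t-r)$ and the inputs that act
  in between.\<close>

definition P :: "real \<Rightarrow> real ^ 'n" where
  "P t = matrix_exp ((r + \<tau>) *\<^sub>R A) *v z t + J (t - (r + \<tau>)) t t"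

abbreviation q :: "real ^ 'n" where "q \<equiv> matrix_exp ((r + \<tau>) *\<^sub>R A) *v p"

lemma kernel_integrable:
  assumes "- (r + \<tau>) \<le> a"
  shows "(\<lambda>s. matrix_exp ((t - s) *\<^sub>R A) *v (u s *\<^sub>R B)) integrable_on {a..a'}"
proof -
  have "admissible (- r - \<tau>) (\<lambda>s. matrix_exp ((t - s) *\<^sub>R A) *v (u s *\<^sub>R B))"
    by (intro admissible_bilinear[OF bounded_bilinear_matrix_vector] continuous_on_matrix_exp continuous_intros
        admissible_linear[OF bounded_linear_scaleR_left u_admissible])
  from admissibleD(2)[OF this] show ?thesis using assms by simp
qed

lemma J_split:
  assumes "- (r + \<tau>) \<le> a" "a \<le> m" "m \<le> a'"
  shows "J a a' t = J a m t + J m a' t"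
  unfolding J_def
  using Henstock_Kurzweil_Integration.integral_combine[OF assms(2,3) kernel_integrable[OF assms(1)]] by simp

lemma J_has_integral:
  assumes "- (r + \<tau>) \<le> a"
  shows "((\<lambda>s. matrix_exp ((t - s) *\<^sub>R A) *v (u s *\<^sub>R B)) has_integral J a a' t) {a..a'}"
  unfolding J_def by (rule integrable_integral[OF kernel_integrable[OF assms]])

lemma J_exp:
  assumes "- (r + \<tau>) \<le> a"
  shows "matrix_exp (h *\<^sub>R A) *v J a a' t = J a a' (h + t)"
proof -
  have "((\<lambda>s. matrix_exp (h *\<^sub>R A) *v (matrix_exp ((t - s) *\<^sub>R A) *v (u s *\<^sub>R B))) has_integral
      matrix_exp (h *\<^sub>R A) *v J a a' t) {a..a'}"
    using has_integral_linear[OF J_has_integral[OF assms] matrix_vector_mul_bounded_linear] by (simp add: o_def)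
  then have "((\<lambda>s. matrix_exp ((h + t - s) *\<^sub>R A) *v (u s *\<^sub>R B)) has_integral
      matrix_exp (h *\<^sub>R A) *v J a a' t) {a..a'}"
    using matrix_exp_add[of h "t - _" A] by (simp only: matrix_vector_mul_assoc add_diff_eq)
  then show ?thesis unfolding J_def by (simp add: integral_unique)
qed

text \<open>The term $e^{AL}z(t)$ contains the response to the input on $[-L, t-L]$ through the delayed
  equation of \<open>z\<close>, and the integral in \<open>P\<close> adds the response to the input on $[t-L, t]$.
  Together they are the response of a system without delay.\<close>

lemma P_variation_of_constants:
  assumes t: "t \<ge> 0"
  shows "P t = matrix_exp (t *\<^sub>R A) *v P 0 + integral {0..t} (\<lambda>s. matrix_exp ((t - s) *\<^sub>R A) *v (u s *\<^sub>R B + y s *\<^sub>R q))"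
proof -
  let ?L = "r + \<tau>"
  have "((\<lambda>s. matrix_exp ((t - s) *\<^sub>R A) *v (u (s - r - \<tau>) *\<^sub>R B + y s *\<^sub>R p)) has_integral
     z t - matrix_exp (t *\<^sub>R A) *v z 0) {0..t}"
    using variation_of_constants[OF z_solves t] by simp
  from has_integral_linear[OF this matrix_vector_mul_bounded_linear[of "matrix_exp (?L *\<^sub>R A)"]]
  have 1: "((\<lambda>s. matrix_exp (?L *\<^sub>R A) *v (matrix_exp ((t - s) *\<^sub>R A) *v (u (s - r - \<tau>) *\<^sub>R B + y s *\<^sub>R p))) has_integral
     matrix_exp (?L *\<^sub>R A) *v z t - matrix_exp (?L *\<^sub>R A) *v (matrix_exp (t *\<^sub>R A) *v z 0)) {0..t}"
    by (simp add: o_def matrix_vector_mult_diff_distrib)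
  have ex: "matrix_exp (?L *\<^sub>R A) *v (matrix_exp (h *\<^sub>R A) *v v) = matrix_exp ((?L + h) *\<^sub>R A) *v v" 
    "matrix_exp (h *\<^sub>R A) *v (matrix_exp (?L *\<^sub>R A) *v v) = matrix_exp ((?L + h) *\<^sub>R A) *v v" for h and v :: "real ^ 'n"
    by (simp_all only: matrix_vector_mul_assoc matrix_exp_add[symmetric] add.commute)
  have "((\<lambda>s. matrix_exp ((t - (- ?L + s)) *\<^sub>R A) *v (u (- ?L + s) *\<^sub>R B)) has_integral J (- ?L) (t - ?L) t) {0..t}"
    using J_has_integral[of "- ?L" t "t - ?L"] 
      has_integral_shift_Icc_real[of "\<lambda>s. matrix_exp ((t - s) *\<^sub>R A) *v (u s *\<^sub>R B)" "- ?L" _ 0 t]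
    by (simp add: o_def algebra_simps)
  from has_integral_diff[OF 1 this]
  have 2: "((\<lambda>s. matrix_exp ((t - s) *\<^sub>R A) *v (y s *\<^sub>R q)) has_integral
     matrix_exp (?L *\<^sub>R A) *v z t - matrix_exp (?L *\<^sub>R A) *v (matrix_exp (t *\<^sub>R A) *v z 0) - J (- ?L) (t - ?L) t) {0..t}"
  proof (rule has_integral_eq[rotated])
    fix s
    have a: "matrix_exp (?L *\<^sub>R A) *v (matrix_exp ((t - s) *\<^sub>R A) *v (u (s - r - \<tau>) *\<^sub>R B + y s *\<^sub>R p))
       = matrix_exp ((?L + (t - s)) *\<^sub>R A) *v (u (s - r - \<tau>) *\<^sub>R B) + y s *\<^sub>R (matrix_exp ((?L + (t - s)) *\<^sub>R A) *v p)"
      by (simp only: ex matrix_vector_right_distrib matrix_vector_mult_scaleR)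
    have b: "matrix_exp ((t - s) *\<^sub>R A) *v (y s *\<^sub>R q) = y s *\<^sub>R (matrix_exp ((?L + (t - s)) *\<^sub>R A) *v p)"
      by (simp only: ex matrix_vector_mult_scaleR)
    have eqs: "s - r - \<tau> = - ?L + s" "?L + (t - s) = t - (- ?L + s)" by simp_all
    show "matrix_exp (?L *\<^sub>R A) *v (matrix_exp ((t - s) *\<^sub>R A) *v (u (s - r - \<tau>) *\<^sub>R B + y s *\<^sub>R p)) -
         matrix_exp ((t - (- ?L + s)) *\<^sub>R A) *v (u (- ?L + s) *\<^sub>R B) = matrix_exp ((t - s) *\<^sub>R A) *v (y s *\<^sub>R q)"
      unfolding a b unfolding eqs by (rule add_diff_cancel_left')
  qed
  have "0 \<ge> - ?L" using L by simp
  from has_integral_add[OF J_has_integral[OF this, of t t] 2]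
  have i1: "integral {0..t} (\<lambda>s. matrix_exp ((t - s) *\<^sub>R A) *v (u s *\<^sub>R B + y s *\<^sub>R q)) =
     J 0 t t + (matrix_exp (?L *\<^sub>R A) *v z t - matrix_exp (?L *\<^sub>R A) *v (matrix_exp (t *\<^sub>R A) *v z 0) - J (- ?L) (t - ?L) t)"
    by (intro integral_unique) (simp add: matrix_vector_right_distrib)
  have i2: "matrix_exp (t *\<^sub>R A) *v P 0 = matrix_exp (?L *\<^sub>R A) *v (matrix_exp (t *\<^sub>R A) *v z 0) + J (- ?L) 0 t"
    unfolding P_def matrix_vector_right_distrib ex using J_exp[of "- ?L" t 0 0] by simp
  have i3: "J (- ?L) 0 t + J 0 t t = J (- ?L) (t - ?L) t + J (t - ?L) t t"
    using J_split[of "- ?L" 0 t t] J_split[of "- ?L" "t - ?L" t t] t L by simp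
  have alg: "X + J3 = Pz + I" if "I = a + (X - X' - J1)" "Pz = X' + J2" "J2 + a = J1 + J3"
    for X X' J1 J2 J3 Pz I a :: "real ^ 'n"
  proof -
    have "J3 = J2 + a - J1" using that(3) by (simp add: eq_diff_eq add.commute)
    then show ?thesis using that(1,2) by simp
  qed
  show ?thesis unfolding P_def[of t] by (rule alg[OF i1 i2 i3])
qed

lemma P_solves: "solves_on {0..} P (\<lambda>t. A *v P t + (u t *\<^sub>R B + y t *\<^sub>R q))"
proof (rule solves_on_of_variation_of_constants[where init="P 0"])
  have "admissible 0 u" using admissible_mono[OF u_admissible] r \<tau> by simp
  then show "admissible 0 (\<lambda>t. u t *\<^sub>R B + y t *\<^sub>R q)"
    by (intro admissible_add admissible_linear[OF bounded_linear_scaleR_left] y_admissible)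
qed (rule P_variation_of_constants)

lemma u_cell:
  assumes "real i * T2 \<le> t" "t < real (Suc i) * T2"
  shows "u t = k \<bullet> P (real i * T2)"
proof -
  let ?L = "r + \<tau>" and ?\<rho> = "real i * T2"
  have \<rho>: "?\<rho> \<ge> 0" using T2 by simp
  have "((\<lambda>s. matrix_exp ((?\<rho> - (?\<rho> + s)) *\<^sub>R A) *v (u (?\<rho> + s) *\<^sub>R B)) has_integral J (?\<rho> - ?L) ?\<rho> ?\<rho>) {- r - \<tau>..0}"
    using J_has_integral[of "?\<rho> - ?L" ?\<rho> ?\<rho>] \<rho>
      has_integral_shift_Icc_real[of "\<lambda>s. matrix_exp ((?\<rho> - s) *\<^sub>R A) *v (u s *\<^sub>R B)" ?\<rho> _ "- r - \<tau>" 0]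
    by (simp add: o_def algebra_simps)
  from has_integral_linear[OF this bounded_linear_inner_right[of k]]
  have "integral {- r - \<tau>..0} (\<lambda>s. k \<bullet> (matrix_exp ((- s) *\<^sub>R A) *v (u (?\<rho> + s) *\<^sub>R B))) = k \<bullet> J (?\<rho> - ?L) ?\<rho> ?\<rho>"
    by (intro integral_unique) (simp add: o_def)
  moreover have "t \<in> {?\<rho>..<(real i + 1) * T2}" using assms by (simp add: algebra_simps)
  ultimately show ?thesis
    using feedback unfolding feedback_def P_def by (simp add: inner_add_right)
qed

end

context closed_loop_data
begin

definition CP :: "real \<Rightarrow> real \<Rightarrow> real \<Rightarrow> real \<Rightarrow> real" where
  "CP K \<mu> M Y = 2 * (K * (M + (r + \<tau>) * (M * norm B))
     + 2 * K / \<mu> * (norm B * norm k * exp 1 * (M * norm p * Y) + M * norm p * Y))"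

text \<open>The last assumption limits the holding period; \<open>Y\<close> is the bound of the injection term
  that \<open>y_le\<close> provides.\<close>

context
  fixes K \<mu> M Y :: real
  assumes K: "0 < K" and \<mu>: "2 * \<sigma> \<le> \<mu>"
    and decay: "\<And>t v. t \<ge> 0 \<Longrightarrow> norm (matrix_exp (t *\<^sub>R (A + outer B k)) *v v) \<le> K * exp (- \<mu> * t) * norm v"
    and M: "0 \<le> M" "\<And>s v. s \<in> {- (r + \<tau>)..r + \<tau>} \<Longrightarrow> norm (matrix_exp (s *\<^sub>R A) *v v) \<le> M * norm v"
    and Y: "0 \<le> Y" "\<And>t. t \<in> {0..T} \<Longrightarrow> \<bar>y t\<bar> \<le> Y * D * exp (- \<sigma> * t)"
    and gain: "T2 * (2 * K / \<mu> * norm B * norm k * exp 1 * (mnorm A + norm k * norm B)) \<le> 1 / 2"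
begin

lemma \<mu>_pos: "\<mu> > 0" using \<mu> \<sigma> by simp

lemma CP_nonneg: "CP K \<mu> M Y \<ge> 0"
  unfolding CP_def using K \<mu>_pos M(1) Y(1) r \<tau>
  by (intro mult_nonneg_nonneg add_nonneg_nonneg divide_nonneg_nonneg) auto

lemma norm_q_le: "norm q \<le> M * norm p"
  using M(2)[of "r + \<tau>" p] L by simp

lemma yq_le:
  assumes "t \<in> {0..T}" shows "norm (y t *\<^sub>R q) \<le> M * norm p * Y * D * exp (- \<sigma> * t)"
proof -
  have "norm (y t *\<^sub>R q) \<le> (Y * D * exp (- \<sigma> * t)) * (M * norm p)"
    unfolding norm_scaleR by (intro mult_mono Y(2)[OF assms] norm_q_le) (use Y(1) D in auto)
  then show ?thesis by (simp add: mult_ac)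
qed

lemma J_le:
  assumes "- (r + \<tau>) \<le> a" "a \<le> a'" "0 \<le> C"
    and ts: "\<And>s. a \<le> s \<Longrightarrow> s < a' \<Longrightarrow> t - s \<in> {- (r + \<tau>)..r + \<tau>}" "\<And>s. a \<le> s \<Longrightarrow> s < a' \<Longrightarrow> \<bar>u s\<bar> \<le> C"
  shows "norm (J a a' t) \<le> M * norm B * C * (a' - a)"
proof (rule has_integral_norm_le_const[OF J_has_integral[OF assms(1)] assms(2)])
  fix s assume s: "a \<le> s" "s < a'"
  have "norm (matrix_exp ((t - s) *\<^sub>R A) *v (u s *\<^sub>R B)) \<le> M * norm (u s *\<^sub>R B)" by (rule M(2)[OF ts(1)[OF s]])
  also have "\<dots> \<le> M * (C * norm B)" unfolding norm_scaleR using M(1) ts(2)[OF s]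
    by (intro mult_left_mono mult_right_mono) auto
  finally show "norm (matrix_exp ((t - s) *\<^sub>R A) *v (u s *\<^sub>R B)) \<le> M * norm B * C" by (simp add: mult_ac)
qed

lemma P_init: "norm (P 0) \<le> (M + (r + \<tau>) * (M * norm B)) * D"
proof -
  have "norm (matrix_exp ((r + \<tau>) *\<^sub>R A) *v z 0) \<le> M * norm (z 0)" using L by (intro M(2)) auto
  also have "\<dots> \<le> M * D" using M(1) z_init by (intro mult_left_mono)
  finally have 1: "norm (matrix_exp ((r + \<tau>) *\<^sub>R A) *v z 0) \<le> M * D" .
  have 2: "norm (J (0 - (r + \<tau>)) 0 0) \<le> M * norm B * D * (0 - (0 - (r + \<tau>)))"
    using L D by (intro J_le u_init) auto
  have "norm (P 0) \<le> M * D + M * norm B * D * (0 - (0 - (r + \<tau>)))"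
    unfolding P_def by (rule norm_triangle_mono[OF 1 2])
  then show ?thesis by (simp add: algebra_simps)
qed

lemma feedback_cell:
  assumes "t \<ge> 0"
  obtains \<rho> where "0 \<le> \<rho>" "\<rho> \<le> t" "t - T2 \<le> \<rho>" "\<And>s. s \<in> {\<rho>..t} \<Longrightarrow> u s = k \<bullet> P \<rho>"
proof -
  obtain i where i: "real i * T2 \<le> t" "t < real (Suc i) * T2"
    using grid_cell[OF grid_multiples[OF T2(1)] assms] by blast
  show ?thesis
  proof (rule that[of "real i * T2"])
    show "u s = k \<bullet> P (real i * T2)" if "s \<in> {real i * T2..t}" for s
      using that i by (intro u_cell) auto
  qed (use i T2 in \<open>auto simp: algebra_simps\<close>)
qed

text \<open>With $A+Bk'$ as the system matrix, \<open>P\<close> is driven by \<open>y\<close> and by the hold error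
  $Bk'(P(\rho) - P(t))$, where $\rho$ is the last hold instant. Over a time of at most \<open>T2\<close>, \<open>P\<close>
  changes by at most \<open>T2\<close> times its derivative, so the gain of this loop is proportional to
  \<open>T2\<close>.\<close>

lemma P_le:
  assumes t: "t \<in> {0..T}"
  shows "norm (P t) \<le> CP K \<mu> M Y * D * exp (- \<sigma> * t)"
proof -
  define C where "C = (K * (M + (r + \<tau>) * (M * norm B))
     + 2 * K / \<mu> * (norm B * norm k * exp 1 * (M * norm p * Y) + M * norm p * Y)) * D"
  have "norm (P t) \<le> 2 * C * exp (- \<sigma> * t)"
  proof (rule small_gain[where a=0 and T=T, OF _ _ _ t])
    show "continuous_on {0..T} (\<lambda>t. norm (P t))"
      using solves_on_continuous[OF P_solves] by (intro continuous_intros) (auto intro: continuous_on_subset)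
    show "0 \<le> C" unfolding C_def using K \<mu>_pos M(1) Y(1) r \<tau> D
      by (intro mult_nonneg_nonneg add_nonneg_nonneg divide_nonneg_nonneg) auto
    fix N t assume N: "N \<ge> 0" "\<And>s. s \<in> {0..T} \<Longrightarrow> norm (P s) \<le> N * exp (- \<sigma> * s)" and t: "t \<in> {0..T}"
    define W where "W = (mnorm A + norm k * norm B) * N + M * norm p * Y * D"
    define \<gamma> where "\<gamma> = norm B * (norm k * (T2 * (exp 1 * W))) + M * norm p * Y * D"
    have W: "W \<ge> 0" unfolding W_def using N(1) M(1) Y(1) D
      by (intro mult_nonneg_nonneg add_nonneg_nonneg) auto
    have f: "solves_on {0..} P (\<lambda>t. (A + outer B k) *v P t + ((u t - k \<bullet> P t) *\<^sub>R B + y t *\<^sub>R q))"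
      by (rule solves_on_cong[OF P_solves _ _ half_line])
        (simp_all add: matrix_vector_mult_add_rdistrib outer_mult scaleR_diff_left)
    have "norm (P t) \<le> (K * exp (\<sigma> * 0) * norm (P 0) + 2 * K / \<mu> * \<gamma>) * exp (- \<sigma> * t)"
    proof (rule decay_iss[OF K \<sigma>(1) \<mu> decay f])
      show "0 \<le> \<gamma>" unfolding \<gamma>_def using W M(1) Y(1) D T2
        by (intro mult_nonneg_nonneg add_nonneg_nonneg) auto
      fix s assume s: "s \<in> {0..t}"
      then have sT: "s \<in> {0..T}" using t by auto
      obtain \<rho> where \<rho>: "0 \<le> \<rho>" "\<rho> \<le> s" "s - T2 \<le> \<rho>" "\<And>s'. s' \<in> {\<rho>..s} \<Longrightarrow> u s' = k \<bullet> P \<rho>"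
        using feedback_cell[of s] s by auto
      have e1: "exp (- \<sigma> * s') \<le> exp 1 * exp (- \<sigma> * s)" if "\<rho> \<le> s'" for s'
        using that \<rho> T2 \<sigma> by (intro exp_shift) auto
      have I: "((\<lambda>t. A *v P t + (u t *\<^sub>R B + y t *\<^sub>R q)) has_integral P s - P \<rho>) {\<rho>..s}"
        using \<rho> by (intro solves_on_has_integral[OF P_solves]) auto
      have "norm (P s - P \<rho>) \<le> W * (exp 1 * exp (- \<sigma> * s)) * (s - \<rho>)"
      proof (rule has_integral_norm_le_const[OF I \<rho>(2)])
        fix s' assume s': "\<rho> \<le> s'" "s' < s"
        let ?E = "exp 1 * exp (- \<sigma> * s)"
        have s'T: "s' \<in> {0..T}" "\<rho> \<in> {0..T}" using s' \<rho> sT by auto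
        have "norm (P s') \<le> N * ?E" "norm (P \<rho>) \<le> N * ?E"
          using N(2)[OF s'T(1)] N(2)[OF s'T(2)] mult_left_mono[OF e1[OF s'(1)] N(1)] mult_left_mono[OF e1[OF order_refl] N(1)]
          by linarith+
        then have 1: "norm (A *v P s') \<le> mnorm A * (N * ?E)" and 2: "\<bar>k \<bullet> P \<rho>\<bar> \<le> norm k * (N * ?E)"
          using norm_mult_mnorm[of A "P s'"] mult_left_mono[of "norm (P s')" "N * ?E" "mnorm A"]
            Cauchy_Schwarz_ineq2[of k "P \<rho>"] mult_left_mono[of "norm (P \<rho>)" "N * ?E" "norm k"]
          by auto
        have 3: "norm (u s' *\<^sub>R B) \<le> norm k * (N * ?E) * norm B"
          unfolding norm_scaleR using 2 \<rho>(4)[of s'] s' by (intro mult_right_mono) auto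
        have "M * norm p * Y * D * exp (- \<sigma> * s') \<le> M * norm p * Y * D * ?E"
          using M(1) Y(1) D by (intro mult_left_mono e1 s') auto
        then have 4: "norm (y s' *\<^sub>R q) \<le> M * norm p * Y * D * ?E" using yq_le[OF s'T(1)] by linarith
        have "norm (A *v P s' + (u s' *\<^sub>R B + y s' *\<^sub>R q)) \<le> mnorm A * (N * ?E) + (norm k * (N * ?E) * norm B + M * norm p * Y * D * ?E)"
          by (intro norm_triangle_mono 1 3 4)
        then show "norm (A *v P s' + (u s' *\<^sub>R B + y s' *\<^sub>R q)) \<le> W * ?E" by (simp add: W_def algebra_simps)
      qed
      also have "\<dots> \<le> W * (exp 1 * exp (- \<sigma> * s)) * T2" using W \<rho> by (intro mult_left_mono) auto
      finally have diff: "norm (P \<rho> - P s) \<le> W * (exp 1 * exp (- \<sigma> * s)) * T2" by (simp add: norm_minus_commute)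
      have "\<bar>u s - k \<bullet> P s\<bar> \<le> norm k * (W * (exp 1 * exp (- \<sigma> * s)) * T2)"
        using \<rho>(4)[of s] \<rho>(2) Cauchy_Schwarz_ineq2[of k "P \<rho> - P s"] mult_left_mono[OF diff, of "norm k"]
        by (simp add: inner_diff_right)
      then have "norm ((u s - k \<bullet> P s) *\<^sub>R B) \<le> norm k * (W * (exp 1 * exp (- \<sigma> * s)) * T2) * norm B"
        unfolding norm_scaleR by (intro mult_right_mono) auto
      from norm_triangle_mono[OF this yq_le[OF sT]]
      show "norm ((u s - k \<bullet> P s) *\<^sub>R B + y s *\<^sub>R q) \<le> \<gamma> * exp (- \<sigma> * s)"
        by (simp add: \<gamma>_def algebra_simps)
    qed (use t in auto)
    also have "\<dots> \<le> (C + N / 2) * exp (- \<sigma> * t)"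
    proof (rule mult_right_mono)
      have "K * exp (\<sigma> * 0) * norm (P 0) \<le> K * ((M + (r + \<tau>) * (M * norm B)) * D)"
        using P_init K by simp
      moreover have "2 * K / \<mu> * \<gamma> = 2 * K / \<mu> * (norm B * norm k * exp 1 * (M * norm p * Y * (T2 * D)) + M * norm p * Y * D)
          + T2 * (2 * K / \<mu> * norm B * norm k * exp 1 * (mnorm A + norm k * norm B)) * N"
        by (simp add: \<gamma>_def W_def algebra_simps add_divide_distrib)
      moreover have "2 * K / \<mu> * (norm B * norm k * exp 1 * (M * norm p * Y * (T2 * D)) + M * norm p * Y * D)
         \<le> 2 * K / \<mu> * (norm B * norm k * exp 1 * (M * norm p * Y * (1 * D)) + M * norm p * Y * D)"
        using K \<mu>_pos M(1) Y(1) D T2 by (intro mult_left_mono add_right_mono mult_right_mono) auto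
      moreover have "T2 * (2 * K / \<mu> * norm B * norm k * exp 1 * (mnorm A + norm k * norm B)) * N \<le> 1 / 2 * N"
        using N(1) by (intro mult_right_mono gain) auto
      moreover have "C = K * ((M + (r + \<tau>) * (M * norm B)) * D)
          + 2 * K / \<mu> * (norm B * norm k * exp 1 * (M * norm p * Y * (1 * D)) + M * norm p * Y * D)"
        by (simp add: C_def algebra_simps)
      ultimately show "K * exp (\<sigma> * 0) * norm (P 0) + 2 * K / \<mu> * \<gamma> \<le> C + N / 2"
        by linarith
    qed simp
    finally show "norm (P t) \<le> (C + N / 2) * exp (- \<sigma> * t)" .
  qed
  then show ?thesis by (simp add: C_def CP_def mult_ac)
qed

definition Cu :: real where "Cu = 1 + exp 1 * norm k * CP K \<mu> M Y"

lemma Cu_nonneg: "Cu \<ge> 1" unfolding Cu_def using CP_nonneg by simp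

lemma u_le:
  assumes "s \<in> {- (r + \<tau>)..T}" shows "\<bar>u s\<bar> \<le> Cu * D * exp (- \<sigma> * s)"
proof (cases "s < 0")
  case True
  have "\<bar>u s\<bar> \<le> 1 * D * 1" using assms True u_init[of s] by simp
  also have "\<dots> \<le> Cu * D * exp (- \<sigma> * s)"
    using Cu_nonneg D decay_ge_one[of s] True by (intro mult_mono) auto
  finally show ?thesis .
next
  case False
  then obtain \<rho> where \<rho>: "0 \<le> \<rho>" "\<rho> \<le> s" "s - T2 \<le> \<rho>" "\<And>s'. s' \<in> {\<rho>..s} \<Longrightarrow> u s' = k \<bullet> P \<rho>"
    using feedback_cell[of s] by auto
  have "\<bar>u s\<bar> \<le> norm k * norm (P \<rho>)" using \<rho>(4)[of s] \<rho>(2) Cauchy_Schwarz_ineq2[of k "P \<rho>"] by simp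
  also have "\<dots> \<le> norm k * (CP K \<mu> M Y * D * exp (- \<sigma> * \<rho>))" using \<rho> assms by (intro mult_left_mono P_le) auto
  also have "\<dots> \<le> norm k * (CP K \<mu> M Y * D * (exp 1 * exp (- \<sigma> * s)))"
    using CP_nonneg D \<rho> T2 \<sigma> by (intro mult_left_mono exp_shift) auto
  also have "\<dots> = (exp 1 * norm k * CP K \<mu> M Y) * (D * exp (- \<sigma> * s))" by (simp add: mult_ac)
  also have "\<dots> \<le> Cu * (D * exp (- \<sigma> * s))" unfolding Cu_def using D by (intro mult_right_mono) auto
  finally show ?thesis by (simp add: mult_ac)
qed

definition Cz :: real where "Cz = M * (CP K \<mu> M Y + (r + \<tau>) * (M * norm B * (Cu * exp (r + \<tau>))))"

lemma Cz_nonneg: "Cz \<ge> 0" unfolding Cz_def using CP_nonneg Cu_nonneg M(1) r \<tau>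
  by (intro mult_nonneg_nonneg add_nonneg_nonneg) auto

text \<open>Solve the definition of \<open>P\<close> for \<open>z\<close>.\<close>

lemma z_le:
  assumes t: "t \<in> {0..T}" shows "norm (z t) \<le> Cz * D * exp (- \<sigma> * t)"
proof -
  let ?L = "r + \<tau>"
  have "matrix_exp ((- ?L) *\<^sub>R A) ** matrix_exp (?L *\<^sub>R A) = mat 1"
    using matrix_exp_inverse[of "- ?L" A] by (simp only: minus_minus)
  moreover have "matrix_exp (?L *\<^sub>R A) *v z t = P t - J (t - ?L) t t" by (simp add: P_def)
  ultimately have z: "z t = matrix_exp ((- ?L) *\<^sub>R A) *v (P t - J (t - ?L) t t)"
    by (metis matrix_vector_mul_assoc matrix_vector_mul_lid)
  have "norm (J (t - ?L) t t) \<le> M * norm B * (Cu * D * (exp ?L * exp (- \<sigma> * t))) * (t - (t - ?L))"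
  proof (rule J_le)
    fix s assume s: "t - ?L \<le> s" "s < t"
    have "\<bar>u s\<bar> \<le> Cu * D * exp (- \<sigma> * s)" using s t by (intro u_le) auto
    also have "\<dots> \<le> Cu * D * (exp ?L * exp (- \<sigma> * t))"
      using s Cu_nonneg D \<sigma> L by (intro mult_left_mono exp_shift) auto
    finally show "\<bar>u s\<bar> \<le> Cu * D * (exp ?L * exp (- \<sigma> * t))" .
  qed (use t L Cu_nonneg D in auto)
  then have "norm (P t - J (t - ?L) t t) \<le> CP K \<mu> M Y * D * exp (- \<sigma> * t) + M * norm B * (Cu * D * (exp ?L * exp (- \<sigma> * t))) * (t - (t - ?L))"
    using P_le[OF t] norm_triangle_ineq4[of "P t" "J (t - ?L) t t"] by linarith
  then have "M * norm (P t - J (t - ?L) t t) \<le> M * (CP K \<mu> M Y * D * exp (- \<sigma> * t) + M * norm B * (Cu * D * (exp ?L * exp (- \<sigma> * t))) * (t - (t - ?L)))"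
    using M(1) by (intro mult_left_mono)
  moreover have "norm (z t) \<le> M * norm (P t - J (t - ?L) t t)" unfolding z using L by (intro M(2)) auto
  ultimately have "norm (z t) \<le> M * (CP K \<mu> M Y * D * exp (- \<sigma> * t) + M * norm B * (Cu * D * (exp ?L * exp (- \<sigma> * t))) * (t - (t - ?L)))"
    by linarith
  then show ?thesis by (simp add: Cz_def algebra_simps)
qed

lemma w_le:
  assumes t: "t \<in> {0..T}" shows "\<bar>w t\<bar> \<le> (norm c * Cz + Y) * D * exp (- \<sigma> * t)"
proof -
  have "w t = c \<bullet> z t - y t" by (simp add: y_def)
  moreover have "\<bar>c \<bullet> z t\<bar> \<le> norm c * (Cz * D * exp (- \<sigma> * t))"
    using Cauchy_Schwarz_ineq2[of c "z t"] mult_left_mono[OF z_le[OF t], of "norm c"] by simp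
  ultimately have "\<bar>w t\<bar> \<le> norm c * (Cz * D * exp (- \<sigma> * t)) + Y * D * exp (- \<sigma> * t)" using Y(2)[OF t] by linarith
  then show ?thesis by (simp add: algebra_simps)
qed

definition Cx :: "real \<Rightarrow> real" where
  "Cx E = 1 + M * ((1 + Cz + E) * exp r) + r * (M * ((norm B * (Cu * exp \<tau>) + mnorm G) * exp r))"

lemma Cx_ge: "0 \<le> E \<Longrightarrow> 1 \<le> Cx E" unfolding Cx_def using Cz_nonneg Cu_nonneg M(1) r
  by (simp add: add_nonneg_nonneg)

text \<open>Up to the time \<open>T - r\<close> the state is $x(t) = z(t+r) - e(t+r)$; variation of constants
  over a time of at most \<open>r\<close> reaches \<open>T\<close>.\<close>

lemma x_le:
  assumes E: "0 \<le> E" "\<And>t. t \<in> {r..T} \<Longrightarrow> norm (e t) \<le> E * D * exp (- \<sigma> * t)"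
    and t: "t \<in> {- r..T}"
  shows "norm (x t) \<le> Cx E * D * exp (- \<sigma> * t)"
proof (cases "t \<le> 0")
  case True
  have "norm (x t) \<le> 1 * D * 1" using t True x_init[of t] by simp
  also have "\<dots> \<le> Cx E * D * exp (- \<sigma> * t)"
    using Cx_ge[OF E(1)] D decay_ge_one[OF True] by (intro mult_mono) auto
  finally show ?thesis .
next
  case False
  define a where "a = max 0 (t - r)"
  have a: "0 \<le> a" "a \<le> t" "t - r \<le> a" "t - a \<le> r" using False r by (auto simp: a_def)
  have xa: "norm (x a) \<le> (1 + Cz + E) * exp r * (D * exp (- \<sigma> * t))"
  proof (cases "t \<le> r")
    case True
    have "exp (- \<sigma> * 0) \<le> exp r * exp (- \<sigma> * t)" using True \<sigma> r by (intro exp_shift) auto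
    then have "(1 + Cz + E) * (D * 1) \<le> (1 + Cz + E) * (D * (exp r * exp (- \<sigma> * t)))"
      using D E(1) Cz_nonneg by (intro mult_left_mono) auto
    moreover have "norm (x a) \<le> D" using True r by (simp add: a_def x_init)
    moreover have "1 * D \<le> (1 + Cz + E) * D" using D E(1) Cz_nonneg by (intro mult_right_mono) auto
    ultimately show ?thesis by (simp add: mult_ac)
  next
    case False
    then have "a = t - r" by (simp add: a_def)
    then have "norm (x a) \<le> norm (z t) + norm (e t)"
      using norm_triangle_ineq4[of "z t" "e t"] by (simp add: e_def)
    also have "\<dots> \<le> Cz * D * exp (- \<sigma> * t) + E * D * exp (- \<sigma> * t)"
      using t False r by (intro add_mono z_le E(2)) auto
    also have "\<dots> = (Cz + E) * 1 * (D * exp (- \<sigma> * t))" by (simp add: algebra_simps)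
    also have "\<dots> \<le> (1 + Cz + E) * exp r * (D * exp (- \<sigma> * t))"
      using D E(1) Cz_nonneg r by (intro mult_right_mono mult_mono) auto
    finally show ?thesis .
  qed
  have I: "((\<lambda>s. matrix_exp ((t - s) *\<^sub>R A) *v (u (s - \<tau>) *\<^sub>R B + G *v d s)) has_integral
     x t - matrix_exp ((t - a) *\<^sub>R A) *v x a) {a..t}"
    using a by (intro variation_of_constants[OF x_solves]) auto
  define C where "C = M * ((norm B * (Cu * exp \<tau>) + mnorm G) * exp r) * (D * exp (- \<sigma> * t))"
  have "norm (x t - matrix_exp ((t - a) *\<^sub>R A) *v x a) \<le> C * (t - a)"
  proof (rule has_integral_norm_le_const[OF I a(2)])
    fix s assume s: "a \<le> s" "s < t"
    have er: "D * exp (- \<sigma> * s) \<le> D * (exp r * exp (- \<sigma> * t))"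
      using D s a r \<sigma> by (intro mult_left_mono exp_shift) auto
    have "\<bar>u (s - \<tau>)\<bar> \<le> Cu * D * exp (- \<sigma> * (s - \<tau>))" using s a t r \<tau> by (intro u_le) auto
    also have "\<dots> \<le> Cu * D * (exp \<tau> * exp (- \<sigma> * s))"
      using Cu_nonneg D \<sigma> \<tau> by (intro mult_left_mono exp_shift) auto
    also have "\<dots> = Cu * exp \<tau> * (D * exp (- \<sigma> * s))" by (simp add: mult_ac)
    also have "\<dots> \<le> Cu * exp \<tau> * (D * (exp r * exp (- \<sigma> * t)))"
      using Cu_nonneg by (intro mult_left_mono er) auto
    finally have 1: "norm (u (s - \<tau>) *\<^sub>R B) \<le> Cu * exp \<tau> * (D * (exp r * exp (- \<sigma> * t))) * norm B"
      unfolding norm_scaleR by (intro mult_right_mono) auto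
    have "norm (d s) \<le> D * (exp r * exp (- \<sigma> * t))" using d_le[of s] er s a t by auto
    then have 2: "norm (G *v d s) \<le> mnorm G * (D * (exp r * exp (- \<sigma> * t)))"
      using norm_mult_mnorm[of G "d s"] mult_left_mono[of "norm (d s)" _ "mnorm G"] by fastforce
    have "norm (matrix_exp ((t - s) *\<^sub>R A) *v (u (s - \<tau>) *\<^sub>R B + G *v d s)) \<le> M * norm (u (s - \<tau>) *\<^sub>R B + G *v d s)"
      using s a \<tau> by (intro M(2)) auto
    also have "\<dots> \<le> M * (Cu * exp \<tau> * (D * (exp r * exp (- \<sigma> * t))) * norm B + mnorm G * (D * (exp r * exp (- \<sigma> * t))))"
      using M(1) by (intro mult_left_mono norm_triangle_mono 1 2)
    also have "\<dots> = C" by (simp add: C_def algebra_simps)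
    finally show "norm (matrix_exp ((t - s) *\<^sub>R A) *v (u (s - \<tau>) *\<^sub>R B + G *v d s)) \<le> C" .
  qed
  also have "\<dots> \<le> C * r" using a Cu_nonneg M(1) D unfolding C_def
    by (intro mult_left_mono mult_nonneg_nonneg add_nonneg_nonneg) auto
  finally have 1: "norm (x t - matrix_exp ((t - a) *\<^sub>R A) *v x a) \<le> C * r" .
  have "norm (matrix_exp ((t - a) *\<^sub>R A) *v x a) \<le> M * norm (x a)" using a \<tau> by (intro M(2)) auto
  also have "\<dots> \<le> M * ((1 + Cz + E) * exp r * (D * exp (- \<sigma> * t)))" using M(1) xa by (intro mult_left_mono)
  finally have 2: "norm (matrix_exp ((t - a) *\<^sub>R A) *v x a) \<le> M * ((1 + Cz + E) * exp r * (D * exp (- \<sigma> * t)))" .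
  have "norm (x t) \<le> C * r + M * ((1 + Cz + E) * exp r * (D * exp (- \<sigma> * t)))"
    using norm_triangle_mono[OF 1 2] by simp
  also have "\<dots> \<le> D * exp (- \<sigma> * t) + (C * r + M * ((1 + Cz + E) * exp r * (D * exp (- \<sigma> * t))))" using D by simp
  also have "\<dots> = Cx E * D * exp (- \<sigma> * t)" by (simp add: C_def Cx_def algebra_simps)
  finally show ?thesis .
qed

end

end

section \<open>The exponential estimate\<close>

lemma sup_norm_le:
  assumes "S \<noteq> {}" "\<And>s. s \<in> S \<Longrightarrow> norm (f s) \<le> C" shows "sup_norm S f \<le> C"
  unfolding sup_norm_def by (rule cSUP_least[OF assms])

lemma norm_le_sup_norm:
  assumes "bounded (f ` S)" "s \<in> S" shows "norm (f s) \<le> sup_norm S f"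
proof -
  obtain C where "\<And>s. s \<in> S \<Longrightarrow> norm (f s) \<le> C" using assms(1) unfolding bounded_iff by blast
  then have "bdd_above ((\<lambda>s. norm (f s)) ` S)" by (intro bdd_aboveI2)
  then show ?thesis unfolding sup_norm_def using assms(2) by (intro cSUP_upper)
qed

lemma norm_le_weighted_SUP:
  fixes f :: "real \<Rightarrow> 'a::euclidean_space"
  assumes "f \<in> L_inf_loc {0..}" "0 < \<sigma>" "s \<in> {0..t}"
  shows "norm (f s) \<le> exp (\<sigma> * t) * (SUP s\<in>{0..t}. exp (- \<sigma> * (t - s)) * norm (f s)) * exp (- \<sigma> * s)"
proof -
  have "bounded (f ` {0..t})" using assms(1) by (auto simp: L_inf_loc_def)
  then obtain C where C: "\<And>s. s \<in> {0..t} \<Longrightarrow> norm (f s) \<le> C" unfolding bounded_iff by blast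
  have "bdd_above ((\<lambda>s. exp (- \<sigma> * (t - s)) * norm (f s)) ` {0..t})"
  proof (rule bdd_aboveI2)
    fix s assume s: "s \<in> {0..t}"
    then have "exp (- \<sigma> * (t - s)) * norm (f s) \<le> 1 * norm (f s)"
      using assms(2) by (intro mult_right_mono) auto
    then show "exp (- \<sigma> * (t - s)) * norm (f s) \<le> C" using C[OF s] by linarith
  qed
  then have "exp (- \<sigma> * (t - s)) * norm (f s) \<le> (SUP s\<in>{0..t}. exp (- \<sigma> * (t - s)) * norm (f s))"
    by (rule cSUP_upper[OF assms(3)])
  then have "exp (\<sigma> * (t - s)) * (exp (- \<sigma> * (t - s)) * norm (f s))
      \<le> exp (\<sigma> * (t - s)) * (SUP s\<in>{0..t}. exp (- \<sigma> * (t - s)) * norm (f s))"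
    by (rule mult_left_mono) simp
  moreover have "exp (\<sigma> * (t - s)) * (exp (- \<sigma> * (t - s)) * norm (f s)) = norm (f s)"
    unfolding mult.assoc[symmetric] exp_add[symmetric] by simp
  ultimately have le: "norm (f s) \<le> exp (\<sigma> * (t - s)) * (SUP s\<in>{0..t}. exp (- \<sigma> * (t - s)) * norm (f s))"
    by linarith
  have "exp (\<sigma> * (t - s)) = exp (\<sigma> * t) * exp (- \<sigma> * s)"
    unfolding exp_add[symmetric] by (simp add: algebra_simps)
  then show ?thesis using le by (simp only: mult_ac)
qed

lemma weighted_SUP_nonneg:
  fixes f :: "real \<Rightarrow> 'a::euclidean_space"
  assumes "f \<in> L_inf_loc {0..}" "0 < \<sigma>" "0 \<le> t"
  shows "0 \<le> (SUP s\<in>{0..t}. exp (- \<sigma> * (t - s)) * norm (f s))"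
proof -
  have "0 \<le> exp (\<sigma> * t) * (SUP s\<in>{0..t}. exp (- \<sigma> * (t - s)) * norm (f s)) * exp (- \<sigma> * t)"
    using norm_le_weighted_SUP[OF assms(1,2), of t t] assms(3) order_trans[OF norm_ge_zero] by auto
  then show ?thesis by (simp add: zero_le_mult_iff)
qed

lemma matrix_exp_bound:
  fixes A :: "real ^ 'n ^ 'n"
  shows "\<exists>M\<ge>0. \<forall>s\<in>{a..b}. \<forall>v. norm (matrix_exp (s *\<^sub>R A) *v v) \<le> M * norm v"
proof -
  have "continuous_on {a..b} (\<lambda>s. mnorm (matrix_exp (s *\<^sub>R A)))"
    unfolding mnorm_def by (intro continuous_intros continuous_on_matrix_exp)
  then have "bounded ((\<lambda>s. mnorm (matrix_exp (s *\<^sub>R A))) ` {a..b})"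
    by (intro compact_imp_bounded compact_continuous_image) auto
  then obtain C where C: "\<And>s. s \<in> {a..b} \<Longrightarrow> norm (mnorm (matrix_exp (s *\<^sub>R A))) \<le> C"
    unfolding bounded_iff by blast
  show ?thesis
  proof (intro exI[of _ "max C 0"] conjI ballI allI)
    fix s and v :: "real ^ 'n" assume s: "s \<in> {a..b}"
    have "mnorm (matrix_exp (s *\<^sub>R A)) * norm v \<le> max C 0 * norm v"
      using C[OF s] by (intro mult_right_mono) auto
    then show "norm (matrix_exp (s *\<^sub>R A) *v v) \<le> max C 0 * norm v"
      using norm_mult_mnorm[of "matrix_exp (s *\<^sub>R A)" v] by linarith
  qed simp
qed

lemma gain_bound:
  fixes g T :: real
  assumes "0 \<le> g" "0 < T" "T < 1 / (2 * (g + 1))"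
  shows "T * g \<le> 1 / 2"
proof -
  have "T * g \<le> T * (g + 1)" using assms by (intro mult_left_mono) auto
  also have "\<dots> \<le> 1 / 2" using assms by (simp add: field_simps)
  finally show ?thesis .
qed

context closed_loop_data
begin

definition Ctotal :: "real \<Rightarrow> real \<Rightarrow> real \<Rightarrow> real \<Rightarrow> real \<Rightarrow> real" where
  "Ctotal K \<mu> M Y E = Cz K \<mu> M Y + (norm c * Cz K \<mu> M Y + Y) + Cx K \<mu> M Y E * exp r + Cu K \<mu> M Y * exp (r + \<tau>)"

lemma state_le_of_error_le:
  assumes "0 < K" "2 * \<sigma> \<le> \<mu>"
    and "\<And>t v. t \<ge> 0 \<Longrightarrow> norm (matrix_exp (t *\<^sub>R (A + outer B k)) *v v) \<le> K * exp (- \<mu> * t) * norm v"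
    and "0 \<le> M" "\<And>s v. s \<in> {- (r + \<tau>)..r + \<tau>} \<Longrightarrow> norm (matrix_exp (s *\<^sub>R A) *v v) \<le> M * norm v"
    and "0 \<le> Y" "\<And>t. t \<in> {0..T} \<Longrightarrow> \<bar>y t\<bar> \<le> Y * D * exp (- \<sigma> * t)"
    and "T2 * (2 * K / \<mu> * norm B * norm k * exp 1 * (mnorm A + norm k * norm B)) \<le> 1 / 2"
    and E: "0 \<le> E" "\<And>t. t \<in> {r..T} \<Longrightarrow> norm (e t) \<le> E * D * exp (- \<sigma> * t)"
  shows "norm (z T) + \<bar>w T\<bar> + sup_norm {- r..0} (hist T x) + sup_norm {- r - \<tau>..<0} (hist T u)
     \<le> Ctotal K \<mu> M Y E * (D * exp (- \<sigma> * T))"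
proof -
  note ctx = assms(1-8)
  have "norm (z T) \<le> Cz K \<mu> M Y * D * exp (- \<sigma> * T)" using T by (intro z_le[OF ctx]) auto
  moreover have "\<bar>w T\<bar> \<le> (norm c * Cz K \<mu> M Y + Y) * D * exp (- \<sigma> * T)" using T by (intro w_le[OF ctx]) auto
  moreover have "sup_norm {- r..0} (hist T x) \<le> Cx K \<mu> M Y E * D * (exp r * exp (- \<sigma> * T))"
  proof (rule sup_norm_le)
    fix s assume s: "s \<in> {- r..0}"
    have "norm (hist T x s) \<le> Cx K \<mu> M Y E * D * exp (- \<sigma> * (T + s))"
      unfolding hist_def using s T by (intro x_le[OF ctx E]) auto
    also have "\<dots> \<le> Cx K \<mu> M Y E * D * (exp r * exp (- \<sigma> * T))"
      using Cx_ge[OF ctx E(1)] D \<sigma> r s by (intro mult_left_mono exp_shift) auto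
    finally show "norm (hist T x s) \<le> Cx K \<mu> M Y E * D * (exp r * exp (- \<sigma> * T))" .
  qed (use r in auto)
  moreover have "sup_norm {- r - \<tau>..<0} (hist T u) \<le> Cu K \<mu> M Y * D * (exp (r + \<tau>) * exp (- \<sigma> * T))"
  proof (rule sup_norm_le)
    fix s assume s: "s \<in> {- r - \<tau>..<0}"
    have "norm (hist T u s) \<le> Cu K \<mu> M Y * D * exp (- \<sigma> * (T + s))"
      unfolding hist_def real_norm_def using s T by (intro u_le[OF ctx]) auto
    also have "\<dots> \<le> Cu K \<mu> M Y * D * (exp (r + \<tau>) * exp (- \<sigma> * T))"
      using Cu_nonneg[OF ctx] D \<sigma> L s by (intro mult_left_mono exp_shift) auto
    finally show "norm (hist T u s) \<le> Cu K \<mu> M Y * D * (exp (r + \<tau>) * exp (- \<sigma> * T))" .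
  qed (use L in auto)
  ultimately show ?thesis by (simp add: Ctotal_def algebra_simps)
qed

lemma exponential_estimate:
  assumes K1: "0 < K1" "2 * \<sigma> \<le> \<mu>1"
    and decay1: "\<And>t v. t \<ge> 0 \<Longrightarrow> norm (matrix_exp (t *\<^sub>R (A + outer B k)) *v v) \<le> K1 * exp (- \<mu>1 * t) * norm v"
    and K2: "0 < K2" "2 * \<sigma> \<le> \<mu>2"
    and decay2: "\<And>t v. t \<ge> 0 \<Longrightarrow> norm (matrix_exp (t *\<^sub>R (A + outer p c)) *v v) \<le> K2 * exp (- \<mu>2 * t) * norm v"
    and M: "0 \<le> M" "\<And>s v. s \<in> {- (r + \<tau>)..r + \<tau>} \<Longrightarrow> norm (matrix_exp (s *\<^sub>R A) *v v) \<le> M * norm v"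
    and gain1: "T1 * (2 * K2 / \<mu>2 * norm p * (exp 1 * norm c * mnorm A)) \<le> 1 / 2"
    and gain2: "T2 * (2 * K1 / \<mu>1 * norm B * norm k * exp 1 * (mnorm A + norm k * norm B)) \<le> 1 / 2"
  shows "norm (z T) + \<bar>w T\<bar> + sup_norm {- r..0} (hist T x) + sup_norm {- r - \<tau>..<0} (hist T u)
     \<le> Ctotal K1 \<mu>1 M (Cy K2 \<mu>2) (Ce K2 \<mu>2) * (D * exp (- \<sigma> * T))"
proof (rule state_le_of_error_le[OF K1 _ M _ _ gain2])
  have \<mu>2: "\<mu>2 > 0" using K2 \<sigma> by simp
  have g1: "T1 * (2 * K2 / \<mu>2 * norm p * \<eta>b) \<le> 1 / 2" using gain1 unfolding \<eta>b_def .
  show "0 \<le> Cy K2 \<mu>2" by (rule Cy_nonneg[OF K2(1) \<mu>2])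
  show "0 \<le> Ce K2 \<mu>2" by (rule Ce_nonneg[OF K2(1) \<mu>2])
  show "\<bar>y t\<bar> \<le> Cy K2 \<mu>2 * D * exp (- \<sigma> * t)" if "t \<in> {0..T}" for t
    by (rule y_le[OF K2 _ g1 that]) (rule decay2)
  show "norm (e t) \<le> Ce K2 \<mu>2 * D * exp (- \<sigma> * t)" if "t \<in> {r..T}" for t
    by (rule e_le[OF _ K2 _ g1 that], use that in simp) (rule decay2)
qed (rule decay1)

end

theorem corollary3p1:
  fixes A G :: "real ^ 'n ^ 'n" and B c k p :: "real ^ 'n" and r \<tau> :: real
  assumes "r \<ge> 0" and "\<tau> \<ge> 0" and "r + \<tau> > 0"
    and "hurwitz (A + outer B k)" and "hurwitz (A + outer p c)"
  shows "\<exists>T1max>0. \<exists>T2max>0. \<forall>T1 T2. 0 < T1 \<and> T1 < T1max \<and> 0 < T2 \<and> T2 < T2max \<longrightarrow>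
    (\<exists>(\<sigma>::real) (\<Theta> :: nat \<Rightarrow> real) (M :: real \<Rightarrow> real).
       \<sigma> > 0 \<and> (\<forall>i\<in>{1..6}. \<Theta> i > 0) \<and>
       continuous_on {0..} M \<and> mono_on {0..} M \<and> (\<forall>s\<ge>0. M s \<ge> 0) \<and>
       (\<forall>(x0 :: real \<Rightarrow> real ^ 'n) (u0 :: real \<Rightarrow> real) (z0 :: real ^ 'n) (w0 :: real)
          (\<xi> :: real \<Rightarrow> real) (b :: real \<Rightarrow> real) (d :: real \<Rightarrow> real ^ 'n).
          continuous_on {- r..0} x0 \<and> u0 \<in> L_inf {- r - \<tau>..<0} \<and>
          \<xi> \<in> L_inf_loc {0..} \<and> b \<in> L_inf_loc {0..} \<and> (\<forall>t\<ge>0. b t \<ge> 0) \<and> d \<in> L_inf_loc {0..}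
          \<longrightarrow>
          (\<exists>x u z w. closed_loop_solution A B G c k p r \<tau> T1 T2 x0 u0 z0 w0 \<xi> b d x u z w) \<and>
          (\<forall>x u z w. closed_loop_solution A B G c k p r \<tau> T1 T2 x0 u0 z0 w0 \<xi> b d x u z w \<longrightarrow>
             (\<forall>t\<ge>0.
                let j = (LEAST i :: nat. real i * T2 \<ge> r + T1);
                    \<mu> = M (SUP s\<in>{0..real j * T2 + \<tau>}. b s)
                in norm (z t) + \<bar>w t\<bar> + sup_norm {- r..0} (hist t x)
                     + sup_norm {- r - \<tau>..<0} (hist t u)
                   \<le> exp (- \<sigma> * t) * \<mu> *
                        (\<Theta> 1 * norm z0 + \<Theta> 2 * \<bar>w0\<bar> + \<Theta> 3 * sup_norm {- r..0} x0
                           + \<Theta> 4 * sup_norm {- r - \<tau>..<0} u0)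
                     + \<mu> * \<Theta> 5 * (SUP s\<in>{0..t}. exp (- \<sigma> * (t - s)) * \<bar>\<xi> s\<bar>)
                     + \<mu> * \<Theta> 6 * (SUP s\<in>{0..t}. exp (- \<sigma> * (t - s)) * norm (d s))))))"
proof -
  obtain K1 \<mu>1 where K1: "\<mu>1 > 0" "K1 > 0"
    "\<And>t v. t \<ge> 0 \<Longrightarrow> norm (matrix_exp (t *\<^sub>R (A + outer B k)) *v v) \<le> K1 * exp (- \<mu>1 * t) * norm v"
    using hurwitz_matrix_exp_decay[OF assms(4)] by blast
  obtain K2 \<mu>2 where K2: "\<mu>2 > 0" "K2 > 0"
    "\<And>t v. t \<ge> 0 \<Longrightarrow> norm (matrix_exp (t *\<^sub>R (A + outer p c)) *v v) \<le> K2 * exp (- \<mu>2 * t) * norm v"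
    using hurwitz_matrix_exp_decay[OF assms(5)] by blast
  obtain M where M: "0 \<le> M" "\<And>s v. s \<in> {- (r + \<tau>)..r + \<tau>} \<Longrightarrow> norm (matrix_exp (s *\<^sub>R A) *v v) \<le> M * norm v"
    using matrix_exp_bound[of "- (r + \<tau>)" "r + \<tau>" A] by blast
  \<comment> \<open>Half of the smaller decay rate; the bound 1 makes the factors of time shifts independent of \<open>\<sigma>\<close>.\<close>
  define \<sigma> where "\<sigma> = min 1 (min \<mu>1 \<mu>2 / 2)"
  have \<sigma>: "0 < \<sigma>" "\<sigma> \<le> 1" "2 * \<sigma> \<le> \<mu>1" "2 * \<sigma> \<le> \<mu>2" using K1(1) K2(1) by (auto simp: \<sigma>_def)
  define g1 where "g1 = 2 * K2 / \<mu>2 * norm p * (exp 1 * norm c * mnorm A)"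
  define g2 where "g2 = 2 * K1 / \<mu>1 * norm B * norm k * exp 1 * (mnorm A + norm k * norm B)"
  have g: "0 \<le> g1" "0 \<le> g2" unfolding g1_def g2_def using K1 K2
    by (intro mult_nonneg_nonneg add_nonneg_nonneg divide_nonneg_nonneg; simp)+
  \<comment> \<open>The maximum with 1 makes the constants positive.\<close>
  define C where "C = max 1 (closed_loop_data.Ctotal G B c k p r \<tau> K1 \<mu>1 M
     (closed_loop_data.Cy A G B c p r K2 \<mu>2) (closed_loop_data.Ce A G B c p r K2 \<mu>2))"
  have C: "C > 0" by (simp add: C_def)
  have estimate: "norm (z t) + \<bar>w t\<bar> + sup_norm {- r..0} (hist t x) + sup_norm {- r - \<tau>..<0} (hist t u)
      \<le> exp (- \<sigma> * t) * 1 * (C * norm z0 + C * \<bar>w0\<bar> + C * sup_norm {- r..0} x0 + C * sup_norm {- r - \<tau>..<0} u0)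
        + 1 * C * (SUP s\<in>{0..t}. exp (- \<sigma> * (t - s)) * \<bar>\<xi> s\<bar>)
        + 1 * C * (SUP s\<in>{0..t}. exp (- \<sigma> * (t - s)) * norm (d s))"
    if T1: "0 < T1" "T1 < min 1 (1 / (2 * (g1 + 1)))" and T2: "0 < T2" "T2 < min 1 (1 / (2 * (g2 + 1)))"
      and x0: "continuous_on {- r..0} x0" and u0: "u0 \<in> L_inf {- r - \<tau>..<0}"
      and \<xi>: "\<xi> \<in> L_inf_loc {0..}" and b: "b \<in> L_inf_loc {0..}" "\<forall>t\<ge>0. b t \<ge> 0" and d: "d \<in> L_inf_loc {0..}"
      and sol: "closed_loop_solution A B G c k p r \<tau> T1 T2 x0 u0 z0 w0 \<xi> b d x u z w" and t: "0 \<le> t"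
    for T1 T2 x0 u0 z0 w0 \<xi> b d x u z w t
  proof -
    define S\<xi> where "S\<xi> = (SUP s\<in>{0..t}. exp (- \<sigma> * (t - s)) * \<bar>\<xi> s\<bar>)"
    define Sd where "Sd = (SUP s\<in>{0..t}. exp (- \<sigma> * (t - s)) * norm (d s))"
    define I where "I = norm z0 + \<bar>w0\<bar> + sup_norm {- r..0} x0 + sup_norm {- r - \<tau>..<0} u0"
    \<comment> \<open>The factor \<open>exp (\<sigma> * t)\<close> moves the weight of the suprema from \<open>exp (- \<sigma> * (t - s))\<close> to \<open>exp (\<sigma> * s)\<close>.\<close>
    define D where "D = I + exp (\<sigma> * t) * (S\<xi> + Sd)"
    have x0b: "bounded (x0 ` {- r..0})" using x0 by (intro compact_imp_bounded compact_continuous_image) auto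
    have u0b: "bounded (u0 ` {- r - \<tau>..<0})" using u0 by (simp add: L_inf_def)
    have nx0: "norm (x0 s) \<le> sup_norm {- r..0} x0" if "s \<in> {- r..0}" for s by (rule norm_le_sup_norm[OF x0b that])
    have nu0: "norm (u0 s) \<le> sup_norm {- r - \<tau>..<0} u0" if "s \<in> {- r - \<tau>..<0}" for s
      by (rule norm_le_sup_norm[OF u0b that])
    have pos: "0 \<le> sup_norm {- r..0} x0" "0 \<le> sup_norm {- r - \<tau>..<0} u0"
      using order_trans[OF norm_ge_zero nx0[of 0]] order_trans[OF norm_ge_zero nu0[of "- r - \<tau>"]] assms(1-3) by auto
    have Spos: "0 \<le> S\<xi>" "0 \<le> Sd"
      using weighted_SUP_nonneg[OF \<xi> \<sigma>(1) t] weighted_SUP_nonneg[OF d \<sigma>(1) t] by (simp_all add: S\<xi>_def Sd_def)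
    then have epos: "0 \<le> exp (\<sigma> * t) * S\<xi>" "0 \<le> exp (\<sigma> * t) * Sd" by simp_all
    have De: "D = I + exp (\<sigma> * t) * S\<xi> + exp (\<sigma> * t) * Sd" by (simp add: D_def algebra_simps)
    have Ipos: "0 \<le> I" using pos by (simp add: I_def)
    interpret loop: closed_loop_data A G B c k p r \<tau> T1 T2 u0 \<xi> b d x u z w t D \<sigma>
    proof
      show "r \<ge> 0" "\<tau> \<ge> 0" "r + \<tau> > 0" by fact+
      show "0 < T1" "T1 \<le> 1" "0 < T2" "T2 \<le> 1" using T1 T2 by auto
      show "u0 \<in> L_inf {- r - \<tau>..<0}" "b \<in> L_inf_loc {0..}" "0 \<le> t" "0 < \<sigma>" "\<sigma> \<le> 1" by fact+
      show "b t \<ge> 0" if "t \<ge> 0" for t using b that by blast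
      show us: "u s = u0 s" if "s \<in> {- r - \<tau>..<0}" for s
        using sol that unfolding closed_loop_solution_def hist_def by simp
      show "plant A B G \<tau> d x u" "observer A B c p r \<tau> T1 \<xi> b x u z w" "feedback A B k r \<tau> T2 u z"
        using sol by (simp_all add: closed_loop_solution_def)
      show "0 \<le> D" unfolding De using Ipos epos by simp
      have "norm z0 \<le> I" "\<bar>w0\<bar> \<le> I" using pos by (simp_all add: I_def)
      then show "norm (z 0) \<le> D" "\<bar>w 0\<bar> \<le> D" using sol epos unfolding De closed_loop_solution_def by auto
      show "norm (x s) \<le> D" if "s \<in> {- r..0}" for s
      proof -
        have "norm (x s) = norm (x0 s)" using sol that unfolding closed_loop_solution_def hist_def by simp
        moreover have "sup_norm {- r..0} x0 \<le> I" using pos by (simp add: I_def)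
        ultimately show ?thesis using nx0[OF that] epos unfolding De by linarith
      qed
      show "\<bar>u s\<bar> \<le> D" if "s \<in> {- r - \<tau>..<0}" for s
      proof -
        have "sup_norm {- r - \<tau>..<0} u0 \<le> I" using pos by (simp add: I_def)
        moreover have "\<bar>u s\<bar> = \<bar>u0 s\<bar>" by (simp add: us[OF that])
        ultimately show ?thesis using nu0[OF that] epos unfolding De real_norm_def by linarith
      qed
      show "\<bar>\<xi> s\<bar> \<le> D * exp (- \<sigma> * s)" if "s \<in> {0..t}" for s
      proof -
        have "\<bar>\<xi> s\<bar> \<le> exp (\<sigma> * t) * S\<xi> * exp (- \<sigma> * s)"
          using norm_le_weighted_SUP[OF \<xi> \<sigma>(1) that] by (simp add: S\<xi>_def)
        also have "\<dots> \<le> D * exp (- \<sigma> * s)" unfolding De using Ipos epos by (intro mult_right_mono) auto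
        finally show ?thesis .
      qed
      show "norm (d s) \<le> D * exp (- \<sigma> * s)" if "s \<in> {0..t}" for s
      proof -
        have "norm (d s) \<le> exp (\<sigma> * t) * Sd * exp (- \<sigma> * s)"
          using norm_le_weighted_SUP[OF d \<sigma>(1) that] by (simp add: Sd_def)
        also have "\<dots> \<le> D * exp (- \<sigma> * s)" unfolding De using Ipos epos by (intro mult_right_mono) auto
        finally show ?thesis .
      qed
    qed
    have "norm (z t) + \<bar>w t\<bar> + sup_norm {- r..0} (hist t x) + sup_norm {- r - \<tau>..<0} (hist t u)
       \<le> loop.Ctotal K1 \<mu>1 M (loop.Cy K2 \<mu>2) (loop.Ce K2 \<mu>2) * (D * exp (- \<sigma> * t))"
    proof (rule loop.exponential_estimate[OF K1(2) \<sigma>(3) _ K2(2) \<sigma>(4) _ M])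
      show "T1 * (2 * K2 / \<mu>2 * norm p * (exp 1 * norm c * mnorm A)) \<le> 1 / 2"
        using gain_bound[OF g(1) T1(1)] T1(2) unfolding g1_def by simp
      show "T2 * (2 * K1 / \<mu>1 * norm B * norm k * exp 1 * (mnorm A + norm k * norm B)) \<le> 1 / 2"
        using gain_bound[OF g(2) T2(1)] T2(2) unfolding g2_def by simp
    qed (use K1(3) K2(3) in blast)+
    also have "\<dots> \<le> C * (D * exp (- \<sigma> * t))"
      unfolding C_def using loop.D by (intro mult_right_mono) auto
    also have "D * exp (- \<sigma> * t) = exp (- \<sigma> * t) * I + S\<xi> + Sd"
    proof -
      have "exp (\<sigma> * t) * exp (- \<sigma> * t) = 1" unfolding exp_add[symmetric] by simp
      then have "exp (\<sigma> * t) * (S\<xi> + Sd) * exp (- \<sigma> * t) = S\<xi> + Sd"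
        by (metis mult.assoc mult.commute mult.left_neutral)
      then show ?thesis by (simp add: D_def algebra_simps)
    qed
    finally show ?thesis by (simp add: I_def S\<xi>_def Sd_def algebra_simps)
  qed
  \<comment> \<open>All \<open>\<Theta> i\<close> are \<open>C\<close> and \<open>M\<close> is the constant 1, as \<open>C\<close> serves every \<open>b\<close>.\<close>
  show ?thesis
  proof (rule exI[of _ "min 1 (1 / (2 * (g1 + 1)))"], rule conjI, use g in simp,
      rule exI[of _ "min 1 (1 / (2 * (g2 + 1)))"], rule conjI, use g in simp, intro allI impI,
      rule exI[of _ \<sigma>], rule exI[of _ "\<lambda>_. C"], rule exI[of _ "\<lambda>_. 1"], intro conjI allI impI ballI)
    fix T1 T2 assume T: "0 < T1 \<and> T1 < min 1 (1 / (2 * (g1 + 1))) \<and> 0 < T2 \<and> T2 < min 1 (1 / (2 * (g2 + 1)))"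
    fix x0 :: "real \<Rightarrow> real ^ 'n" and u0 :: "real \<Rightarrow> real" and z0 :: "real ^ 'n" and w0 :: real
      and \<xi> b :: "real \<Rightarrow> real" and d :: "real \<Rightarrow> real ^ 'n"
    assume a: "continuous_on {- r..0} x0 \<and> u0 \<in> L_inf {- r - \<tau>..<0} \<and>
        \<xi> \<in> L_inf_loc {0..} \<and> b \<in> L_inf_loc {0..} \<and> (\<forall>t\<ge>0. b t \<ge> 0) \<and> d \<in> L_inf_loc {0..}"
    show "\<exists>x u z w. closed_loop_solution A B G c k p r \<tau> T1 T2 x0 u0 z0 w0 \<xi> b d x u z w"
      using a T assms(1-3) by (intro closed_loop_exists) auto
    fix x :: "real \<Rightarrow> real ^ 'n" and u :: "real \<Rightarrow> real" and z :: "real \<Rightarrow> real ^ 'n"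
      and w :: "real \<Rightarrow> real" and t :: real
    assume "closed_loop_solution A B G c k p r \<tau> T1 T2 x0 u0 z0 w0 \<xi> b d x u z w" "0 \<le> (t::real)"
    with a T show "let j = (LEAST i :: nat. real i * T2 \<ge> r + T1);
                  \<mu> = 1
              in norm (z t) + \<bar>w t\<bar> + sup_norm {- r..0} (hist t x)
                   + sup_norm {- r - \<tau>..<0} (hist t u)
                 \<le> exp (- \<sigma> * t) * \<mu> *
                      (C * norm z0 + C * \<bar>w0\<bar> + C * sup_norm {- r..0} x0
                         + C * sup_norm {- r - \<tau>..<0} u0)
                   + \<mu> * C * (SUP s\<in>{0..t}. exp (- \<sigma> * (t - s)) * \<bar>\<xi> s\<bar>)
                   + \<mu> * C * (SUP s\<in>{0..t}. exp (- \<sigma> * (t - s)) * norm (d s))"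
      unfolding Let_def by (intro estimate) auto
  qed (use \<sigma>(1) C in \<open>auto simp: mono_on_def\<close>)
qed

end
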